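(* Let $m\ge 0$ be an integer, $\mathbf x=(x_1,\dots,x_{m+1})$, $\mathbf y=(y_1,\dots,y_{m+1})$, and put $\mathbf x'=(x_1,\dots,x_m)$, $\mathbf y'=(y_1,\dots,y_m)$. Then \[ Z_{\mathrm{HT}}(2m+1;\mathbf x,\mathbf y)=\frac{a\,x_{m+1}y_{m+1}}{\sigma(a)\,(a x_{m+1}+y_{m+1})(a y_{m+1}+x_{m+1})}\Big[Z(m+1;\mathbf x,\mathbf y)\,Z^{(2)}_{\mathrm{HT}}(2m;\mathbf x',\mathbf y')+Z(m;\mathbf x',\mathbf y')\,Z^{(2)}_{\mathrm{HT}}(2m+2;\mathbf x,\mathbf y)\Big]. \]
   Context: Notation: $\bar z=z^{-1}$, $\sigma(z)=z-z^{-1}$; $a$ is a fixed (generic) nonzero complex parameter. Vertex weights: at a vertex where a horizontal and a vertical line cross, the four incident edges are oriented with exactly two pointing into the vertex (ice rule). The vertex is of type 1 if both horizontal edges point into it and both vertical edges point out; type 2 if both horizontal edges point out and both vertical edges point in; type 3 if both horizontal edges point right and both vertical edges point up; type 4 if horizontal edges point left and vertical edges point down; type 5 if horizontal edges point left and vertical edges point up; type 6 if horizontal edges point right and vertical edges point down. A vertex with spectral parameter $z$ has weight $\sigma(a^2)$ (types 1,2), $\sigma(az)$ (types 3,4), $\sigma(a\bar z)$ (types 5,6). A state is an orientation of all internal edges obeying the ice rule at every vertex, its weight is the product of its vertex weights, and the partition function is the sum of weights of all states. Domain-wall model: $Z(n;\mathbf x,\mathbf y)$, $\mathbf x=(x_1,\dots,x_n)$,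 $\mathbf y=(y_1,\dots,y_n)$, is the partition function on the $n\times n$ grid of vertices $(i,j)$ (row $i$ from the top, column $j$ from the left), vertex $(i,j)$ having spectral parameter $x_i\bar y_j$; horizontal boundary edges (left of column 1, right of column $n$) point into the grid, vertical boundary edges (above row 1, below row $n$) point out of the grid. $Z(0)=1$. Even half-turn model: for $\mathbf x=(x_1,\dots,x_m)$, $\mathbf y=(y_1,\dots,y_m)$, $Z_{\mathrm{HT}}(2m;\mathbf x,\mathbf y)$ is the partition function on the grid of vertices $(r,j)$, $1\le r\le 2m$ (from the top), $1\le j\le m$; vertex $(r,j)$ has spectral parameter $x_{i(r)}\bar y_j$ with $i(r)=\min(r,2m+1-r)$; left boundary edges point right (into the grid), top boundary edges point up, bottom boundary edges point down; for each $r\le m$ the edge to the right of vertex $(r,m)$ and the edge to the right of vertex $(2m+1-r,m)$ are one single edge (a U-turn) with one orientation (pointing out of one of these two vertices and into the other). $Z_{\mathrm{HT}}(0)=1$. Define $Z^{(2)}_{\mathrm{HT}}(2m;\mathbf x,\mathbf y)=Z_{\mathrm{HT}}(2m;\mathbf x,\mathbf y)/Z(m;\mathbf x,\mathbf y)$ (so $Z^{(2)}_{\mathrm{HT}}(0)=1$). Odd half-turn model: for $\mathbf x=(x_1,\dots,x_{m+1})$, $\mathbf y=(y_1,\dots,y_{m+1})$, $Z_{\mathrm{HT}}(2m+1;\mathbf x,\mathbf y)$ is the partition function on the vertex set $\{(r,j):1\le r\le 2m+1,\,1\le j\le m\}\cup\{(r,m+1): m+2\le r\le 2m+1\}$ (rows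 from the top, columns from the left), vertex $(r,j)$ having spectral parameter $x_{i(r)}\bar y_j$ with $i(r)=\min(r,2m+2-r)$. Edges join consecutive vertices in each row and in each column. Boundary: the left boundary edge of each row points right (into the grid), the top boundary edges of columns $1,\dots,m$ point up, the bottom boundary edges of columns $1,\dots,m+1$ (below row $2m+1$) point down. The edge to the right of $(m+1,m)$ and the edge above $(m+2,m+1)$ form one single edge (the middle line of parameter $x_{m+1}$ turns into the vertical line of parameter $y_{m+1}$), pointing right out of $(m+1,m)$ iff pointing down into $(m+2,m+1)$ (for $m=0$ there are no vertices and $Z_{\mathrm{HT}}(1)=1$). For each $r\le m$, the edge to the right of $(r,m)$ and the edge to the right of $(2m+2-r,m+1)$ are one single edge with one orientation (out of one of these vertices, into the other). States of this model are in bijection with the $(2m+1)\times(2m+1)$ half-turn symmetric alternating-sign matrices. *)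

theory Defs
  imports Complex_Main "HOL-Library.FuncSet"
begin

definition sigma :: "complex \<Rightarrow> complex" where
  "sigma z = z - inverse z"

(* Edges of a square-grid model.
   Hor r j : the horizontal edge to the RIGHT of vertex (r,j); its state value is True
             iff it points right (for a U-turn edge: iff it points out of (r,j)).
   Ver r j : the vertical edge BELOW vertex (r,j); state value True iff it points up. *)
datatype edge = Hor nat nat | Ver nat nat

(* Local configuration at a vertex is a tuple (L,R,U,D):
   L = left edge points right, R = right edge points right,
   U = top edge points up,     D = bottom edge points up. *)

(* ice rule: exactly two of the four edges point into the vertex *)
definition ice :: "bool \<Rightarrow> bool \<Rightarrow> bool \<Rightarrow> bool \<Rightarrow> bool" where
  "ice L R U D \<longleftrightarrow> (of_bool L + of_bool (\<not> R) + of_bool (\<not> U) + of_bool D :: nat) = 2"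

definition vweight :: "complex \<Rightarrow> complex \<Rightarrow> bool \<Rightarrow> bool \<Rightarrow> bool \<Rightarrow> bool \<Rightarrow> complex" where
  "vweight a z L R U D =
     (if (L \<and> \<not> R \<and> U \<and> \<not> D) \<or> (\<not> L \<and> R \<and> \<not> U \<and> D) then sigma (a\<^sup>2)
      else if (L \<and> R \<and> U \<and> D) \<or> (\<not> L \<and> \<not> R \<and> \<not> U \<and> \<not> D) then sigma (a * z)
      else if (\<not> L \<and> \<not> R \<and> U \<and> D) \<or> (L \<and> R \<and> \<not> U \<and> \<not> D) then sigma (a * inverse z)
      else 0)"

(* generic partition function: V vertices, zf spectral parameters, E internal edges,
   slots s v = (L,R,U,D) at vertex v in state s (boundary edges are constants) *)
definition pf :: "complex \<Rightarrow> (nat \<times> nat) set \<Rightarrow> (nat \<times> nat \<Rightarrow> complex) \<Rightarrow> edge set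
                  \<Rightarrow> ((edge \<Rightarrow> bool) \<Rightarrow> nat \<times> nat \<Rightarrow> bool \<times> bool \<times> bool \<times> bool) \<Rightarrow> complex" where
  "pf a V zf E slots =
     (\<Sum>s \<in> {s \<in> PiE E (\<lambda>_. UNIV). \<forall>v\<in>V. case slots s v of (L,R,U,D) \<Rightarrow> ice L R U D}.
        \<Prod>v\<in>V. case slots s v of (L,R,U,D) \<Rightarrow> vweight a (zf v) L R U D)"

definition dw_edges :: "nat \<Rightarrow> edge set" where
  "dw_edges n = {Hor i j | i j. 1 \<le> i \<and> i \<le> n \<and> 1 \<le> j \<and> j < n}
              \<union> {Ver i j | i j. 1 \<le> i \<and> i < n \<and> 1 \<le> j \<and> j \<le> n}"

definition dw_slots :: "nat \<Rightarrow> (edge \<Rightarrow> bool) \<Rightarrow> nat \<times> nat \<Rightarrow> bool \<times> bool \<times> bool \<times> bool" where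
  "dw_slots n s v = (case v of (i,j) \<Rightarrow>
     (if j = 1 then True else s (Hor i (j - 1)),
      if j = n then False else s (Hor i j),
      if i = 1 then True else s (Ver (i - 1) j),
      if i = n then False else s (Ver i j)))"

definition Z_dw :: "complex \<Rightarrow> nat \<Rightarrow> (nat \<Rightarrow> complex) \<Rightarrow> (nat \<Rightarrow> complex) \<Rightarrow> complex" where
  "Z_dw a n x y = pf a ({1..n} \<times> {1..n}) (\<lambda>(i,j). x i * inverse (y j)) (dw_edges n) (dw_slots n)"

definition hte_edges :: "nat \<Rightarrow> edge set" where
  "hte_edges m = {Hor r j | r j. 1 \<le> r \<and> r \<le> 2*m \<and> 1 \<le> j \<and> j < m}
              \<union> {Hor r m | r. 1 \<le> r \<and> r \<le> m}
              \<union> {Ver r j | r j. 1 \<le> r \<and> r < 2*m \<and> 1 \<le> j \<and> j \<le> m}"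

definition hte_slots :: "nat \<Rightarrow> (edge \<Rightarrow> bool) \<Rightarrow> nat \<times> nat \<Rightarrow> bool \<times> bool \<times> bool \<times> bool" where
  "hte_slots m s v = (case v of (r,j) \<Rightarrow>
     (if j = 1 then True else s (Hor r (j - 1)),
      if j = m then (if r \<le> m then s (Hor r m) else \<not> s (Hor (2*m + 1 - r) m))
      else s (Hor r j),
      if r = 1 then True else s (Ver (r - 1) j),
      if r = 2*m then False else s (Ver r j)))"

definition Z_HT_even :: "complex \<Rightarrow> nat \<Rightarrow> (nat \<Rightarrow> complex) \<Rightarrow> (nat \<Rightarrow> complex) \<Rightarrow> complex" where
  "Z_HT_even a m x y = pf a ({1..2*m} \<times> {1..m})
      (\<lambda>(r,j). x (min r (2*m + 1 - r)) * inverse (y j)) (hte_edges m) (hte_slots m)"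

definition Z_HT2 :: "complex \<Rightarrow> nat \<Rightarrow> (nat \<Rightarrow> complex) \<Rightarrow> (nat \<Rightarrow> complex) \<Rightarrow> complex" where
  "Z_HT2 a m x y = Z_HT_even a m x y / Z_dw a m x y"

definition hto_vertices :: "nat \<Rightarrow> (nat \<times> nat) set" where
  "hto_vertices m = ({1..2*m+1} \<times> {1..m}) \<union> ({m+2..2*m+1} \<times> {m+1})"

definition hto_edges :: "nat \<Rightarrow> edge set" where
  "hto_edges m = {Hor r j | r j. 1 \<le> r \<and> r \<le> 2*m+1 \<and> 1 \<le> j \<and> j \<le> m}
              \<union> {Ver r j | r j. 1 \<le> r \<and> r \<le> 2*m \<and> 1 \<le> j \<and> j \<le> m}
              \<union> {Ver r (m+1) | r. m+2 \<le> r \<and> r \<le> 2*m}"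

definition hto_slots :: "nat \<Rightarrow> (edge \<Rightarrow> bool) \<Rightarrow> nat \<times> nat \<Rightarrow> bool \<times> bool \<times> bool \<times> bool" where
  "hto_slots m s v = (case v of (r,j) \<Rightarrow>
     (if j = m + 1 then
        (s (Hor r m),
         \<not> s (Hor (2*m + 2 - r) m),
         if r = m + 2 then \<not> s (Hor (m+1) m) else s (Ver (r - 1) (m+1)),
         if r = 2*m + 1 then False else s (Ver r (m+1)))
      else
        (if j = 1 then True else s (Hor r (j - 1)),
         s (Hor r j),
         if r = 1 then True else s (Ver (r - 1) j),
         if r = 2*m + 1 then False else s (Ver r j))))"

definition Z_HT_odd :: "complex \<Rightarrow> nat \<Rightarrow> (nat \<Rightarrow> complex) \<Rightarrow> (nat \<Rightarrow> complex) \<Rightarrow> complex" where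
  "Z_HT_odd a m x y = pf a (hto_vertices m)
      (\<lambda>(r,j). x (min r (2*m + 2 - r)) * inverse (y j)) (hto_edges m) (hto_slots m)"

end

theory Submission
  imports "HOL-Complex_Analysis.Complex_Analysis" "Jordan_Normal_Form.Determinant" Defs
begin

text \<open>
  Write \<open>t = x\<^bsub>m+1\<^esub> / y\<^bsub>m+1\<^esub>\<close> and split the odd partition function as \<open>Z\<^sup>+ + Z\<^sup>-\<close> according to the orientation
  of the middle edge; the two parts have opposite parity in \<open>x\<^bsub>m+1\<^esub>\<close>. The theorem is the sum of the two identities
  \<open>\<sigma>(a) ((t + 1/t) Z\<^sup>- + (a + 1/a) Z\<^sup>+) = Z(m+1) Z\<^bsub>HT\<^esub>(2m) / Z(m)\<close> and
  \<open>\<sigma>(a) ((t + 1/t) Z\<^sup>+ + (a + 1/a) Z\<^sup>-) = Z(m) Z\<^bsub>HT\<^esub>(2m+2) / Z(m+1)\<close>, which are proved together by induction on \<open>m\<close>.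

  The Yang--Baxter equation makes all partition functions symmetric in \<open>x\<^bsub>1\<^esub>, ..., x\<^bsub>m\<^esub>\<close> and in \<open>y\<^bsub>1\<^esub>, ..., y\<^bsub>m\<^esub>\<close>, and at
  \<open>x\<^bsub>1\<^esub> = a\<^bsup>\<plusminus>1\<^esup> y\<^bsub>j\<^esub>\<close> the lines \<open>x\<^bsub>1\<^esub>\<close> and \<open>y\<^bsub>j\<^esub>\<close> freeze, which lowers \<open>m\<close> by one. For the even model these values determine
  the partition function and give Kuperberg's formula \<open>Z\<^bsub>HT\<^esub>(2m) = Z(m) \<times> determinant\<close>. For the odd model the degree in
  \<open>x\<^bsub>1\<^esub>\<close> exceeds the number of such values by one, so each identity holds up to a multiple of
  \<open>\<Prod> \<sigma>(a x\<^bsub>i\<^esub>/y\<^bsub>j\<^esub>) \<sigma>(a y\<^bsub>j\<^esub>/x\<^bsub>i\<^esub>)\<close> that does not depend on \<open>x\<^bsub>i\<^esub>, y\<^bsub>j\<^esub>\<close> with \<open>i, j \<le> m\<close>. That multiple is found to vanish by setting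
  all \<open>x\<^bsub>i\<^esub> = a y\<^bsub>m+1\<^esub>\<close> and all \<open>y\<^bsub>j\<^esub> = a x\<^bsub>m+1\<^esub>\<close>: then the lines of \<open>x\<^bsub>m+1\<^esub>\<close> and \<open>y\<^bsub>m+1\<^esub>\<close> are reconnected at every vertex,
  and the odd model becomes the odd model of order \<open>2m-1\<close> with \<open>Z\<^sup>+\<close> and \<open>Z\<^sup>-\<close> exchanged.
\<close>

section \<open>Partition functions of rectangular grids\<close>

text \<open>The prefactor of the theorem is \<open>1 / (sigma a * (t + 1/t + a + 1/a))\<close>, so
  clearing it leaves an equation in which every term has a definite parity in the last row
  parameter; its parts of either parity are the two identities. Quotients by partition functions are
  meaningless at special parameters. All identities are therefore kept as differences with
  denominators multiplied out, and a factor is removed by analytic continuation from one point where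
  it does not vanish. The determinant enters for reasons of degree. Multiplying the odd identities
  by \<open>Z(m)\<close> or \<open>Z(m+1)\<close> adds degree in the first row parameter without
  adding known zeros. The Vandermonde products in the determinant formula add degree too, but with
  as many zeros, at repeated parameters. Only in this form do degree and number of zeros
  match.\<close>

definition bools :: "nat \<Rightarrow> bool list set" where
  "bools n = {bs. length bs = n}"

lemma length_bools [simp]: "bs \<in> bools n \<longleftrightarrow> length bs = n"
  by (simp add: bools_def)

lemma finite_bools [simp]: "finite (bools n)"
  using finite_lists_length_eq[of "UNIV :: bool set" n] by (simp add: bools_def)

lemma bools_0 [simp]: "bools 0 = {[]}"
  by (auto simp: bools_def)

lemma sum_bools_append:
  "sum f (bools (m + n)) = (\<Sum>bs\<in>bools m. \<Sum>cs\<in>bools n. f (bs @ cs))"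
proof -
  have "(\<Sum>bs\<in>bools m. \<Sum>cs\<in>bools n. f (bs @ cs)) = (\<Sum>p\<in>bools m \<times> bools n. f (fst p @ snd p))"
    by (simp add: sum.cartesian_product case_prod_beta)
  also have "\<dots> = sum f (bools (m + n))"
    by (rule sum.reindex_bij_witness[where i = "\<lambda>bs. (take m bs, drop m bs)" and j = "\<lambda>p. fst p @ snd p"])
       auto
  finally show ?thesis ..
qed

lemma bools_1: "bools (Suc 0) = {[False], [True]}"
  by (auto simp: bools_def length_Suc_conv)

lemma sum_bools_1 [simp]: "sum f (bools (Suc 0)) = (\<Sum>b\<in>UNIV. f [b])"
  by (simp add: bools_1 UNIV_bool)

lemma sum_bools_Suc: "sum f (bools (Suc n)) = (\<Sum>b\<in>UNIV. \<Sum>bs\<in>bools n. f (b # bs))"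
  using sum_bools_append[of f 1 n] by simp

lemma sum_bools_snoc: "sum f (bools (Suc n)) = (\<Sum>bs\<in>bools n. \<Sum>b\<in>UNIV. f (bs @ [b]))"
  using sum_bools_append[of f n 1] by simp

lemma sum_bools_rev: "sum f (bools n) = (\<Sum>bs\<in>bools n. f (rev bs))"
  by (rule sum.reindex_bij_witness[where i = rev and j = rev]) auto

lemma map_Not_map_Not [simp]: "map Not (map Not bs) = bs"
  by (induction bs) auto

lemma sum_bools_Not: "sum f (bools n) = (\<Sum>bs\<in>bools n. f (map Not bs))"
  by (rule sum.reindex_bij_witness[where i = "map Not" and j = "map Not"]) (auto simp: comp_def)

text \<open>Both sides bracket one fourfold sum. In \<open>grid_Cons_row\<close>, \<open>k\<close>
  and \<open>v\<close> are the right and lower edge of the top left vertex, \<open>i\<close> the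
  other edges right of the first column, \<open>j\<close> the other edges below the first row: the
  left side groups by columns, the right side by rows.\<close>

lemma sum_exchange:
  fixes w :: "'k \<Rightarrow> 'v \<Rightarrow> complex"
  shows "(\<Sum>k\<in>K. \<Sum>i\<in>I. (\<Sum>v\<in>V. w k v * f v i) * (\<Sum>j\<in>J. g k j * h i j)) =
    (\<Sum>v\<in>V. \<Sum>j\<in>J. (\<Sum>k\<in>K. w k v * g k j) * (\<Sum>i\<in>I. f v i * h i j))"
proof -
  let ?t = "\<lambda>k i v j. w k v * f v i * (g k j * h i j)"
  have "(\<Sum>k\<in>K. \<Sum>i\<in>I. \<Sum>v\<in>V. \<Sum>j\<in>J. ?t k i v j) = (\<Sum>k\<in>K. \<Sum>v\<in>V. \<Sum>i\<in>I. \<Sum>j\<in>J. ?t k i v j)"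
    by (intro sum.cong refl sum.swap)
  also have "\<dots> = (\<Sum>v\<in>V. \<Sum>k\<in>K. \<Sum>i\<in>I. \<Sum>j\<in>J. ?t k i v j)"
    by (rule sum.swap)
  also have "\<dots> = (\<Sum>v\<in>V. \<Sum>k\<in>K. \<Sum>j\<in>J. \<Sum>i\<in>I. ?t k i v j)"
    by (intro sum.cong refl sum.swap)
  also have "\<dots> = (\<Sum>v\<in>V. \<Sum>j\<in>J. \<Sum>k\<in>K. \<Sum>i\<in>I. ?t k i v j)"
    by (intro sum.cong refl sum.swap)
  finally show ?thesis
    by (simp only: sum_product) (simp only: mult_ac)
qed

text \<open>Reflection in the main diagonal combined with reversal of all arrows, because True means
  incoming for \<open>L\<close> and outgoing for \<open>U\<close>. Types 1 to 4 are fixed and 5, 6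
  exchanged, so \<open>z\<close> stays.\<close>

lemma vweight_transpose: "vweight a z L R U D = vweight a z U D L R"
  unfolding vweight_def by (cases L; cases R; cases U; cases D) simp_all

text \<open>Reflection in a horizontal axis exchanges top and bottom and reverses the vertical
  arrows. Types 1 and 2 are fixed, while 3 and 4 become 6 and 5; hence the inverse of
  \<open>z\<close>.\<close>

lemma vweight_reflect: "vweight a (inverse z) L R (\<not> D) (\<not> U) = vweight a z L R U D"
  unfolding vweight_def by (cases L; cases R; cases U; cases D) simp_all

locale six_vertex =
  fixes a :: complex
  assumes a_nonzero: "a \<noteq> 0" and sigma_a2: "sigma (a\<^sup>2) \<noteq> 0"
begin

text \<open>
  A line of vertices with parameters \<open>zs\<close>, entered from above in state \<open>u\<close> and left below in state \<open>d\<close>, with left and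
  right edges \<open>ls\<close>, \<open>rs\<close>. By \<open>vweight_transpose\<close> the same function describes a row read from left to right.
\<close>

fun col :: "complex list \<Rightarrow> bool \<Rightarrow> bool list \<Rightarrow> bool list \<Rightarrow> bool \<Rightarrow> complex" where
  "col [] u [] [] d = of_bool (u = d)"
| "col (z # zs) u (l # ls) (r # rs) d = (\<Sum>v\<in>UNIV. vweight a z l r u v * col zs v ls rs d)"
| "col _ _ _ _ _ = 0"

text \<open>The boundary edges are listed in the order top, left, right, bottom.\<close>

fun grid :: "complex list \<Rightarrow> complex list \<Rightarrow> bool list \<Rightarrow> bool list \<Rightarrow> bool list \<Rightarrow> bool list \<Rightarrow> complex" where
  "grid xs [] [] ls rs [] = of_bool (ls = rs)"
| "grid xs (y # ys) (u # us) ls rs (d # ds) =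
     (\<Sum>ks\<in>bools (length xs). col (map (\<lambda>x. x * inverse y) xs) u ls ks d * grid xs ys us ks rs ds)"
| "grid _ _ _ _ _ _ = 0"

lemma grid_Nil_rows:
  "length us = length ys \<Longrightarrow> length ds = length ys \<Longrightarrow> grid [] ys us [] [] ds = of_bool (us = ds)"
proof (induction ys arbitrary: us ds)
  case (Cons y ys)
  then show ?case by (auto simp: length_Suc_conv)
qed simp

text \<open>\<open>grid\<close> is defined by removing columns; this recursion removes rows. Having
  both gives transposition and cuts along horizontal lines.\<close>

lemma grid_Cons_row:
  assumes "length us = length ys" "length ds = length ys" "length ls = length xs" "length rs = length xs"
  shows "grid (x # xs) ys us (l # ls) (r # rs) ds =
    (\<Sum>vs\<in>bools (length ys). col (map (\<lambda>y. x * inverse y) ys) l us vs r * grid xs ys vs ls rs ds)"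
  using assms
proof (induction ys arbitrary: us ds l ls)
  case Nil
  then show ?case by auto
next
  case (Cons y ys)
  obtain u us' d ds' where us: "us = u # us'" "length us' = length ys" and ds: "ds = d # ds'" "length ds' = length ys"
    using Cons.prems by (auto simp: length_Suc_conv)
  let ?C = "\<lambda>v ks. col (map (\<lambda>x. x * inverse y) xs) v ls ks d"
  let ?R = "\<lambda>k vs. col (map (\<lambda>y. x * inverse y) ys) k us' vs r"
  let ?w = "\<lambda>k v. vweight a (x * inverse y) l k u v"
  let ?G = "\<lambda>ks vs. grid xs ys vs ks rs ds'"
  have "grid (x # xs) (y # ys) us (l # ls) (r # rs) ds =
     (\<Sum>k\<in>UNIV. \<Sum>ks\<in>bools (length xs). (\<Sum>v\<in>UNIV. ?w k v * ?C v ks) *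
        grid (x # xs) ys us' (k # ks) (r # rs) ds')"
    by (simp add: us ds sum_bools_Suc)
  also have "\<dots> = (\<Sum>k\<in>UNIV. \<Sum>ks\<in>bools (length xs). (\<Sum>v\<in>UNIV. ?w k v * ?C v ks) *
        (\<Sum>vs\<in>bools (length ys). ?R k vs * ?G ks vs))"
    using Cons.IH us ds Cons.prems by (intro sum.cong refl) simp
  also have "\<dots> = (\<Sum>v\<in>UNIV. \<Sum>vs\<in>bools (length ys). (\<Sum>k\<in>UNIV. ?w k v * ?R k vs) *
        (\<Sum>ks\<in>bools (length xs). ?C v ks * ?G ks vs))"
    by (rule sum_exchange)
  also have "\<dots> = (\<Sum>vs\<in>bools (length (y # ys)). col (map (\<lambda>y. x * inverse y) (y # ys)) l us vs r *
      grid xs (y # ys) vs ls rs ds)"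
    by (simp add: us ds sum_bools_Suc vweight_transpose[of a "x * inverse y" u _ l])
  finally show ?case by (simp add: us ds)
qed

lemma grid_transpose:
  assumes "length us = length ys" "length ds = length ys" "length ls = length xs" "length rs = length xs"
  shows "grid xs ys us ls rs ds = grid (map inverse ys) (map inverse xs) ls us ds rs"
  using assms
proof (induction xs arbitrary: us ls rs)
  case Nil
  then show ?case by (simp add: grid_Nil_rows)
next
  case (Cons x xs)
  obtain l ls' r rs' where ls: "ls = l # ls'" "length ls' = length xs" and rs: "rs = r # rs'" "length rs' = length xs"
    using Cons.prems by (auto simp: length_Suc_conv)
  have "grid (x # xs) ys us ls rs ds =
     (\<Sum>vs\<in>bools (length ys). col (map (\<lambda>y. x * inverse y) ys) l us vs r * grid xs ys vs ls' rs' ds)"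
    using Cons.prems by (simp add: ls rs grid_Cons_row)
  also have "\<dots> = (\<Sum>vs\<in>bools (length ys). col (map (\<lambda>y. x * inverse y) ys) l us vs r *
      grid (map inverse ys) (map inverse xs) ls' vs ds rs')"
    using Cons.prems by (intro sum.cong refl) (simp add: ls rs Cons.IH)
  finally show ?case by (simp add: ls rs comp_def mult.commute)
qed

lemma col_append:
  assumes "length ls = length zs" "length rs = length zs"
  shows "col (zs @ zs') u (ls @ ls') (rs @ rs') d = (\<Sum>v\<in>UNIV. col zs u ls rs v * col zs' v ls' rs' d)"
  using assms
proof (induction zs arbitrary: u ls rs)
  case Nil
  then show ?case by (simp add: UNIV_bool)
next
  case (Cons z zs)
  then show ?case
    by (auto simp: length_Suc_conv UNIV_bool algebra_simps)
qed

lemma col_reflect: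
  assumes "length ls = length zs" "length rs = length zs"
  shows "col (rev (map inverse zs)) (\<not> d) (rev ls) (rev rs) (\<not> u) = col zs u ls rs d"
  using assms
proof (induction zs arbitrary: u ls rs)
  case (Cons z zs)
  obtain l ls' r rs' where ls: "ls = l # ls'" "length ls' = length zs" and rs: "rs = r # rs'" "length rs' = length zs"
    using Cons.prems by (auto simp: length_Suc_conv)
  have "col (rev (map inverse (z # zs))) (\<not> d) (rev ls) (rev rs) (\<not> u) =
     (\<Sum>v\<in>UNIV. col (rev (map inverse zs)) (\<not> d) (rev ls') (rev rs') (\<not> v) * vweight a (inverse z) l r (\<not> v) (\<not> u))"
    using ls rs by (simp add: col_append UNIV_bool add.commute)
  then show ?case using Cons.IH ls rs
    by (simp only: vweight_reflect) (simp add: mult.commute)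
qed auto

lemma grid_reflect:
  assumes "length us = length ys" "length ds = length ys" "length ls = length xs" "length rs = length xs"
  shows "grid (rev (map inverse xs)) (map inverse ys) (map Not ds) (rev ls) (rev rs) (map Not us)
    = grid xs ys us ls rs ds"
  using assms
proof (induction ys arbitrary: us ds ls)
  case (Cons y ys)
  obtain u us' d ds' where us: "us = u # us'" "length us' = length ys" and ds: "ds = d # ds'" "length ds' = length ys"
    using Cons.prems by (auto simp: length_Suc_conv)
  have "grid (rev (map inverse xs)) (map inverse (y # ys)) (map Not ds) (rev ls) (rev rs) (map Not us)
    = (\<Sum>ks\<in>bools (length xs). col (rev (map inverse (map (\<lambda>x. x * inverse y) xs))) (\<not> d) (rev ls) (rev ks) (\<not> u)
       * grid (rev (map inverse xs)) (map inverse ys) (map Not ds') (rev ks) (rev rs) (map Not us'))"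
    using sum_bools_rev[of "\<lambda>ks. col (rev (map inverse (map (\<lambda>x. x * inverse y) xs))) (\<not> d) (rev ls) ks (\<not> u)
       * grid (rev (map inverse xs)) (map inverse ys) (map Not ds') ks (rev rs) (map Not us')" "length xs"]
    by (simp add: us ds rev_map comp_def)
  then show ?case using Cons.prems us ds by (simp add: col_reflect Cons.IH del: map_map cong: sum.cong_simp)
qed simp

lemma grid_append_col:
  assumes "length us = length ys" "length ds = length ys" "length ls = length xs" "length rs = length xs"
  shows "grid xs (ys @ ys') (us @ us'') ls rs (ds @ ds'') =
    (\<Sum>ks\<in>bools (length xs). grid xs ys us ls ks ds * grid xs ys' us'' ks rs ds'')"
  using assms
proof (induction ys arbitrary: us ds ls)
  case Nil
  have "(\<Sum>ks\<in>bools (length xs). of_bool (ls = ks) * grid xs ys' us'' ks rs ds'') =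
     (\<Sum>ks\<in>bools (length xs). if ks = ls then grid xs ys' us'' ks rs ds'' else 0)"
    by (intro sum.cong) auto
  then show ?case using Nil by simp
next
  case (Cons y ys)
  obtain u us' d ds' where us: "us = u # us'" "length us' = length ys" and ds: "ds = d # ds'" "length ds' = length ys"
    using Cons.prems by (auto simp: length_Suc_conv)
  let ?c = "\<lambda>js. col (map (\<lambda>x. x * inverse y) xs) u ls js d"
  have "grid xs ((y # ys) @ ys') (us @ us'') ls rs (ds @ ds'') =
     (\<Sum>js\<in>bools (length xs). ?c js *
        (\<Sum>ks\<in>bools (length xs). grid xs ys us' js ks ds' * grid xs ys' us'' ks rs ds''))"
    using Cons.prems us ds by (simp add: Cons.IH)
  also have "\<dots> = (\<Sum>js\<in>bools (length xs). \<Sum>ks\<in>bools (length xs).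
     ?c js * grid xs ys us' js ks ds' * grid xs ys' us'' ks rs ds'')"
    by (simp add: sum_distrib_left mult.assoc)
  also have "\<dots> = (\<Sum>ks\<in>bools (length xs). \<Sum>js\<in>bools (length xs).
     ?c js * grid xs ys us' js ks ds' * grid xs ys' us'' ks rs ds'')"
    by (rule sum.swap)
  finally show ?case using us ds by (simp add: sum_distrib_right)
qed

lemma grid_append_row:
  assumes "length us = length ys" "length ds = length ys" "length ls = length xs" "length rs = length xs"
    "length ls' = length xs'" "length rs' = length xs'"
  shows "grid (xs @ xs') ys us (ls @ ls') (rs @ rs') ds =
    (\<Sum>vs\<in>bools (length ys). grid xs ys us ls rs vs * grid xs' ys vs ls' rs' ds)"
proof -
  have "grid (xs @ xs') ys us (ls @ ls') (rs @ rs') ds =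
     grid (map inverse ys) (map inverse xs @ map inverse xs') (ls @ ls') us ds (rs @ rs')"
    using assms by (simp add: grid_transpose[of us ys ds "ls @ ls'"])
  also have "\<dots> = (\<Sum>vs\<in>bools (length ys). grid (map inverse ys) (map inverse xs) ls us vs rs *
      grid (map inverse ys) (map inverse xs') ls' vs ds rs')"
    using assms by (simp add: grid_append_col)
  also have "\<dots> = (\<Sum>vs\<in>bools (length ys). grid xs ys us ls rs vs * grid xs' ys vs ls' rs' ds)"
    using assms by (intro sum.cong refl) (simp add: grid_transpose[of us ys _ ls] grid_transpose[of _ ys ds ls'])
  finally show ?thesis .
qed

lemma grid_single_col:
  assumes "length ls = length xs" "length rs = length xs"
  shows "grid xs [y] [u] ls rs [d] = col (map (\<lambda>x. x * inverse y) xs) u ls rs d"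
proof -
  have "(\<Sum>ks\<in>bools (length xs). col (map (\<lambda>x. x * inverse y) xs) u ls ks d * of_bool (ks = rs)) =
     (\<Sum>ks\<in>bools (length xs). if ks = rs then col (map (\<lambda>x. x * inverse y) xs) u ls ks d else 0)"
    by (intro sum.cong) auto
  then show ?thesis using assms by simp
qed

lemma grid_single_row:
  assumes "length us = length ys" "length ds = length ys"
  shows "grid [x] ys us [l] [r] ds = col (map (\<lambda>y. x * inverse y) ys) l us ds r"
  using assms by (simp add: grid_transpose[of us ys ds "[l]"] grid_single_col comp_def mult.commute)

end

section \<open>Cancellation along curves and the Yang--Baxter equation\<close>

definition nonvanishing_family :: "(nat \<Rightarrow> complex \<Rightarrow> complex) \<Rightarrow> bool" where
  "nonvanishing_family c \<longleftrightarrow> (\<forall>i. c i holomorphic_on UNIV \<and> (\<forall>s. c i s \<noteq> 0))"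

text \<open>
  Along the curves \<open>x\<^bsub>i\<^esub>(s) = x\<^bsub>i\<^esub>(0) exp(s L\<^bsub>i\<^esub>)\<close> Laurent polynomials become entire functions, which have no zero divisors.
\<close>

definition curvewise_entire :: "((nat \<Rightarrow> complex) \<Rightarrow> (nat \<Rightarrow> complex) \<Rightarrow> complex) \<Rightarrow> bool" where
  "curvewise_entire f \<longleftrightarrow> (\<forall>c d. nonvanishing_family c \<longrightarrow> nonvanishing_family d \<longrightarrow>
     (\<lambda>s. f (\<lambda>i. c i s) (\<lambda>i. d i s)) holomorphic_on UNIV)"

text \<open>Along the curve from \<open>(x0, y0)\<close> to \<open>(x, y)\<close> the second factor
  is nonzero near \<open>s = 0\<close>, so the first vanishes on an open set and hence up to
  \<open>s = 1\<close>. One point with \<open>g\<close> nonzero is thus enough to cancel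
  \<open>g\<close> everywhere.\<close>

lemma curvewise_entire_cancel:
  assumes f: "curvewise_entire f" and g: "curvewise_entire g"
    and fg: "\<And>x y. (\<forall>i. x i \<noteq> 0) \<Longrightarrow> (\<forall>i. y i \<noteq> 0) \<Longrightarrow> f x y * g x y = 0"
    and x0: "\<forall>i. x0 i \<noteq> 0" and y0: "\<forall>i. y0 i \<noteq> 0" and g0: "g x0 y0 \<noteq> 0"
    and x: "\<forall>i. x i \<noteq> 0" and y: "\<forall>i. y i \<noteq> 0"
  shows "f x y = 0"
proof -
  define c where "c i s = x0 i * exp (s * Ln (x i / x0 i))" for i s
  define d where "d i s = y0 i * exp (s * Ln (y i / y0 i))" for i s
  have nv: "nonvanishing_family c" "nonvanishing_family d"
    unfolding nonvanishing_family_def c_def d_def using x0 y0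
    by (auto intro!: holomorphic_intros)
  define F where "F s = f (\<lambda>i. c i s) (\<lambda>i. d i s)" for s
  define G where "G s = g (\<lambda>i. c i s) (\<lambda>i. d i s)" for s
  have hol: "F holomorphic_on UNIV" "G holomorphic_on UNIV"
    using f g nv unfolding F_def G_def curvewise_entire_def by blast+
  have FG: "F s * G s = 0" for s
    unfolding F_def G_def using nv by (intro fg) (auto simp: nonvanishing_family_def)
  have "c i 0 = x0 i" "d i 0 = y0 i" "c i 1 = x i" "d i 1 = y i" for i
    using x0 y0 x y by (simp_all add: c_def d_def exp_Ln)
  then have G0: "G 0 \<noteq> 0" and F1: "F 1 = f x y"
    using g0 by (simp_all add: G_def F_def)
  define U where "U = {s. G s \<noteq> 0}"
  have "open U"
    unfolding U_def using holomorphic_on_imp_continuous_on[OF hol(2)]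
    by (intro open_Collect_neq continuous_on_const)
  moreover have "F s = 0" if "s \<in> U" for s
    using FG[of s] that by (simp add: U_def)
  moreover have "0 \<in> U" using G0 by (simp add: U_def)
  ultimately have "F 1 = 0"
    using analytic_continuation_open[of U UNIV F "\<lambda>_. 0" 1] hol by auto
  then show ?thesis using F1 by simp
qed

named_theorems ce_intros

lemma curvewise_entire_const [ce_intros]: "curvewise_entire (\<lambda>x y. k)"
  by (simp add: curvewise_entire_def)

lemma curvewise_entire_coords [ce_intros]:
  "curvewise_entire (\<lambda>x y. x i)" "curvewise_entire (\<lambda>x y. y i)"
  "curvewise_entire (\<lambda>x y. inverse (x i))" "curvewise_entire (\<lambda>x y. inverse (y i))"
  by (auto simp: curvewise_entire_def nonvanishing_family_def intro!: holomorphic_intros)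

lemma curvewise_entire_arith [ce_intros]:
  assumes "curvewise_entire f" "curvewise_entire g"
  shows "curvewise_entire (\<lambda>x y. f x y + g x y)" "curvewise_entire (\<lambda>x y. f x y - g x y)"
    "curvewise_entire (\<lambda>x y. f x y * g x y)"
  using assms by (auto simp: curvewise_entire_def intro!: holomorphic_intros)

lemma curvewise_entire_power [ce_intros]:
  "curvewise_entire f \<Longrightarrow> curvewise_entire (\<lambda>x y. f x y ^ n)"
  by (auto simp: curvewise_entire_def intro!: holomorphic_intros)

lemma curvewise_entire_sum [ce_intros]:
  "(\<And>i. i \<in> A \<Longrightarrow> curvewise_entire (f i)) \<Longrightarrow> curvewise_entire (\<lambda>x y. \<Sum>i\<in>A. f i x y)"
  by (auto simp: curvewise_entire_def intro!: holomorphic_intros)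

lemma curvewise_entire_prod [ce_intros]:
  "(\<And>i. i \<in> A \<Longrightarrow> curvewise_entire (f i)) \<Longrightarrow> curvewise_entire (\<lambda>x y. \<Prod>i\<in>A. f i x y)"
  by (auto simp: curvewise_entire_def intro!: holomorphic_intros)

lemma curvewise_entire_prod_list [ce_intros]:
  "(\<And>i. i \<in> set js \<Longrightarrow> curvewise_entire (f i)) \<Longrightarrow> curvewise_entire (\<lambda>x y. \<Prod>i\<leftarrow>js. f i x y)"
  by (induction js) (auto intro!: ce_intros)

text \<open>\<open>curvewise_entire\<close> is not closed under \<open>inverse\<close>, hence the
  separate assumption on the reciprocal.\<close>

lemma curvewise_entire_sigma:
  assumes "curvewise_entire z" "curvewise_entire (\<lambda>x y. inverse (z x y))"
  shows "curvewise_entire (\<lambda>x y. sigma (k * z x y))" "curvewise_entire (\<lambda>x y. sigma (k * inverse (z x y)))"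
  unfolding sigma_def inverse_mult_distrib inverse_inverse_eq using assms by (auto intro!: ce_intros)

lemma curvewise_entire_vweight:
  assumes "curvewise_entire z" "curvewise_entire (\<lambda>x y. inverse (z x y))"
  shows "curvewise_entire (\<lambda>x y. vweight a (z x y) L R U D)"
  unfolding vweight_def using curvewise_entire_sigma[OF assms]
  by (cases L; cases R; cases U; cases D) (simp_all add: curvewise_entire_const)

context six_vertex
begin

lemma curvewise_entire_col:
  assumes "\<And>i. i \<in> set js \<Longrightarrow> curvewise_entire (z i)"
    "\<And>i. i \<in> set js \<Longrightarrow> curvewise_entire (\<lambda>x y. inverse (z i x y))"
  shows "curvewise_entire (\<lambda>x y. col (map (\<lambda>i. z i x y) js) u ls rs d)"
  using assms
proof (induction js arbitrary: u ls rs)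
  case Nil
  show ?case by (cases "ls = [] \<and> rs = []") (auto intro!: ce_intros simp: neq_Nil_conv elim!: list.exhaust)
next
  case (Cons i js)
  show ?case
  proof (cases "ls = [] \<or> rs = []")
    case True
    then show ?thesis by (cases ls; cases rs) (auto intro: ce_intros)
  next
    case False
    then obtain l ls' r rs' where "ls = l # ls'" "rs = r # rs'" by (auto simp: neq_Nil_conv)
    then show ?thesis using Cons by (auto intro!: ce_intros curvewise_entire_vweight)
  qed
qed

lemma curvewise_entire_grid:
  assumes p: "\<And>i. i \<in> set js \<Longrightarrow> curvewise_entire (p i)"
    "\<And>i. i \<in> set js \<Longrightarrow> curvewise_entire (\<lambda>x y. inverse (p i x y))"
    and "\<And>i. i \<in> set ks \<Longrightarrow> curvewise_entire (q i)"
    "\<And>i. i \<in> set ks \<Longrightarrow> curvewise_entire (\<lambda>x y. inverse (q i x y))"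
  shows "curvewise_entire (\<lambda>x y. grid (map (\<lambda>i. p i x y) js) (map (\<lambda>i. q i x y) ks) us ls rs ds)"
  using assms(3,4)
proof (induction ks arbitrary: us ls ds)
  case Nil
  show ?case by (cases us; cases ds) (auto intro: ce_intros)
next
  case (Cons k ks)
  show ?case
  proof (cases "us = [] \<or> ds = []")
    case True
    then show ?thesis by (cases us; cases ds) (auto intro: ce_intros)
  next
    case False
    then obtain u us' d ds' where eq: "us = u # us'" "ds = d # ds'" by (auto simp: neq_Nil_conv)
    have "curvewise_entire (\<lambda>x y. col (map (\<lambda>i. p i x y * inverse (q k x y)) js) u ls bs d)" for bs
      using p Cons.prems by (intro curvewise_entire_col) (auto intro!: ce_intros)
    then show ?thesis using Cons by (auto simp: eq comp_def intro!: ce_intros)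
  qed
qed

section \<open>The R-matrix and the exchange of neighbouring columns\<close>

text \<open>Six-vertex weights at spectral parameter \<open>a * y2 / y1\<close>, attached to a
  crossing of the two vertical lines; \<open>us\<close> are the states above and \<open>vs\<close>
  those below the crossing.\<close>

definition R_matrix :: "complex \<Rightarrow> complex \<Rightarrow> bool list \<Rightarrow> bool list \<Rightarrow> complex" where
  "R_matrix y1 y2 us vs =
     (if vs = us then (if us ! 0 = us ! 1 then sigma (a\<^sup>2 * (y2 * inverse y1)) else sigma (a\<^sup>2))
      else if vs = rev us then sigma (y1 * inverse y2) else 0)"

lemma bools_2: "bools 2 = {[False, False], [False, True], [True, False], [True, True]}"
  by (auto simp: bools_def length_Suc_conv numeral_2_eq_2)

text \<open>A finite check: 16 choices of vertical and 4 of horizontal boundary states, each giving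
  a rational identity in \<open>x\<close>, \<open>y1\<close>, \<open>y2\<close> and
  \<open>a\<close>.\<close>

lemma yang_baxter:
  assumes "x \<noteq> 0" "y1 \<noteq> 0" "y2 \<noteq> 0" "us \<in> bools 2" "ds \<in> bools 2"
  shows "(\<Sum>vs\<in>bools 2. R_matrix y1 y2 us vs * col [x * inverse y2, x * inverse y1] l vs ds r) =
    (\<Sum>vs\<in>bools 2. col [x * inverse y1, x * inverse y2] l us vs r * R_matrix y1 y2 vs ds)"
proof -
  have "us = [False, False] \<or> us = [False, True] \<or> us = [True, False] \<or> us = [True, True]"
    "ds = [False, False] \<or> ds = [False, True] \<or> ds = [True, False] \<or> ds = [True, True]"
    using assms(4,5) unfolding bools_2 by auto
  then show ?thesis using assms(1-3) a_nonzero
    by (elim disjE; cases l; cases r)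
       (simp_all add: bools_2 R_matrix_def vweight_def UNIV_bool, simp_all add: sigma_def field_simps power2_eq_square)
qed

text \<open>The crossing is pulled down through the rows one at a time; with no rows left both sides
  are \<open>R_matrix y1 y2 us ds\<close>.\<close>

lemma grid_intertwine:
  assumes "\<forall>x\<in>set xs. x \<noteq> 0" "y1 \<noteq> 0" "y2 \<noteq> 0" "us \<in> bools 2" "ds \<in> bools 2"
    "length ls = length xs" "length rs = length xs"
  shows "(\<Sum>vs\<in>bools 2. R_matrix y1 y2 us vs * grid xs [y2, y1] vs ls rs ds) =
    (\<Sum>vs\<in>bools 2. grid xs [y1, y2] us ls rs vs * R_matrix y1 y2 vs ds)"
  using assms
proof (induction xs arbitrary: us ls rs)
  case Nil
  have "(\<Sum>vs\<in>bools 2. R_matrix y1 y2 us vs * grid [] [y2, y1] vs [] [] ds) =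
      (\<Sum>vs\<in>bools 2. if vs = ds then R_matrix y1 y2 us vs else 0)"
    using Nil by (intro sum.cong refl, subst grid_Nil_rows) auto
  moreover have "(\<Sum>vs\<in>bools 2. grid [] [y1, y2] us [] [] vs * R_matrix y1 y2 vs ds) =
      (\<Sum>vs\<in>bools 2. if vs = us then R_matrix y1 y2 vs ds else 0)"
    using Nil by (intro sum.cong refl, subst grid_Nil_rows) auto
  ultimately show ?case using Nil by simp
next
  case (Cons x xs)
  obtain l ls' r rs' where ls: "ls = l # ls'" "length ls' = length xs" and rs: "rs = r # rs'" "length rs' = length xs"
    using Cons.prems by (auto simp: length_Suc_conv)
  let ?R = "R_matrix y1 y2"
  let ?T = "\<lambda>y y' us vs. col [x * inverse y, x * inverse y'] l us vs r"
  let ?G = "\<lambda>y y' us vs. grid xs [y, y'] us ls' rs' vs"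
  have row: "grid (x # xs) [y, y'] us ls rs vs = (\<Sum>ws\<in>bools 2. ?T y y' us ws * ?G y y' ws vs)"
    if "us \<in> bools 2" "vs \<in> bools 2" for y y' us vs
    using that ls rs by (simp add: grid_Cons_row numeral_2_eq_2)
  have "(\<Sum>vs\<in>bools 2. ?R us vs * grid (x # xs) [y2, y1] vs ls rs ds) =
      (\<Sum>vs\<in>bools 2. \<Sum>ws\<in>bools 2. ?R us vs * ?T y2 y1 vs ws * ?G y2 y1 ws ds)"
    using Cons.prems by (simp add: row sum_distrib_left mult.assoc)
  also have "\<dots> = (\<Sum>ws\<in>bools 2. (\<Sum>vs\<in>bools 2. ?R us vs * ?T y2 y1 vs ws) * ?G y2 y1 ws ds)"
    by (subst sum.swap) (simp add: sum_distrib_right)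
  also have "\<dots> = (\<Sum>ws\<in>bools 2. (\<Sum>vs\<in>bools 2. ?T y1 y2 us vs * ?R vs ws) * ?G y2 y1 ws ds)"
    using Cons.prems by (intro sum.cong refl, subst yang_baxter) auto
  also have "\<dots> = (\<Sum>vs\<in>bools 2. \<Sum>ws\<in>bools 2. ?T y1 y2 us vs * (?R vs ws * ?G y2 y1 ws ds))"
    by (subst sum.swap) (simp add: sum_distrib_right mult.assoc)
  also have "\<dots> = (\<Sum>vs\<in>bools 2. ?T y1 y2 us vs * (\<Sum>ws\<in>bools 2. ?R vs ws * ?G y2 y1 ws ds))"
    by (simp add: sum_distrib_left)
  also have "\<dots> = (\<Sum>vs\<in>bools 2. ?T y1 y2 us vs * (\<Sum>ws\<in>bools 2. ?G y1 y2 vs ws * ?R ws ds))"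
    using Cons.prems ls rs by (intro sum.cong refl arg_cong2[where f = "(*)"] Cons.IH) auto
  also have "\<dots> = (\<Sum>vs\<in>bools 2. \<Sum>ws\<in>bools 2. ?T y1 y2 us vs * ?G y1 y2 vs ws * ?R ws ds)"
    by (simp add: sum_distrib_left mult.assoc)
  also have "\<dots> = (\<Sum>ws\<in>bools 2. (\<Sum>vs\<in>bools 2. ?T y1 y2 us vs * ?G y1 y2 vs ws) * ?R ws ds)"
    by (subst sum.swap) (simp add: sum_distrib_right)
  also have "\<dots> = (\<Sum>ws\<in>bools 2. grid (x # xs) [y1, y2] us ls rs ws * ?R ws ds)"
    using Cons.prems by (simp add: row)
  finally show ?case .
qed

text \<open>The upper left part common to all models: top edges point up and left edges right, as
  every boundary condition demands there, while the right edges \<open>es\<close> and the lower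
  edges \<open>ds\<close> stay free.\<close>

definition block :: "complex list \<Rightarrow> complex list \<Rightarrow> bool list \<Rightarrow> bool list \<Rightarrow> complex" where
  "block xs ys es ds = grid xs ys (replicate (length ys) True) (replicate (length xs) True) es ds"

lemma block_transpose:
  assumes "length es = length xs" "length ds = length ys"
  shows "block xs ys es ds = block (map inverse ys) (map inverse xs) ds es"
  unfolding block_def using assms by (subst grid_transpose) simp_all

text \<open>The crossing conserves the number of upward edges, so on two upward top edges it acts as
  a scalar. Pulled through the block it reappears at the lower edges.\<close>

lemma block_swap:
  assumes "\<forall>x\<in>set xs. x \<noteq> 0" "y1 \<noteq> 0" "y2 \<noteq> 0" "length es = length xs"
    "length dp = length p" "length ds = 2" "length dq = length q"
  shows "sigma (a\<^sup>2 * (y2 * inverse y1)) * block xs (p @ [y2, y1] @ q) es (dp @ ds @ dq) =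
    (\<Sum>vs\<in>bools 2. block xs (p @ [y1, y2] @ q) es (dp @ vs @ dq) * R_matrix y1 y2 vs ds)"
proof -
  let ?n = "length xs"
  let ?P = "\<lambda>ks. grid xs p (replicate (length p) True) (replicate ?n True) ks dp"
  let ?Q = "\<lambda>ks. grid xs q (replicate (length q) True) ks es dq"
  let ?M = "\<lambda>y y' vs ks js. grid xs [y, y'] [True, True] ks js vs"
  have split: "block xs (p @ [y, y'] @ q) es (dp @ vs @ dq) =
     (\<Sum>ks\<in>bools ?n. \<Sum>js\<in>bools ?n. ?P ks * ?Q js * ?M y y' vs ks js)" if "length vs = 2" for y y' vs
  proof -
    have "replicate (length (p @ [y, y'] @ q)) True = replicate (length p) True @ [True, True] @ replicate (length q) True"
      by (rule replicate_eqI[symmetric]) auto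
    then have "block xs (p @ [y, y'] @ q) es (dp @ vs @ dq) =
      (\<Sum>ks\<in>bools ?n. ?P ks * grid xs ([y, y'] @ q) ([True, True] @ replicate (length q) True) ks es (vs @ dq))"
      unfolding block_def using assms by (simp only: grid_append_col length_replicate)
    also have "\<dots> = (\<Sum>ks\<in>bools ?n. ?P ks * (\<Sum>js\<in>bools ?n. ?M y y' vs ks js * ?Q js))"
      using that assms by (intro sum.cong refl arg_cong2[where f = "(*)"] grid_append_col) auto
    finally show ?thesis by (simp add: sum_distrib_left mult_ac)
  qed
  have mid: "sigma (a\<^sup>2 * (y2 * inverse y1)) * ?M y2 y1 ds ks js =
      (\<Sum>vs\<in>bools 2. ?M y1 y2 vs ks js * R_matrix y1 y2 vs ds)" if "length ks = ?n" "length js = ?n" for ks js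
  proof -
    have "sigma (a\<^sup>2 * (y2 * inverse y1)) * ?M y2 y1 ds ks js =
        (\<Sum>vs\<in>bools 2. R_matrix y1 y2 [True, True] vs * grid xs [y2, y1] vs ks js ds)"
      by (simp add: bools_2 R_matrix_def)
    also have "\<dots> = (\<Sum>vs\<in>bools 2. ?M y1 y2 vs ks js * R_matrix y1 y2 vs ds)"
      using assms that by (intro grid_intertwine) auto
    finally show ?thesis .
  qed
  have "sigma (a\<^sup>2 * (y2 * inverse y1)) * block xs (p @ [y2, y1] @ q) es (dp @ ds @ dq) =
     (\<Sum>ks\<in>bools ?n. \<Sum>js\<in>bools ?n. ?P ks * ?Q js * (sigma (a\<^sup>2 * (y2 * inverse y1)) * ?M y2 y1 ds ks js))"
    using assms by (simp only: split) (simp add: sum_distrib_left mult_ac)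
  also have "\<dots> = (\<Sum>ks\<in>bools ?n. \<Sum>js\<in>bools ?n. \<Sum>vs\<in>bools 2. ?P ks * ?Q js * ?M y1 y2 vs ks js * R_matrix y1 y2 vs ds)"
    by (intro sum.cong refl) (simp add: mid sum_distrib_left mult.assoc)
  also have "\<dots> = (\<Sum>ks\<in>bools ?n. \<Sum>vs\<in>bools 2. \<Sum>js\<in>bools ?n. ?P ks * ?Q js * ?M y1 y2 vs ks js * R_matrix y1 y2 vs ds)"
    by (intro sum.cong refl sum.swap)
  also have "\<dots> = (\<Sum>vs\<in>bools 2. \<Sum>ks\<in>bools ?n. \<Sum>js\<in>bools ?n. ?P ks * ?Q js * ?M y1 y2 vs ks js * R_matrix y1 y2 vs ds)"
    by (rule sum.swap)
  also have "\<dots> = (\<Sum>vs\<in>bools 2. block xs (p @ [y1, y2] @ q) es (dp @ vs @ dq) * R_matrix y1 y2 vs ds)"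
    by (intro sum.cong refl) (simp only: split length_bools, simp add: sum_distrib_right)
  finally show ?thesis .
qed

text \<open>Inverted parameters and negated states belong to a reflected lower half: the crossings
  that emerge from both halves at a cut undo each other. The scalar is the product of the two
  scalars of \<open>block_swap\<close>.\<close>

lemma R_matrix_unitary:
  assumes "y1 \<noteq> 0" "y2 \<noteq> 0" "vs \<in> bools 2" "ws \<in> bools 2"
  shows "(\<Sum>ds\<in>bools 2. R_matrix y1 y2 vs ds * R_matrix (inverse y1) (inverse y2) ws (map Not ds)) =
    (if ws = map Not vs then sigma (a\<^sup>2 * (y2 * inverse y1)) * sigma (a\<^sup>2 * (y1 * inverse y2)) else 0)"
proof -
  have "vs = [False, False] \<or> vs = [False, True] \<or> vs = [True, False] \<or> vs = [True, True]"
    "ws = [False, False] \<or> ws = [False, True] \<or> ws = [True, False] \<or> ws = [True, True]"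
    using assms(3,4) unfolding bools_2 by auto
  then show ?thesis using assms(1,2) a_nonzero
    by (elim disjE)
       (simp_all add: bools_2 R_matrix_def, simp_all add: sigma_def field_simps power2_eq_square)
qed

section \<open>Two blocks glued along a horizontal cut\<close>

text \<open>The common form of all models, so that symmetry in the columns is proved once. The
  second block is a reflected lower half: along the cut its columns carry inverted parameters and
  negated states. The columns \<open>zs\<close> have no counterpart above the cut, and
  \<open>fs\<close> are their fixed free ends.\<close>

definition pairing :: "complex list \<Rightarrow> bool list \<Rightarrow> complex list \<Rightarrow> bool list \<Rightarrow> complex list \<Rightarrow> bool list \<Rightarrow> complex list \<Rightarrow> complex" where
  "pairing xs es xs' es' zs fs ys =
     (\<Sum>ds\<in>bools (length ys). block xs ys es ds * block xs' (map inverse ys @ zs) es' (map Not ds @ fs))"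

text \<open>Each half produces a crossing at the cut, and the two cancel by
  \<open>R_matrix_unitary\<close>. The scalars from the top edges stay on both sides because they
  may vanish.\<close>

lemma pairing_swap_generic:
  assumes "\<forall>x\<in>set xs. x \<noteq> 0" "\<forall>x\<in>set xs'. x \<noteq> 0" "y1 \<noteq> 0" "y2 \<noteq> 0" "length es = length xs"
    "length es' = length xs'" "length fs = length zs"
  shows "sigma (a\<^sup>2 * (y2 * inverse y1)) * sigma (a\<^sup>2 * (y1 * inverse y2)) * pairing xs es xs' es' zs fs (p @ [y2, y1] @ q) =
    sigma (a\<^sup>2 * (y2 * inverse y1)) * sigma (a\<^sup>2 * (y1 * inverse y2)) * pairing xs es xs' es' zs fs (p @ [y1, y2] @ q)"
proof -
  define r where "r = sigma (a\<^sup>2 * (y2 * inverse y1))"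
  define r' where "r' = sigma (a\<^sup>2 * (y1 * inverse y2))"
  let ?R = "R_matrix y1 y2" and ?R' = "R_matrix (inverse y1) (inverse y2)"
  let ?A = "\<lambda>y y' dp ds dq. block xs (p @ [y, y'] @ q) es (dp @ ds @ dq)"
  let ?B = "\<lambda>y y' dp ds dq. block xs' (map inverse p @ [inverse y, inverse y'] @ (map inverse q @ zs)) es'
     (map Not dp @ ds @ (map Not dq @ fs))"
  have split: "pairing xs es xs' es' zs fs (p @ [y, y'] @ q) =
     (\<Sum>dp\<in>bools (length p). \<Sum>dq\<in>bools (length q). \<Sum>ds\<in>bools 2. ?A y y' dp ds dq * ?B y y' dp (map Not ds) dq)" for y y'
  proof -
    have "bools (length (p @ [y, y'] @ q)) = bools (length p + (2 + length q))" by simp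
    then have "pairing xs es xs' es' zs fs (p @ [y, y'] @ q) =
     (\<Sum>dp\<in>bools (length p). \<Sum>ds\<in>bools 2. \<Sum>dq\<in>bools (length q). ?A y y' dp ds dq * ?B y y' dp (map Not ds) dq)"
      unfolding pairing_def by (simp only: sum_bools_append) simp
    also have "\<dots> = (\<Sum>dp\<in>bools (length p). \<Sum>dq\<in>bools (length q). \<Sum>ds\<in>bools 2. ?A y y' dp ds dq * ?B y y' dp (map Not ds) dq)"
      by (intro sum.cong refl sum.swap)
    finally show ?thesis .
  qed
  have A: "r * ?A y2 y1 dp ds dq = (\<Sum>vs\<in>bools 2. ?A y1 y2 dp vs dq * ?R vs ds)"
    if "length dp = length p" "length ds = 2" "length dq = length q" for dp ds dq
    unfolding r_def using assms that by (intro block_swap) auto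
  have B: "r' * ?B y2 y1 dp ds dq = (\<Sum>vs\<in>bools 2. ?B y1 y2 dp vs dq * ?R' vs ds)"
    if "length dp = length p" "length ds = 2" "length dq = length q" for dp ds dq
    using assms that
      block_swap[of xs' "inverse y1" "inverse y2" es' "map Not dp" "map inverse p" ds "map Not dq @ fs" "map inverse q @ zs"]
    by (simp add: r'_def mult.commute)
  have U: "(\<Sum>ds\<in>bools 2. (r * ?A y2 y1 dp ds dq) * (r' * ?B y2 y1 dp (map Not ds) dq)) =
     r * r' * (\<Sum>ds\<in>bools 2. ?A y1 y2 dp ds dq * ?B y1 y2 dp (map Not ds) dq)"
    if "length dp = length p" "length dq = length q" for dp dq
  proof -
    have "(\<Sum>ds\<in>bools 2. (r * ?A y2 y1 dp ds dq) * (r' * ?B y2 y1 dp (map Not ds) dq)) =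
      (\<Sum>ds\<in>bools 2. (\<Sum>vs\<in>bools 2. ?A y1 y2 dp vs dq * ?R vs ds) * (\<Sum>ws\<in>bools 2. ?B y1 y2 dp ws dq * ?R' ws (map Not ds)))"
      using that by (intro sum.cong refl arg_cong2[where f = "(*)"] A B) auto
    also have "\<dots> = (\<Sum>ds\<in>bools 2. \<Sum>vs\<in>bools 2. \<Sum>ws\<in>bools 2.
        ?A y1 y2 dp vs dq * ?B y1 y2 dp ws dq * (?R vs ds * ?R' ws (map Not ds)))"
      by (simp only: sum_product) (simp only: mult_ac)
    also have "\<dots> = (\<Sum>vs\<in>bools 2. \<Sum>ds\<in>bools 2. \<Sum>ws\<in>bools 2.
        ?A y1 y2 dp vs dq * ?B y1 y2 dp ws dq * (?R vs ds * ?R' ws (map Not ds)))"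
      by (rule sum.swap)
    also have "\<dots> = (\<Sum>vs\<in>bools 2. \<Sum>ws\<in>bools 2. \<Sum>ds\<in>bools 2.
        ?A y1 y2 dp vs dq * ?B y1 y2 dp ws dq * (?R vs ds * ?R' ws (map Not ds)))"
      by (intro sum.cong refl sum.swap)
    also have "\<dots> = (\<Sum>vs\<in>bools 2. \<Sum>ws\<in>bools 2. if ws = map Not vs then
        ?A y1 y2 dp vs dq * ?B y1 y2 dp ws dq * (r * r') else 0)"
      using assms by (intro sum.cong refl, subst sum_distrib_left[symmetric], subst R_matrix_unitary)
        (auto simp: r_def r'_def)
    also have "\<dots> = (\<Sum>vs\<in>bools 2. ?A y1 y2 dp vs dq * ?B y1 y2 dp (map Not vs) dq * (r * r'))"
      by (intro sum.cong refl) (simp only: sum.delta' sum.delta finite_bools, simp)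
    finally show ?thesis by (simp add: sum_distrib_left mult_ac)
  qed
  have "r * r' * pairing xs es xs' es' zs fs (p @ [y2, y1] @ q) =
     (\<Sum>dp\<in>bools (length p). \<Sum>dq\<in>bools (length q). \<Sum>ds\<in>bools 2. (r * ?A y2 y1 dp ds dq) * (r' * ?B y2 y1 dp (map Not ds) dq))"
    unfolding split by (simp only: sum_distrib_left mult_ac)
  also have "\<dots> = (\<Sum>dp\<in>bools (length p). \<Sum>dq\<in>bools (length q).
      r * r' * (\<Sum>ds\<in>bools 2. ?A y1 y2 dp ds dq * ?B y1 y2 dp (map Not ds) dq))"
    by (intro sum.cong refl U) auto
  also have "\<dots> = r * r' * pairing xs es xs' es' zs fs (p @ [y1, y2] @ q)"
    unfolding split by (simp only: sum_distrib_left)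
  finally show ?thesis by (simp only: r_def r'_def)
qed

text \<open>The scalars of \<open>pairing_swap_generic\<close> are cancelled by continuation in the
  column parameters from the point where all of them are 1; there their product is the square of
  \<open>sigma (a\<^sup>2)\<close>.\<close>

lemma pairing_swap:
  assumes "\<forall>x\<in>set xs. x \<noteq> 0" "\<forall>x\<in>set xs'. x \<noteq> 0" "length es = length xs"
    "length es' = length xs'" "length fs = length zs" "\<forall>z\<in>set (p @ [y1, y2] @ q). z \<noteq> 0"
  shows "pairing xs es xs' es' zs fs (p @ [y1, y2] @ q) = pairing xs es xs' es' zs fs (p @ [y2, y1] @ q)"
proof -
  define k where "k = length p"
  define l where "l = length q"
  define hd_idx where "hd_idx = [0..<k]"
  define tl_idx where "tl_idx = map ((+) (k + 2)) [0..<l]"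
  let ?ys = "p @ [y1, y2] @ q"
  define P where "P i j y = pairing xs es xs' es' zs fs (map y hd_idx @ [y i, y j] @ map y tl_idx)"
    for i j and y :: "nat \<Rightarrow> complex"
  \<comment> \<open>The default value 1 keeps all coordinates nonzero beyond the end of the
    list.\<close>
  define Y where "Y i = (if i < length ?ys then ?ys ! i else 1)" for i
  have Y1: "Y k = y1" "Y (k + 1) = y2"
    by (simp_all add: Y_def k_def nth_append)
  have Y2: "map Y hd_idx = p"
    by (rule nth_equalityI) (simp_all add: hd_idx_def Y_def k_def nth_append)
  have Y3: "map Y tl_idx = q"
    by (rule nth_equalityI) (simp_all add: tl_idx_def Y_def k_def l_def nth_append)
  have ent: "curvewise_entire (\<lambda>x y. P i j y)" for i j
  proof -
    have eq: "map y hd_idx @ [y i, y j] @ map y tl_idx = map y (hd_idx @ [i, j] @ tl_idx)" for y :: "nat \<Rightarrow> complex"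
      by simp
    have 1: "curvewise_entire (\<lambda>x y. grid xs (map y js) us ls rs ds)" for js us ls rs ds
      using curvewise_entire_grid[where js = "[0..<length xs]" and p = "\<lambda>i x y. xs ! i" and ks = js and q = "\<lambda>i x y. y i"]
      by (simp add: ce_intros map_nth)
    have 2: "curvewise_entire (\<lambda>x y. grid xs' (map inverse (map y js) @ zs) us ls rs ds)" for js us ls rs ds
    proof -
      let ?q = "\<lambda>i x y. case i of Inl i \<Rightarrow> inverse (y i) | Inr c \<Rightarrow> c"
      have "curvewise_entire (\<lambda>x y. grid (map (\<lambda>i. xs' ! i) [0..<length xs']) (map (\<lambda>i. ?q i x y) (map Inl js @ map Inr zs)) us ls rs ds)"
        by (rule curvewise_entire_grid[where q = ?q]) (auto intro!: ce_intros split: sum.split)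
      then show ?thesis by (simp add: comp_def map_nth)
    qed
    show ?thesis unfolding P_def pairing_def block_def eq length_map length_append
      by (intro ce_intros 1 2)
  qed
  let ?f = "\<lambda>(x :: nat \<Rightarrow> complex) y. P k (k + 1) y - P (k + 1) k y"
  let ?g = "\<lambda>(x :: nat \<Rightarrow> complex) y. sigma (a\<^sup>2 * (y (k+1) * inverse (y k))) * sigma (a\<^sup>2 * (y k * inverse (y (k+1))))"
  have "?f (\<lambda>_. 1) Y = 0"
  proof (rule curvewise_entire_cancel[of ?f ?g "\<lambda>_. 1" "\<lambda>_. 1" "\<lambda>_. 1" Y])
    show "curvewise_entire (\<lambda>x y. P k (k + 1) y - P (k + 1) k y)" by (intro ce_intros ent)
    show "curvewise_entire (\<lambda>x y. sigma (a\<^sup>2 * (y (k+1) * inverse (y k))) * sigma (a\<^sup>2 * (y k * inverse (y (k+1)))))"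
      by (intro ce_intros curvewise_entire_sigma) (auto intro!: ce_intros)
    show "(P k (k + 1) y - P (k + 1) k y) * (sigma (a\<^sup>2 * (y (k+1) * inverse (y k))) * sigma (a\<^sup>2 * (y k * inverse (y (k+1))))) = 0"
      if "\<forall>i. y i \<noteq> 0" for y
    proof -
      have cancel: "(v - u) * c = 0" if "c * u = c * v" for c u v :: complex
        using that by auto
      show ?thesis
        unfolding P_def using that assms(1-5) by (intro cancel pairing_swap_generic) auto
    qed
    show "\<forall>i. Y i \<noteq> 0"
      using assms(6) nth_mem[of _ ?ys] unfolding Y_def by (metis zero_neq_one)
  qed (use sigma_a2 in auto)
  then show ?thesis by (simp only: P_def Y1 Y2 Y3) simp
qed

end

text \<open>Adjacent transpositions generate all permutations. \<open>front\<close> carries one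
  entry to the front of a segment; the induction on \<open>us\<close> applies it behind a prefix
  \<open>r\<close> that is already in order. \<open>Q\<close> is a side condition invariant under
  permutations.\<close>

lemma perm_invariant_of_swap:
  assumes swap: "\<And>p u v q. Q (p @ [u, v] @ q) \<Longrightarrow> f (p @ [u, v] @ q) = f (p @ [v, u] @ q)"
    and Q: "\<And>us vs. mset us = mset vs \<Longrightarrow> Q us \<Longrightarrow> Q vs"
    and eq: "mset us = mset vs" and us: "Q us"
  shows "f us = f vs"
proof -
  have front: "f (r @ p @ [v] @ q) = f (r @ v # p @ q)" if "Q (r @ p @ [v] @ q)" for r p v q
    using that
  proof (induction p arbitrary: q rule: rev_induct)
    case (snoc u p)
    have "f ((r @ p) @ [u, v] @ q) = f ((r @ p) @ [v, u] @ q)"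
      using snoc.prems by (intro swap) simp
    moreover have "Q (r @ p @ [v] @ (u # q))"
      by (rule Q[OF _ snoc.prems]) simp
    ultimately show ?case using snoc.IH[of "u # q"] by simp
  qed simp
  have "f (r @ us) = f (r @ vs)" if "mset us = mset vs" "Q (r @ us)" for r
    using that
  proof (induction us arbitrary: vs r)
    case (Cons u us)
    then have "u \<in> set vs" by (metis list.set_intros(1) set_mset_mset)
    then obtain p q where vs: "vs = p @ [u] @ q" by (metis append_Cons append_Nil in_set_conv_decomp)
    have "Q (r @ p @ [u] @ q)" by (rule Q[OF _ Cons.prems(2)]) (use Cons.prems(1) vs in simp)
    then have "f (r @ vs) = f ((r @ [u]) @ p @ q)" using front vs by simp
    also have "\<dots> = f ((r @ [u]) @ us)"
      using Cons vs by (intro Cons.IH[symmetric]) auto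
    finally show ?case by simp
  qed simp
  from this[of "[]"] eq us show ?thesis by simp
qed

context six_vertex
begin

lemma pairing_perm:
  assumes "\<forall>x\<in>set xs. x \<noteq> 0" "\<forall>x\<in>set xs'. x \<noteq> 0" "length es = length xs"
    "length es' = length xs'" "length fs = length zs" "\<forall>z\<in>set ys. z \<noteq> 0" "mset ys = mset ys'"
  shows "pairing xs es xs' es' zs fs ys = pairing xs es xs' es' zs fs ys'"
proof (rule perm_invariant_of_swap[where Q = "\<lambda>ys. \<forall>z\<in>set ys. z \<noteq> 0"])
  show "pairing xs es xs' es' zs fs (p @ [u, v] @ q) = pairing xs es xs' es' zs fs (p @ [v, u] @ q)"
    if "\<forall>z\<in>set (p @ [u, v] @ q). z \<noteq> 0" for p u v q
    using assms(1-5) that by (rule pairing_swap)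
qed (use assms in \<open>auto dest: mset_eq_setD\<close>)

definition Z_dom :: "complex list \<Rightarrow> complex list \<Rightarrow> complex" where
  "Z_dom xs ys = block xs ys (replicate (length xs) False) (replicate (length ys) False)"

text \<open>
  The even model is cut along the horizontal line between rows \<open>m\<close> and \<open>m + 1\<close>; reflecting the lower half turns it
  into a block with inverted parameters, whose free edges are the negations of those of the upper half. In the odd
  model the cut runs below the middle row, and the state \<open>s\<close> of the middle edge is kept fixed.
\<close>

definition Z_even :: "complex list \<Rightarrow> complex list \<Rightarrow> complex" where
  "Z_even xs ys = (\<Sum>es\<in>bools (length xs). pairing xs es (map inverse xs) (map Not es) [] [] ys)"

definition Z_odd :: "bool \<Rightarrow> complex list \<Rightarrow> complex \<Rightarrow> complex list \<Rightarrow> complex \<Rightarrow> complex" where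
  "Z_odd s xs X ys Y =
     (\<Sum>es\<in>bools (length xs). pairing (xs @ [X]) (es @ [s]) (map inverse xs) (map Not es) [inverse Y] [s] ys)"

end

section \<open>Symmetries and frozen corners\<close>

context six_vertex
begin

text \<open>A second block without rows lets its vertical lines pass unchanged, which forces the
  lower edges of the first block to point down. In this form \<open>pairing_perm\<close>
  applies.\<close>

lemma Z_dom_eq_pairing:
  "Z_dom xs ys = pairing xs (replicate (length xs) False) [] [] [] [] ys"
proof -
  let ?F = "replicate (length ys) False"
  have "pairing xs (replicate (length xs) False) [] [] [] [] ys =
     (\<Sum>ds\<in>bools (length ys). if ds = ?F then block xs ys (replicate (length xs) False) ds else 0)"
    unfolding pairing_def
  proof (intro sum.cong refl)
    fix ds assume ds: "ds \<in> bools (length ys)"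
    have "map Not ?F = replicate (length ys) True" by simp
    then have "replicate (length ys) True = map Not ds \<longleftrightarrow> ds = ?F"
      using map_Not_map_Not[of ds] map_Not_map_Not[of ?F] by metis
    then show "block xs ys (replicate (length xs) False) ds * block [] (map inverse ys @ []) [] (map Not ds @ []) =
       (if ds = ?F then block xs ys (replicate (length xs) False) ds else 0)"
      using ds by (simp add: block_def grid_Nil_rows)
  qed
  then show ?thesis by (simp add: Z_dom_def)
qed

lemma Z_dom_perm_right:
  assumes "\<forall>x\<in>set xs. x \<noteq> 0" "\<forall>y\<in>set ys. y \<noteq> 0" "mset ys = mset ys'"
  shows "Z_dom xs ys = Z_dom xs ys'"
  unfolding Z_dom_eq_pairing using assms by (intro pairing_perm) auto

lemma Z_even_perm_right:
  assumes "\<forall>x\<in>set xs. x \<noteq> 0" "\<forall>y\<in>set ys. y \<noteq> 0" "mset ys = mset ys'"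
  shows "Z_even xs ys = Z_even xs ys'"
  unfolding Z_even_def using assms by (intro sum.cong refl pairing_perm) auto

lemma Z_odd_perm_right:
  assumes "\<forall>x\<in>set xs. x \<noteq> 0" "X \<noteq> 0" "\<forall>y\<in>set ys. y \<noteq> 0" "mset ys = mset ys'"
  shows "Z_odd s xs X ys Y = Z_odd s xs X ys' Y"
  unfolding Z_odd_def using assms by (intro sum.cong refl pairing_perm) auto

lemma Z_dom_transpose: "Z_dom xs ys = Z_dom (map inverse ys) (map inverse xs)"
  unfolding Z_dom_def by (subst block_transpose) simp_all

lemma Z_dom_perm_left:
  assumes "\<forall>x\<in>set xs. x \<noteq> 0" "\<forall>y\<in>set ys. y \<noteq> 0" "mset xs = mset xs'"
  shows "Z_dom xs ys = Z_dom xs' ys"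
  unfolding Z_dom_transpose[of _ ys] using assms by (intro Z_dom_perm_right) auto

text \<open>\<open>grid_reflect\<close> reverses the order of the rows; symmetry in the rows
  restores it.\<close>

lemma Z_dom_inverse:
  assumes "\<forall>x\<in>set xs. x \<noteq> 0" "\<forall>y\<in>set ys. y \<noteq> 0"
  shows "Z_dom (map inverse xs) (map inverse ys) = Z_dom xs ys"
proof -
  have "Z_dom (rev (map inverse xs)) (map inverse ys) = Z_dom xs ys"
    unfolding Z_dom_def block_def
    using grid_reflect[of "replicate (length ys) True" ys "replicate (length ys) False" "replicate (length xs) True" xs
        "replicate (length xs) False"] by simp
  moreover have "Z_dom (rev (map inverse xs)) (map inverse ys) = Z_dom (map inverse xs) (map inverse ys)"
    using assms by (intro Z_dom_perm_left) auto
  ultimately show ?thesis by simp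
qed

lemma Z_dom_commute:
  assumes "\<forall>x\<in>set xs. x \<noteq> 0" "\<forall>y\<in>set ys. y \<noteq> 0"
  shows "Z_dom xs ys = Z_dom ys xs"
  using Z_dom_transpose[of xs ys] Z_dom_inverse[of ys xs] assms by simp

lemma map_inverse_inverse [simp]: "map inverse (map inverse xs) = (xs :: complex list)"
  by (simp add: comp_def)

lemma Z_even_alt:
  "Z_even xs ys = (\<Sum>es\<in>bools (length xs). \<Sum>ds\<in>bools (length ys). block xs ys es ds *
     block (map inverse xs) (map inverse ys) (map Not es) (map Not ds))"
  by (simp add: Z_even_def pairing_def)

lemma Z_even_inverse: "Z_even (map inverse xs) (map inverse ys) = Z_even xs ys"
proof -
  have "Z_even (map inverse xs) (map inverse ys) =
     (\<Sum>es\<in>bools (length xs). \<Sum>ds\<in>bools (length ys). block (map inverse xs) (map inverse ys) es ds *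
       block xs ys (map Not es) (map Not ds))"
    by (simp only: Z_even_alt map_inverse_inverse length_map)
  also have "\<dots> = (\<Sum>es\<in>bools (length xs). \<Sum>ds\<in>bools (length ys).
       block (map inverse xs) (map inverse ys) (map Not es) (map Not ds) * block xs ys es ds)"
    by (subst sum_bools_Not, rule sum.cong[OF refl], subst sum_bools_Not) (simp only: map_Not_map_Not)
  finally show ?thesis by (simp only: Z_even_alt mult.commute)
qed

text \<open>Transposing both halves inverts all parameters, that is, exchanges the upper and the
  lower half; \<open>Z_even_inverse\<close> exchanges them back.\<close>

lemma Z_even_commute: "Z_even xs ys = Z_even ys xs"
proof -
  have "Z_even xs ys = (\<Sum>es\<in>bools (length xs). \<Sum>ds\<in>bools (length ys).
      block (map inverse ys) (map inverse xs) ds es * block ys xs (map Not ds) (map Not es))"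
    unfolding Z_even_alt
  proof (intro sum.cong refl)
    fix es ds assume "es \<in> bools (length xs)" "ds \<in> bools (length ys)"
    then show "block xs ys es ds * block (map inverse xs) (map inverse ys) (map Not es) (map Not ds) =
       block (map inverse ys) (map inverse xs) ds es * block ys xs (map Not ds) (map Not es)"
      using block_transpose[of es xs ds ys] block_transpose[of "map Not es" "map inverse xs" "map Not ds" "map inverse ys"]
      by (simp only: map_inverse_inverse length_map length_bools)
  qed
  also have "\<dots> = Z_even (map inverse ys) (map inverse xs)"
    unfolding Z_even_alt map_inverse_inverse length_map by (rule sum.swap)
  finally show ?thesis by (simp only: Z_even_inverse)
qed

lemma Z_even_perm_left:
  assumes "\<forall>x\<in>set xs. x \<noteq> 0" "\<forall>y\<in>set ys. y \<noteq> 0" "mset xs = mset xs'"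
  shows "Z_even xs ys = Z_even xs' ys"
  unfolding Z_even_commute[of _ ys] using assms by (intro Z_even_perm_right) auto

lemma Z_odd_alt:
  "Z_odd s xs X ys Y = (\<Sum>es\<in>bools (length xs). \<Sum>ds\<in>bools (length ys). block (xs @ [X]) ys (es @ [s]) ds *
     block (map inverse xs) (map inverse (ys @ [Y])) (map Not es) (map Not ds @ [s]))"
  by (simp add: Z_odd_def pairing_def)

text \<open>Transposition turns the half with the extra row \<open>X\<close> into the half with the
  extra column \<open>Y\<close> and vice versa. Facts about columns thereby carry over to
  rows.\<close>

lemma Z_odd_commute: "Z_odd s xs X ys Y = Z_odd s ys Y xs X"
proof -
  let ?A = "\<lambda>es ds. block (map inverse ys) (map inverse (xs @ [X])) ds (es @ [s])"
  let ?B = "\<lambda>es ds. block (ys @ [Y]) xs (ds @ [s]) es"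
  have "Z_odd s xs X ys Y = (\<Sum>es\<in>bools (length xs). \<Sum>ds\<in>bools (length ys). ?A es ds * ?B (map Not es) (map Not ds))"
    unfolding Z_odd_alt
  proof (intro sum.cong refl)
    fix es ds assume "es \<in> bools (length xs)" "ds \<in> bools (length ys)"
    then show "block (xs @ [X]) ys (es @ [s]) ds * block (map inverse xs) (map inverse (ys @ [Y])) (map Not es) (map Not ds @ [s]) =
       ?A es ds * ?B (map Not es) (map Not ds)"
      using block_transpose[of "es @ [s]" "xs @ [X]" ds ys]
        block_transpose[of "map Not es" "map inverse xs" "map Not ds @ [s]" "map inverse (ys @ [Y])"]
      by (simp only: map_inverse_inverse length_map length_bools length_append list.size)
  qed
  also have "\<dots> = (\<Sum>es\<in>bools (length xs). \<Sum>ds\<in>bools (length ys). ?A (map Not es) (map Not ds) * ?B es ds)"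
    by (subst sum_bools_Not, rule sum.cong[OF refl], subst sum_bools_Not) (simp only: map_Not_map_Not)
  also have "\<dots> = (\<Sum>ds\<in>bools (length ys). \<Sum>es\<in>bools (length xs). ?A (map Not es) (map Not ds) * ?B es ds)"
    by (rule sum.swap)
  finally show ?thesis by (simp only: Z_odd_alt mult.commute)
qed

lemma Z_odd_perm_left:
  assumes "\<forall>x\<in>set xs. x \<noteq> 0" "Y \<noteq> 0" "\<forall>y\<in>set ys. y \<noteq> 0" "mset xs = mset xs'"
  shows "Z_odd s xs X ys Y = Z_odd s xs' X ys Y"
  unfolding Z_odd_commute[of s _ X] using assms by (intro Z_odd_perm_right) auto

section \<open>Corners frozen by the ice rule\<close>

text \<open>Weight of types 3 and 4 where the lines \<open>x\<close> and \<open>y\<close> cross;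
  types 5 and 6 have weight \<open>sw y x\<close>.\<close>

definition sw :: "complex \<Rightarrow> complex \<Rightarrow> complex" where
  "sw x y = sigma (a * (x * inverse y))"

lemma sw_inverse [simp]: "sw (inverse x) (inverse y) = sw y x"
  by (simp add: sw_def mult.commute)

lemma vweight_simps:
  "vweight a (x * inverse y) True True True v = (if v then sw x y else 0)"
  "vweight a (x * inverse y) True False True v = (if v then 0 else sigma (a\<^sup>2))"
  "vweight a (x * inverse y) True r False v = (if r \<and> \<not> v then sw y x else 0)"
  by (auto simp: vweight_def sw_def mult.commute)

text \<open>A downward arrow from above and a left edge pointing right leave only type 6, which
  sends the downward arrow on.\<close>

lemma col_frozen_down:
  "length rs = length xs \<Longrightarrow> col (map (\<lambda>x. x * inverse y) xs) False (replicate (length xs) True) rs d =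
    (if rs = replicate (length xs) True \<and> \<not> d then \<Prod>x\<leftarrow>xs. sw y x else 0)"
proof (induction xs arbitrary: rs)
  case (Cons x xs)
  then obtain r rs' where "rs = r # rs'" "length rs' = length xs" by (auto simp: length_Suc_conv)
  then show ?case using Cons.IH[of rs'] by (cases r) (auto simp: vweight_simps UNIV_bool)
qed auto

lemma col_frozen_up:
  "length rs = length xs \<Longrightarrow> col (map (\<lambda>x. x * inverse y) xs) True (replicate (length xs) True) rs True =
    (if rs = replicate (length xs) True then \<Prod>x\<leftarrow>xs. sw x y else 0)"
proof (induction xs arbitrary: rs)
  case (Cons x xs)
  then obtain r rs' where "rs = r # rs'" "length rs' = length xs" by (auto simp: length_Suc_conv)
  then show ?case using Cons.IH[of rs'] by (cases r) (auto simp: vweight_simps UNIV_bool col_frozen_down)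
qed auto

lemma block_Cons_col:
  "block xs (y # ys) es (d # ds) = (\<Sum>ks\<in>bools (length xs).
     col (map (\<lambda>x. x * inverse y) xs) True (replicate (length xs) True) ks d *
     grid xs ys (replicate (length ys) True) ks es ds)"
  by (simp add: block_def)

lemma block_col_up:
  "block xs (y # ys) es (True # ds) = (\<Prod>x\<leftarrow>xs. sw x y) * block xs ys es ds"
proof -
  have "block xs (y # ys) es (True # ds) = (\<Sum>ks\<in>bools (length xs). if ks = replicate (length xs) True
     then (\<Prod>x\<leftarrow>xs. sw x y) * grid xs ys (replicate (length ys) True) ks es ds else 0)"
    unfolding block_Cons_col by (intro sum.cong refl) (simp add: col_frozen_up)
  then show ?thesis by (simp add: block_def)
qed

lemma block_row_right:
  assumes "length es = length xs" "length ds = length ys"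
  shows "block (x # xs) ys (True # es) ds = (\<Prod>y\<leftarrow>ys. sw x y) * block xs ys es ds"
proof -
  have "block (x # xs) ys (True # es) ds = block (map inverse ys) (inverse x # map inverse xs) ds (True # es)"
    using assms by (subst block_transpose) auto
  also have "\<dots> = (\<Prod>y\<leftarrow>map inverse ys. sw y (inverse x)) * block (map inverse ys) (map inverse xs) ds es"
    by (rule block_col_up)
  also have "block (map inverse ys) (map inverse xs) ds es = block xs ys es ds"
    using assms by (subst block_transpose[symmetric]) auto
  finally show ?thesis by (simp add: comp_def)
qed

text \<open>Weight of a forced first row and first column: type 1 at the corner, type 5 along the
  row \<open>x\<close>, type 6 down the column \<open>y\<close>.\<close>

definition frozen :: "complex \<Rightarrow> complex list \<Rightarrow> complex \<Rightarrow> complex list \<Rightarrow> complex" where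
  "frozen x xs y ys = sigma (a\<^sup>2) * (\<Prod>y'\<leftarrow>ys. sw y' x) * (\<Prod>x'\<leftarrow>xs. sw y x')"

lemma sw_eq_0: "a * x = y \<Longrightarrow> x \<noteq> 0 \<Longrightarrow> sw x y = 0"
  using a_nonzero by (auto simp: sw_def sigma_def)

text \<open>The two outer edges of the corner vertex allow types 1 and 3, and
  \<open>a * x = y\<close> annihilates type 3. Type 1 at the corner forces the rest of its row and
  column, and the edges entering the smaller block have the states of the original boundary.\<close>

lemma block_corner:
  assumes "a * x = y" "x \<noteq> 0" "length es = length xs" "length ds = length ys"
  shows "block (x # xs) (y # ys) (e # es) (d # ds) =
    (if e \<or> d then 0 else frozen x xs y ys * block xs ys es ds)"
proof -
  let ?T = "\<lambda>n. replicate n True"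
  let ?v = "False # ?T (length ys)"
  have row: "col (map (\<lambda>y. x * inverse y) (y # ys)) True (?T (Suc (length ys))) vs e =
      (if vs = ?v then of_bool (\<not> e) * sigma (a\<^sup>2) * (\<Prod>y'\<leftarrow>ys. sw y' x) else 0)"
    if vs: "vs \<in> bools (Suc (length ys))" for vs
  proof -
    obtain v vs' where v: "vs = v # vs'" "length vs' = length ys" using vs by (auto simp: length_Suc_conv)
    have row': "col (map (\<lambda>y. x * inverse y) ys) False (?T (length ys)) vs' e =
        (if vs' = ?T (length ys) \<and> \<not> e then \<Prod>y'\<leftarrow>ys. sw y' x else 0)"
      using col_frozen_down[of vs' "map inverse ys" "inverse x" e] v by (simp add: comp_def mult.commute)
    show ?thesis using sw_eq_0[OF assms(1,2)]
      by (cases v) (auto simp: v vweight_simps UNIV_bool row')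
  qed
  have if_mult: "(if P then u else 0) * v = (if P then u * v else 0)" for P and u v :: complex
    by simp
  have "block (x # xs) (y # ys) (e # es) (d # ds) = (\<Sum>vs\<in>bools (Suc (length ys)).
      col (map (\<lambda>y. x * inverse y) (y # ys)) True (?T (Suc (length ys))) vs e * grid xs (y # ys) vs (?T (length xs)) es (d # ds))"
    using assms unfolding block_def by (simp add: grid_Cons_row del: grid.simps col.simps)
  also have "\<dots> = (\<Sum>vs\<in>bools (Suc (length ys)). if vs = ?v then
      of_bool (\<not> e) * sigma (a\<^sup>2) * (\<Prod>y'\<leftarrow>ys. sw y' x) * grid xs (y # ys) vs (?T (length xs)) es (d # ds) else 0)"
    by (intro sum.cong refl) (simp only: row if_mult)
  also have "\<dots> = of_bool (\<not> e) * sigma (a\<^sup>2) * (\<Prod>y'\<leftarrow>ys. sw y' x) * grid xs (y # ys) ?v (?T (length xs)) es (d # ds)"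
    by (simp del: grid.simps)
  also have "grid xs (y # ys) ?v (?T (length xs)) es (d # ds) =
     (\<Sum>ks\<in>bools (length xs). if ks = ?T (length xs) then
       of_bool (\<not> d) * (\<Prod>x'\<leftarrow>xs. sw y x') * grid xs ys (?T (length ys)) ks es ds else 0)"
    unfolding grid.simps by (intro sum.cong refl) (auto simp: col_frozen_down)
  also have "\<dots> = of_bool (\<not> d) * (\<Prod>x'\<leftarrow>xs. sw y x') * block xs ys es ds"
    by (simp add: block_def)
  finally show ?thesis by (simp add: frozen_def)
qed

lemma Z_dom_frozen:
  assumes "a * x = y" "x \<noteq> 0"
  shows "Z_dom (x # xs) (y # ys) = frozen x xs y ys * Z_dom xs ys"
  using assms by (simp add: Z_dom_def block_corner)

text \<open>Ends in state True force both lines to go straight, for any \<open>x\<close> and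
  \<open>y\<close>. The reflected half is in this situation when \<open>block_corner\<close> freezes
  the other half.\<close>

lemma block_corner_up:
  assumes "length es = length xs" "length ds = length ys"
  shows "block (x # xs) (y # ys) (True # es) (True # ds) =
    sw x y * (\<Prod>y'\<leftarrow>ys. sw x y') * (\<Prod>x'\<leftarrow>xs. sw x' y) * block xs ys es ds"
  using assms by (simp add: block_row_right block_col_up)

lemma sw_eq_sigma_a2: "a * x = y \<Longrightarrow> x \<noteq> 0 \<Longrightarrow> sw y x = sigma (a\<^sup>2)"
  using a_nonzero by (auto simp: sw_def power2_eq_square mult.assoc)

lemma Z_even_frozen:
  assumes "a * x = y" "x \<noteq> 0"
  shows "Z_even (x # xs) (y # ys) = (frozen x xs y ys)\<^sup>2 * Z_even xs ys"
proof -
  let ?A = "\<lambda>es ds. block xs ys es ds"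
  let ?B = "\<lambda>es ds. block (map inverse xs) (map inverse ys) (map Not es) (map Not ds)"
  have "Z_even (x # xs) (y # ys) = (\<Sum>es\<in>bools (length xs). \<Sum>ds\<in>bools (length ys).
     (frozen x xs y ys * ?A es ds) * (frozen x xs y ys * ?B es ds))"
    unfolding Z_even_alt length_Cons sum_bools_Suc[where n = "length xs"]
    unfolding sum_bools_Suc[where n = "length ys"] UNIV_bool
    using assms by (simp add: block_corner)
     (simp add: block_corner_up comp_def sw_eq_sigma_a2 frozen_def)
  also have "\<dots> = (frozen x xs y ys)\<^sup>2 * Z_even xs ys"
    unfolding Z_even_alt by (simp add: sum_distrib_left power2_eq_square mult_ac)
  finally show ?thesis .
qed

lemma Z_odd_frozen:
  assumes "a * x = y" "x \<noteq> 0"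
  shows "Z_odd s (x # xs) X (y # ys) Y =
    frozen x xs y ys * frozen x (xs @ [X]) y (ys @ [Y]) * Z_odd s xs X ys Y"
proof -
  let ?A = "\<lambda>es ds. block (xs @ [X]) ys (es @ [s]) ds"
  let ?B = "\<lambda>es ds. block (map inverse xs) (map inverse (ys @ [Y])) (map Not es) (map Not ds @ [s])"
  have "Z_odd s (x # xs) X (y # ys) Y = (\<Sum>es\<in>bools (length xs). \<Sum>ds\<in>bools (length ys).
     (frozen x (xs @ [X]) y ys * ?A es ds) * (frozen x xs y (ys @ [Y]) * ?B es ds))"
    unfolding Z_odd_alt length_Cons sum_bools_Suc[where n = "length xs"]
    unfolding sum_bools_Suc[where n = "length ys"] UNIV_bool
    using assms by (simp add: block_corner)
     (simp add: block_corner_up comp_def sw_eq_sigma_a2 frozen_def)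
  also have "\<dots> = frozen x (xs @ [X]) y ys * frozen x xs y (ys @ [Y]) * Z_odd s xs X ys Y"
    unfolding Z_odd_alt by (simp add: sum_distrib_left mult_ac)
  \<comment> \<open>Regrouped into the factors of the domain-wall models without and with the pair
    \<open>X\<close>, \<open>Y\<close>.\<close>
  also have "frozen x (xs @ [X]) y ys * frozen x xs y (ys @ [Y]) = frozen x xs y ys * frozen x (xs @ [X]) y (ys @ [Y])"
    by (simp add: frozen_def)
  finally show ?thesis .
qed

end

section \<open>Laurent polynomials and reconnected lines\<close>

text \<open>Laurent polynomials with exponents in \<open>{-d, -d + 2, ..., d}\<close>.\<close>

definition laurent :: "nat \<Rightarrow> (complex \<Rightarrow> complex) \<Rightarrow> bool" where
  "laurent d f \<longleftrightarrow> (\<exists>p. degree p \<le> d \<and> (\<forall>x. x \<noteq> 0 \<longrightarrow> f x * x ^ d = poly p (x\<^sup>2)))"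

lemma laurentI: "degree p \<le> d \<Longrightarrow> (\<And>x. x \<noteq> 0 \<Longrightarrow> f x * x ^ d = poly p (x\<^sup>2)) \<Longrightarrow> laurent d f"
  unfolding laurent_def by blast

lemma laurent_const: "laurent 0 (\<lambda>_. c)"
  by (rule laurentI[of "[:c:]"]) auto

lemma laurent_zero: "laurent d (\<lambda>_. 0)"
  by (rule laurentI[of 0]) auto

lemma laurent_mult: "laurent d f \<Longrightarrow> laurent e g \<Longrightarrow> laurent (d + e) (\<lambda>x. f x * g x)"
proof -
  assume "laurent d f" "laurent e g"
  then obtain p q where p: "degree p \<le> d" "\<And>x. x \<noteq> 0 \<Longrightarrow> f x * x ^ d = poly p (x\<^sup>2)"
    and q: "degree q \<le> e" "\<And>x. x \<noteq> 0 \<Longrightarrow> g x * x ^ e = poly q (x\<^sup>2)"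
    unfolding laurent_def by blast
  show ?thesis
  proof (rule laurentI[of "p * q"])
    show "degree (p * q) \<le> d + e" using p(1) q(1) degree_mult_le[of p q] by linarith
    show "f x * g x * x ^ (d + e) = poly (p * q) (x\<^sup>2)" if "x \<noteq> 0" for x
    proof -
      have "f x * g x * x ^ (d + e) = (f x * x ^ d) * (g x * x ^ e)"
        by (simp only: power_add mult_ac)
      then show ?thesis using p(2)[OF that] q(2)[OF that] by simp
    qed
  qed
qed

lemma laurent_add: "laurent d f \<Longrightarrow> laurent d g \<Longrightarrow> laurent d (\<lambda>x. f x + g x)"
proof -
  assume "laurent d f" "laurent d g"
  then obtain p q where p: "degree p \<le> d" "\<And>x. x \<noteq> 0 \<Longrightarrow> f x * x ^ d = poly p (x\<^sup>2)"
    and q: "degree q \<le> d" "\<And>x. x \<noteq> 0 \<Longrightarrow> g x * x ^ d = poly q (x\<^sup>2)"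
    unfolding laurent_def by blast
  show ?thesis
  proof (rule laurentI[of "p + q"])
    show "degree (p + q) \<le> d" using p(1) q(1) by (rule degree_add_le)
    show "(f x + g x) * x ^ d = poly (p + q) (x\<^sup>2)" if "x \<noteq> 0" for x
      using p(2)[OF that] q(2)[OF that] by (simp add: distrib_right)
  qed
qed

lemma laurent_cmult: "laurent d f \<Longrightarrow> laurent d (\<lambda>x. c * f x)"
  using laurent_mult[OF laurent_const] by simp

lemma laurent_multc: "laurent d f \<Longrightarrow> laurent d (\<lambda>x. f x * c)"
  using laurent_cmult[of d f c] by (simp add: mult.commute)

lemma laurent_diff: "laurent d f \<Longrightarrow> laurent d g \<Longrightarrow> laurent d (\<lambda>x. f x - g x)"
  using laurent_add[OF _ laurent_cmult, of d f g "-1"] by simp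

lemma laurent_sum: "(\<And>i. i \<in> A \<Longrightarrow> laurent d (f i)) \<Longrightarrow> laurent d (\<lambda>x. \<Sum>i\<in>A. f i x)"
  by (induction A rule: infinite_finite_induct) (auto intro!: laurent_zero laurent_add)

lemma laurent_prod:
  "finite A \<Longrightarrow> (\<And>i. i \<in> A \<Longrightarrow> laurent d (f i)) \<Longrightarrow> laurent (d * card A) (\<lambda>x. \<Prod>i\<in>A. f i x)"
proof (induction A rule: finite_induct)
  case empty
  then show ?case using laurent_const[of 1] by simp
next
  case (insert i A)
  then have "laurent (d + d * card A) (\<lambda>x. f i x * (\<Prod>i\<in>A. f i x))" by (intro laurent_mult) auto
  then show ?case using insert by simp
qed

lemma laurent_prod_list:
  "(\<And>i. i \<in> set js \<Longrightarrow> laurent d (f i)) \<Longrightarrow> laurent (d * length js) (\<lambda>x. \<Prod>i\<leftarrow>js. f i x)"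
proof (induction js)
  case Nil
  then show ?case using laurent_const[of 1] by simp
next
  case (Cons i js)
  then have "laurent (d + d * length js) (\<lambda>x. f i x * (\<Prod>i\<leftarrow>js. f i x))" by (intro laurent_mult) auto
  then show ?case by simp
qed

lemma laurent_raise: "laurent d f \<Longrightarrow> laurent (d + 2) f"
proof -
  assume "laurent d f"
  then obtain p where p: "degree p \<le> d" "\<And>x. x \<noteq> 0 \<Longrightarrow> f x * x ^ d = poly p (x\<^sup>2)"
    unfolding laurent_def by blast
  show ?thesis
  proof (rule laurentI[of "pCons 0 p"])
    show "degree (pCons 0 p) \<le> d + 2" using p(1) by (simp add: degree_pCons_eq_if)
    show "f x * x ^ (d + 2) = poly (pCons 0 p) (x\<^sup>2)" if "x \<noteq> 0" for x
      using p(2)[OF that] by (simp add: power_add power2_eq_square mult_ac)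
  qed
qed

lemma laurent_inverse: "laurent d f \<Longrightarrow> laurent d (\<lambda>x. f (inverse x))"
proof -
  assume "laurent d f"
  then obtain p where p: "degree p \<le> d" "\<And>x. x \<noteq> 0 \<Longrightarrow> f x * x ^ d = poly p (x\<^sup>2)"
    unfolding laurent_def by blast
  show ?thesis
  \<comment> \<open>\<open>reflect_poly\<close> reverses the coefficients only up to the actual
    degree of \<open>p\<close>; the monomial makes up the difference to \<open>d\<close>.\<close>
  proof (rule laurentI[of "monom 1 (d - degree p) * reflect_poly p"])
    have "degree (monom (1::complex) (d - degree p) * reflect_poly p) \<le> (d - degree p) + degree p"
      using degree_mult_le[of "monom (1::complex) (d - degree p)" "reflect_poly p"] degree_reflect_poly_le[of p]
      by (simp add: degree_monom_eq)
    then show "degree (monom (1::complex) (d - degree p) * reflect_poly p) \<le> d" using p(1) by simp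
    fix x :: complex assume x: "x \<noteq> 0"
    have "f (inverse x) * inverse x ^ d = poly p (inverse (x\<^sup>2))"
      using p(2)[of "inverse x"] x by (simp add: power_inverse)
    then have "f (inverse x) * inverse x ^ d * x ^ (2 * d) = poly p (inverse (x\<^sup>2)) * (x\<^sup>2) ^ d"
      by (simp add: power_mult)
    moreover have "inverse x ^ d * x ^ (2 * d) = x ^ d"
      using x by (simp add: mult_2 power_add power_inverse)
    moreover have "(x\<^sup>2) ^ d = (x\<^sup>2) ^ (d - degree p) * (x\<^sup>2) ^ degree p"
      using p(1) by (simp flip: power_add)
    ultimately show "f (inverse x) * x ^ d = poly (monom 1 (d - degree p) * reflect_poly p) (x\<^sup>2)"
      using x by (simp add: poly_reflect_poly_nz poly_monom mult_ac)
  qed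
qed

lemma laurent_linear: "laurent 1 (\<lambda>x. b * x + c * inverse x)"
  by (rule laurentI[of "[:c, b:]"]) (auto simp: field_simps power2_eq_square)

lemma laurent_sigma: "laurent 1 (\<lambda>x. sigma (k * x))"
  using laurent_linear[of k "- inverse k"] by (simp add: sigma_def)

text \<open>With \<open>d\<close> zeros known, one scalar stays free: \<open>p\<close> and its
  coefficient at \<open>d\<close> times the monic product \<open>h\<close> differ by a polynomial of
  degree below \<open>d\<close> that has \<open>d\<close> zeros. Zeros are indexed by squares
  because \<open>f\<close> depends on the sign of \<open>x\<close> only through its parity.\<close>

lemma laurent_roots:
  assumes f: "laurent d f" and W: "finite W" "card W = d"
    and root: "\<And>w. w \<in> W \<Longrightarrow> \<exists>b. b \<noteq> 0 \<and> b\<^sup>2 = w \<and> f b = 0"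
  shows "\<exists>c. \<forall>x. x \<noteq> 0 \<longrightarrow> f x * x ^ d = c * (\<Prod>w\<in>W. x\<^sup>2 - w)"
proof -
  from f obtain p where p: "degree p \<le> d" "\<And>x. x \<noteq> 0 \<Longrightarrow> f x * x ^ d = poly p (x\<^sup>2)"
    unfolding laurent_def by blast
  define h where "h = (\<Prod>w\<in>W. [:- w, 1:])"
  have h: "poly h z = (\<Prod>w\<in>W. z - w)" for z
    by (simp add: h_def poly_prod)
  have lead: "lead_coeff h = 1"
    unfolding h_def lead_coeff_prod by simp
  have "degree h = d"
    using W by (simp add: h_def degree_prod_eq_sum_degree)
  define r where "r = p - Polynomial.smult (coeff p d) h"
  have "degree r \<le> d"
    unfolding r_def using p(1) \<open>degree h = d\<close> by (intro degree_diff_le) (auto intro: order.trans[OF degree_smult_le])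
  moreover have "coeff r d = 0"
    using lead \<open>degree h = d\<close> by (simp add: r_def)
  ultimately have deg: "degree r < d \<or> r = 0"
    by (metis le_neq_implies_less leading_coeff_0_iff)
  have zeros: "W \<subseteq> {z. poly r z = 0}"
  proof
    fix w assume w: "w \<in> W"
    then obtain b where "b \<noteq> 0" "b\<^sup>2 = w" "f b = 0" using root by blast
    then have "poly p w = 0" using p(2)[of b] by simp
    moreover have "poly h w = 0" using w W by (auto simp: h)
    ultimately show "w \<in> {z. poly r z = 0}" by (simp add: r_def)
  qed
  have "r = 0"
  proof (rule ccontr)
    assume "r \<noteq> 0"
    then have "card W \<le> degree r"
      using card_mono[OF poly_roots_finite zeros] card_poly_roots_bound[of r] by (meson order.trans)
    with deg W \<open>r \<noteq> 0\<close> show False by simp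
  qed
  then have "poly p z = coeff p d * (\<Prod>w\<in>W. z - w)" for z
    using h by (metis eq_iff_diff_eq_0 poly_smult r_def)
  with p(2) show ?thesis by metis
qed

lemma laurent_many_roots:
  assumes f: "laurent d f" and W: "finite W" "card W > d"
    and root: "\<And>w. w \<in> W \<Longrightarrow> \<exists>b. b \<noteq> 0 \<and> b\<^sup>2 = w \<and> f b = 0"
    and x: "x \<noteq> 0"
  shows "f x = 0"
proof -
  from f obtain p where p: "degree p \<le> d" "\<And>x. x \<noteq> 0 \<Longrightarrow> f x * x ^ d = poly p (x\<^sup>2)"
    unfolding laurent_def by blast
  have zeros: "W \<subseteq> {z. poly p z = 0}"
    using root p(2) by fastforce
  have "p = 0"
  proof (rule ccontr)
    assume "p \<noteq> 0"
    then have "card W \<le> degree p"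
      using card_mono[OF poly_roots_finite zeros] card_poly_roots_bound[of p] by (meson order.trans)
    with p(1) W show False by simp
  qed
  then show ?thesis using p(2)[OF x] x by simp
qed

context six_vertex
begin

section \<open>Degrees in one line parameter\<close>

lemma laurent_sw: "laurent 1 (\<lambda>x. sw x y)" "laurent 1 (\<lambda>x. sw y x)"
proof -
  show "laurent 1 (\<lambda>x. sw x y)"
    using laurent_sigma[of "a * inverse y"] by (simp add: sw_def mult_ac)
  show "laurent 1 (\<lambda>x. sw y x)"
    using laurent_linear[of "- inverse (a * y)" "a * y"] by (simp add: sw_def sigma_def mult_ac)
qed

lemma laurent_vweight:
  "laurent (if U = D then 1 else 0) (\<lambda>x. vweight a (x * inverse y) L R U D)"
  using laurent_sw[of y]
  by (cases L; cases R; cases U; cases D)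
     (simp_all add: vweight_def sw_def laurent_zero laurent_const mult.commute[of _ "inverse _"])

text \<open>The line changes its state at vertices of types 1 and 2, whose weight is constant. The
  number of changes is even or odd according to whether \<open>u = d\<close>, and each costs one
  degree; this gives bound and parity. \<open>laurent_raise\<close> compensates for pairs of
  changes.\<close>

lemma laurent_col:
  "length ls = length ys \<Longrightarrow> length rs = length ys \<Longrightarrow>
   laurent (if u = d then length ys else length ys - 1) (\<lambda>x. col (map (\<lambda>y. x * inverse y) ys) u ls rs d)"
proof (induction ys arbitrary: u ls rs)
  case Nil
  then show ?case by (cases "u = d") (simp_all add: laurent_const)
next
  case (Cons y ys)
  obtain l ls' r rs' where eq: "ls = l # ls'" "rs = r # rs'" "length ls' = length ys" "length rs' = length ys"
    using Cons.prems by (auto simp: length_Suc_conv)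
  let ?n = "length ys"
  let ?t = "\<lambda>v x. vweight a (x * inverse y) l r u v * col (map (\<lambda>y. x * inverse y) ys) v ls' rs' d"
  have "laurent (if u = d then Suc ?n else ?n) (?t v)" for v
  proof -
    have t: "laurent ((if u = v then 1 else 0) + (if v = d then ?n else ?n - 1)) (?t v)"
      by (intro laurent_mult laurent_vweight Cons.IH eq)
    consider "u = v" "v = d" | "u \<noteq> v" "v = d" | "v \<noteq> d" "ys = []" | "v \<noteq> d" "u = v" "ys \<noteq> []"
      | "u \<noteq> v" "v \<noteq> d" "ys \<noteq> []"
      by blast
    then show ?thesis
    proof cases
      case 3
      then show ?thesis using eq by (simp add: laurent_zero)
    next
      case 4
      then show ?thesis using t by (simp add: Suc_leI)
    next
      case 5
      then have "u = d" "?n - 1 + 2 = Suc ?n" by (auto simp: Suc_leI)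
      then show ?thesis using laurent_raise[OF t] 5 by simp
    qed (use t in auto)
  qed
  then have "laurent (if u = d then Suc ?n else ?n) (\<lambda>x. \<Sum>v\<in>UNIV. ?t v x)"
    by (intro laurent_sum)
  then show ?case by (simp only: eq list.map col.simps length_Cons diff_Suc_1)
qed

lemma laurent_block:
  assumes "length es = length xs" "length ds = length ys"
  shows "laurent (if e then length ys else length ys - 1) (\<lambda>x. block (x # xs) ys (e # es) ds)"
proof -
  have "laurent (if True = e then length ys else length ys - 1)
     (\<lambda>x. \<Sum>vs\<in>bools (length ys). col (map (\<lambda>y. x * inverse y) ys) True (replicate (length ys) True) vs e *
        grid xs ys vs (replicate (length xs) True) es ds)"
    by (intro laurent_sum laurent_multc laurent_col) auto
  then show ?thesis using assms by (simp add: block_def grid_Cons_row)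
qed

lemma laurent_Z_dom: "laurent (length ys - 1) (\<lambda>x. Z_dom (x # xs) ys)"
  using laurent_block[of "replicate (length xs) False" xs "replicate (length ys) False" ys False]
  by (simp add: Z_dom_def)

text \<open>Rows start in state True. The row of \<open>x\<close> ends with \<open>e\<close> in the
  upper half and with the negation of \<open>e\<close> in the lower, so exactly one of the two loses
  a degree.\<close>

lemma laurent_Z_even:
  assumes "ys \<noteq> []"
  shows "laurent (2 * length ys - 1) (\<lambda>x. Z_even (x # xs) ys)"
proof -
  let ?n = "length ys"
  have "laurent (2 * ?n - 1) (\<lambda>x. block (x # xs) ys (e # es) ds *
     block (inverse x # map inverse xs) (map inverse ys) ((\<not> e) # map Not es) (map Not ds))"
    if "length es = length xs" "length ds = ?n" for e es ds
  proof -
    have "(if e then ?n else ?n - 1) + (if \<not> e then ?n else ?n - 1) = 2 * ?n - 1"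
      using assms by (cases ys) auto
    moreover have "laurent ((if e then ?n else ?n - 1) + (if \<not> e then ?n else ?n - 1))
      (\<lambda>x. block (x # xs) ys (e # es) ds *
         block (inverse x # map inverse xs) (map inverse ys) ((\<not> e) # map Not es) (map Not ds))"
      using laurent_mult[OF laurent_block[of es xs ds ys e] laurent_inverse[OF
          laurent_block[of "map Not es" "map inverse xs" "map Not ds" "map inverse ys" "\<not> e"]]] that
      by (cases e) simp_all
    ultimately show ?thesis by (simp only:)
  qed
  then show ?thesis unfolding Z_even_alt
    by (simp only: length_Cons sum_bools_Suc list.map) (intro laurent_sum, simp)
qed

text \<open>As for the even model, but the row in the lower half crosses one more column, which
  raises the bound by one.\<close>

lemma laurent_Z_odd:
  assumes "ys \<noteq> []"
  shows "laurent (2 * length ys) (\<lambda>x. Z_odd s (x # xs) X ys Y)"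
proof -
  let ?n = "length ys"
  have "laurent (2 * ?n) (\<lambda>x. block (x # (xs @ [X])) ys (e # (es @ [s])) ds *
     block (inverse x # map inverse xs) (map inverse (ys @ [Y])) ((\<not> e) # map Not es) (map Not ds @ [s]))"
    if "length es = length xs" "length ds = ?n" for e es ds
  proof -
    have "(if e then ?n else ?n - 1) + (if \<not> e then Suc ?n else Suc ?n - 1) = 2 * ?n"
      using assms by (cases ys) auto
    moreover have "laurent ((if e then ?n else ?n - 1) + (if \<not> e then Suc ?n else Suc ?n - 1))
      (\<lambda>x. block (x # (xs @ [X])) ys (e # (es @ [s])) ds *
         block (inverse x # map inverse xs) (map inverse (ys @ [Y])) ((\<not> e) # map Not es) (map Not ds @ [s]))"
      using laurent_mult[OF laurent_block[of "es @ [s]" "xs @ [X]" ds ys e] laurent_inverse[OF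
          laurent_block[of "map Not es" "map inverse xs" "map Not ds @ [s]" "map inverse (ys @ [Y])" "\<not> e"]]] that
      by (cases e) simp_all
    ultimately show ?thesis by (simp only:)
  qed
  then show ?thesis unfolding Z_odd_alt
    by (simp only: length_Cons sum_bools_Suc list.map append_Cons) (intro laurent_sum, simp)
qed

section \<open>Reconnection of crossing lines\<close>

text \<open>Types 3 and 4 vanish and all other types have the same weight, so the ice rule becomes
  \<open>r = (\<not> u)\<close> and \<open>v = (\<not> l)\<close>. Each crossing is replaced by two
  arcs, top to right and left to bottom; the right states are the left states shifted by one
  place.\<close>

lemma col_turn:
  assumes "\<forall>z\<in>set zs. sigma (a * z) = 0 \<and> sigma (a * inverse z) = sigma (a\<^sup>2)"
    "length ls = length zs" "length rs = length zs"
  shows "col zs u ls rs d = (if rs @ [\<not> d] = (\<not> u) # ls then sigma (a\<^sup>2) ^ length zs else 0)"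
  using assms
proof (induction zs arbitrary: u ls rs)
  case Nil
  then show ?case by auto
next
  case (Cons z zs)
  obtain l ls' r rs' where eq: "ls = l # ls'" "rs = r # rs'" "length ls' = length zs" "length rs' = length zs"
    using Cons.prems by (auto simp: length_Suc_conv)
  have w: "vweight a z l r u v = (if r = (\<not> u) \<and> v = (\<not> l) then sigma (a\<^sup>2) else 0)" for v
    using Cons.prems(1) by (cases l; cases r; cases u; cases v) (simp_all add: vweight_def)
  have "col (z # zs) u ls rs d = (if r = (\<not> u) then sigma (a\<^sup>2) * col zs (\<not> l) ls' rs' d else 0)"
    by (auto simp add: eq w UNIV_bool)
  also have "col zs (\<not> l) ls' rs' d = (if rs' @ [\<not> d] = l # ls' then sigma (a\<^sup>2) ^ length zs else 0)"
    using Cons.IH[of ls' rs' "\<not> l"] Cons.prems(1) eq by simp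
  finally show ?case by (simp add: eq)
qed

lemma block_snoc_row:
  assumes "length es = length xs" "length ds = length ys"
  shows "block (xs @ [X]) ys (es @ [s]) ds =
    (\<Sum>vs\<in>bools (length ys). block xs ys es vs * col (map (\<lambda>y. X * inverse y) ys) True vs ds s)"
proof -
  have "replicate (length (xs @ [X])) True = replicate (length xs) True @ [True]"
    by (simp add: replicate_append_same)
  then show ?thesis
    unfolding block_def using assms
    by (simp only: grid_append_row length_replicate list.size) (simp add: grid_single_row)
qed

lemma block_snoc_col:
  assumes "length es = length xs" "length ds = length ys"
  shows "block xs (ys @ [Y]) es (ds @ [s]) =
    (\<Sum>ks\<in>bools (length xs). block xs ys ks ds * col (map (\<lambda>x. x * inverse Y) xs) True ks es s)"
proof -
  have "replicate (length (ys @ [Y])) True = replicate (length ys) True @ [True]"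
    by (simp add: replicate_append_same)
  then show ?thesis
    unfolding block_def using assms
    by (simp only: grid_append_col length_replicate) (simp add: grid_single_col)
qed

text \<open>Reconnecting the row \<open>X\<close> shifts the vertical states of the upper half by
  one column, and reconnecting the column \<open>Y\<close> shifts the horizontal states of the lower
  half by one row. Then the first row of the upper half and the first column of the lower half end
  in True and split off. What remains are blocks of sizes \<open>n\<close> by \<open>n + 1\<close>
  and \<open>n + 1\<close> by \<open>n\<close>: an odd model whose upper half is the former lower
  half, with negated middle edge.\<close>

lemma Z_odd_turn:
  assumes x: "x = a * Y" and y: "y = a * X" and nz: "X \<noteq> 0" "Y \<noteq> 0"
  shows "Z_odd s (replicate (Suc n) x) X (replicate (Suc n) y) Y =
    (sigma (a\<^sup>2))\<^sup>2 ^ Suc n * (sw x y * sw y x) ^ Suc n *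
    Z_odd (\<not> s) (replicate n (inverse x)) (inverse x) (replicate n (inverse y)) (inverse y)"
proof -
  let ?c = "sigma (a\<^sup>2) ^ Suc n"
  let ?rx = "replicate (Suc n) x" and ?ry = "replicate (Suc n) y"
  let ?ix = "replicate (Suc n) (inverse x)" and ?iy = "replicate (Suc n) (inverse y)"
  \<comment> \<open>By \<open>col_turn\<close>, \<open>(d # ds) @ [\<not> s] = False # vs\<close>
    for the states \<open>vs\<close> just above the row \<open>X\<close>; so \<open>d\<close> is
    False and \<open>vs\<close> is \<open>ds @ [\<not> s]\<close>.\<close>
  have 1: "block (?rx @ [X]) ?ry (es @ [s]) (d # ds) = (if d then 0 else ?c * block ?rx ?ry es (ds @ [\<not> s]))"
    if "length es = Suc n" "length ds = n" for es d ds
  proof -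
    have "block (?rx @ [X]) ?ry (es @ [s]) (d # ds) =
      (\<Sum>vs\<in>bools (Suc n). if vs = ds @ [\<not> s] then (if d then 0 else ?c * block ?rx ?ry es vs) else 0)"
      using that a_nonzero nz
      by (subst block_snoc_row; (intro sum.cong)?; (subst col_turn)?)
         (auto simp: y sigma_def field_simps power2_eq_square)
    then show ?thesis using that by simp
  qed
  have 2: "block ?ix (?iy @ [inverse Y]) (map Not (e # es)) (map Not (d # ds) @ [s]) =
      (if e then ?c * block ?ix ?iy (map Not es @ [\<not> s]) (map Not (d # ds)) else 0)"
    if "length es = n" "length ds = n" for e es d ds
  proof -
    have "block ?ix (?iy @ [inverse Y]) (map Not (e # es)) (map Not (d # ds) @ [s]) =
      (\<Sum>ks\<in>bools (Suc n). if ks = map Not es @ [\<not> s] then (if e then ?c * block ?ix ?iy ks (map Not (d # ds)) else 0) else 0)"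
      using that a_nonzero nz
      by (subst block_snoc_col; (intro sum.cong)?; (subst col_turn)?)
         (auto simp: x sigma_def field_simps power2_eq_square)
    then show ?thesis using that by simp
  qed
  let ?A = "\<lambda>es ds. block (replicate n x) ?ry es (ds @ [\<not> s])"
  let ?B = "\<lambda>es ds. block ?ix (replicate n (inverse y)) (map Not es @ [\<not> s]) (map Not ds)"
  have 3: "block ?rx ?ry (True # es) (ds @ [\<not> s]) = sw x y ^ Suc n * ?A es ds"
    if "length es = n" "length ds = n" for es ds
    using that block_row_right[of es "replicate n x" "ds @ [\<not> s]" ?ry x] by simp
  have 4: "block ?ix ?iy (map Not es @ [\<not> s]) (True # map Not ds) = sw y x ^ Suc n * ?B es ds" for es ds
    using block_col_up[of ?ix "inverse y" "replicate n (inverse y)" "map Not es @ [\<not> s]" "map Not ds"] by simp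
  let ?k = "sw x y ^ Suc n * sw y x ^ Suc n * (?c * ?c)"
  have "Z_odd s ?rx X ?ry Y = (\<Sum>e\<in>UNIV. \<Sum>es\<in>bools n. \<Sum>d\<in>UNIV. \<Sum>ds\<in>bools n.
      block (?rx @ [X]) ?ry ((e # es) @ [s]) (d # ds) *
      block ?ix (?iy @ [inverse Y]) (map Not (e # es)) (map Not (d # ds) @ [s]))"
    unfolding Z_odd_alt length_replicate by (simp only: sum_bools_Suc) simp
  also have "\<dots> = (\<Sum>e\<in>UNIV. \<Sum>es\<in>bools n. \<Sum>d\<in>UNIV. \<Sum>ds\<in>bools n.
      if e \<and> \<not> d then ?k * (?A es ds * ?B es ds) else 0)"
  proof (intro sum.cong refl)
    fix e es d ds assume "es \<in> bools n" "ds \<in> bools n"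
    then have l: "length (e # es) = Suc n" "length es = n" "length ds = n" by simp_all
    show "block (?rx @ [X]) ?ry ((e # es) @ [s]) (d # ds) *
      block ?ix (?iy @ [inverse Y]) (map Not (e # es)) (map Not (d # ds) @ [s]) =
      (if e \<and> \<not> d then ?k * (?A es ds * ?B es ds) else 0)"
      unfolding 1[OF l(1,3)] 2[OF l(2,3)]
      using 3[OF l(2,3)] 4[of es ds] by (cases e; cases d) (simp_all only: simp_thms if_True if_False list.map mult_ac mult_zero_left mult_zero_right)
  qed
  also have "\<dots> = ?k * (\<Sum>es\<in>bools n. \<Sum>ds\<in>bools n. ?A es ds * ?B es ds)"
    unfolding UNIV_bool by (simp add: sum_distrib_left)
  also have "(\<Sum>es\<in>bools n. \<Sum>ds\<in>bools n. ?A es ds * ?B es ds) =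
    (\<Sum>es\<in>bools n. \<Sum>ds\<in>bools n. ?A (map Not es) (map Not ds) * ?B (map Not es) (map Not ds))"
    by (subst sum_bools_Not, rule sum.cong[OF refl], subst sum_bools_Not) (rule refl)
  \<comment> \<open>With the summation variables negated, \<open>?B\<close> has the form of an upper
    half and \<open>?A\<close> that of the reflected lower half.\<close>
  also have "\<dots> = Z_odd (\<not> s) (replicate n (inverse x)) (inverse x) (replicate n (inverse y)) (inverse y)"
    unfolding Z_odd_alt by (simp add: replicate_append_same mult.commute del: map_map)
  also have "?k = (sigma (a\<^sup>2))\<^sup>2 ^ Suc n * (sw x y * sw y x) ^ Suc n"
    by (simp add: power_mult_distrib power2_eq_square mult_ac)
  finally show ?thesis .
qed

text \<open>
  Row \<open>i\<close> of Kuperberg's matrix \<open>1/\<sigma>(a x\<^bsub>i\<^esub>/y\<^bsub>j\<^esub>) + 1/\<sigma>(a y\<^bsub>j\<^esub>/x\<^bsub>i\<^esub>)\<close>, cleared of denominators.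
\<close>

definition det_entry :: "complex \<Rightarrow> complex list \<Rightarrow> nat \<Rightarrow> complex" where
  "det_entry x ys j = sigma a * (x * inverse (ys ! j) + ys ! j * inverse x) *
     (\<Prod>k\<in>{..<length ys} - {j}. sw x (ys ! k) * sw (ys ! k) x)"

definition half_turn_det :: "complex list \<Rightarrow> complex list \<Rightarrow> complex" where
  "half_turn_det xs ys = det (mat (length xs) (length xs) (\<lambda>(i, j). det_entry (xs ! i) ys j))"

text \<open>Cofactor at column \<open>j\<close> when a further row is put on top of
  \<open>xs\<close>. It does not involve that row, so the degree of the determinant in the new
  parameter can be read off its entries.\<close>

definition minor :: "complex list \<Rightarrow> complex list \<Rightarrow> nat \<Rightarrow> complex" where
  "minor xs ys j = (-1) ^ j * det (mat (length xs) (length xs)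
     (\<lambda>(i, k). det_entry (xs ! i) ys (if k < j then k else Suc k)))"

lemma half_turn_det_Cons:
  "half_turn_det (x # xs) ys = (\<Sum>j\<le>length xs. det_entry x ys j * minor xs ys j)"
proof -
  let ?n = "Suc (length xs)"
  let ?A = "mat ?n ?n (\<lambda>(i, j). det_entry ((x # xs) ! i) ys j)"
  have "cofactor ?A 0 j = minor xs ys j" if "j < ?n" for j
  proof -
    have "mat_delete ?A 0 j = mat (length xs) (length xs) (\<lambda>(i, k). det_entry (xs ! i) ys (if k < j then k else Suc k))"
      by (rule eq_matI) (auto simp: mat_delete_def)
    then show ?thesis by (simp add: cofactor_def minor_def)
  qed
  then show ?thesis
    unfolding half_turn_det_def
    by (simp add: laplace_expansion_row[of ?A ?n 0] lessThan_Suc_atMost)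
qed

lemma laurent_det_entry:
  assumes "j < length ys"
  shows "laurent (2 * length ys - 1) (\<lambda>x. det_entry x ys j)"
proof -
  have "laurent (0 + 1 + (1 + 1) * card ({..<length ys} - {j})) (\<lambda>x. det_entry x ys j)"
    unfolding det_entry_def
    by (intro laurent_mult laurent_prod laurent_const laurent_sw laurent_linear[of "inverse (ys ! j)" "ys ! j", unfolded mult.commute[of "inverse _"]] | simp)+
  moreover have "0 + 1 + (1 + 1) * card ({..<length ys} - {j}) = 2 * length ys - 1"
    using assms by simp
  ultimately show ?thesis by (simp only:)
qed

lemma laurent_half_turn_det:
  assumes "length ys = Suc (length xs)"
  shows "laurent (2 * length ys - 1) (\<lambda>x. half_turn_det (x # xs) ys)"
  unfolding half_turn_det_Cons using assms
  by (intro laurent_sum laurent_multc laurent_det_entry) simp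

lemma half_turn_det_repeat:
  assumes "x \<in> set xs"
  shows "half_turn_det (x # xs) ys = 0"
proof -
  obtain k where k: "k < length xs" "xs ! k = x" using assms by (auto simp: in_set_conv_nth)
  show ?thesis
    unfolding half_turn_det_def using k
    by (intro det_identical_rows[where i = 0 and j = "Suc k" and n = "Suc (length xs)"])
       (auto intro!: eq_vecI)
qed

end

section \<open>The half-turn determinant\<close>

lemma permutes_lt: "p permutes {0..<n::nat} \<Longrightarrow> i < n \<Longrightarrow> p i < n"
  using permutes_in_image[of p "{0..<n}" i] by simp

lemma prod_list_nth: "(\<Prod>z\<leftarrow>zs. (f z :: complex)) = (\<Prod>k<length zs. f (zs ! k))"
proof (induction zs)
  case (Cons z zs)
  then show ?case by (simp add: prod.lessThan_Suc_shift del: prod.lessThan_Suc)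
qed simp

definition skip :: "nat \<Rightarrow> nat \<Rightarrow> nat" where
  "skip j k = (if k < j then k else Suc k)"

lemma skip_inject [simp]: "skip j k = skip j l \<longleftrightarrow> k = l"
  by (auto simp: skip_def split: if_splits)

lemma skip_neq [simp]: "skip j k \<noteq> j" "j \<noteq> skip j k"
  by (auto simp: skip_def)

lemma lessThan_skip: "j \<le> n \<Longrightarrow> {..<Suc n} - {j} = skip j ` {..<n}"
proof (intro equalityI subsetI)
  fix l assume j: "j \<le> n" and "l \<in> {..<Suc n} - {j}"
  then have l: "l < Suc n" "l \<noteq> j" by auto
  show "l \<in> skip j ` {..<n}"
  proof (cases "l < j")
    case True
    with j show ?thesis by (intro image_eqI[of _ _ l]) (auto simp: skip_def)
  next
    case False
    with l show ?thesis by (intro image_eqI[of _ _ "l - 1"]) (auto simp: skip_def)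
  qed
qed (auto simp: skip_def)

lemma nth_skip: "(p @ [y] @ r) ! skip (length p) k = (p @ r) ! k"
  by (simp add: skip_def nth_append)

lemma prod_skip:
  "(\<Prod>k\<in>{..<length (p @ [y] @ r)} - {length p}. f ((p @ [y] @ r) ! k)) = (\<Prod>z\<leftarrow>p @ r. (f z :: complex))"
proof -
  have "(\<Prod>k\<in>{..<length (p @ [y] @ r)} - {length p}. f ((p @ [y] @ r) ! k)) =
      (\<Prod>k\<in>skip (length p) ` {..<length (p @ r)}. f ((p @ [y] @ r) ! k))"
    by (subst lessThan_skip[symmetric]) simp_all
  also have "\<dots> = (\<Prod>k<length (p @ r). f ((p @ r) ! k))"
    by (subst prod.reindex) (auto simp: inj_on_def nth_skip simp del: append_Cons append_assoc length_append)
  also have "\<dots> = (\<Prod>z\<leftarrow>p @ r. f z)"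
    by (rule prod_list_nth[symmetric])
  finally show ?thesis .
qed

text \<open>The multiplicative form of the Vandermonde product.\<close>

fun vandermonde :: "complex list \<Rightarrow> complex" where
  "vandermonde [] = 1"
| "vandermonde (x # xs) = (\<Prod>x'\<leftarrow>xs. sigma (x' * inverse x)) * vandermonde xs"

lemma sigma_inverse: "sigma (inverse z) = - sigma z"
  by (simp add: sigma_def)

text \<open>\<open>sigma\<close> is odd under inversion, so carrying \<open>y\<close> to the front
  costs one sign for each entry of \<open>p\<close>.\<close>

lemma vandermonde_extract:
  "vandermonde (p @ [y] @ r) = (-1) ^ length p * (\<Prod>z\<leftarrow>p @ r. sigma (z * inverse y)) * vandermonde (p @ r)"
proof (induction p)
  case (Cons u p)
  have "sigma (y * inverse u) = - sigma (u * inverse y)"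
    using sigma_inverse[of "u * inverse y"] by (simp add: mult.commute)
  then show ?case using Cons.IH by (simp add: mult_ac)
qed simp

lemma vandermonde_inverse_extract:
  "vandermonde (map inverse (p @ [y] @ r)) =
    (-1) ^ length p * (\<Prod>z\<leftarrow>p @ r. sigma (y * inverse z)) * vandermonde (map inverse (p @ r))"
  using vandermonde_extract[of "map inverse p" "inverse y" "map inverse r"]
  by (simp add: comp_def mult.commute)

text \<open>What may be substituted for a line parameter, since weights involve a parameter and its
  inverse. Besides coordinates this admits the multiples by \<open>a\<close> that occur at special
  points.\<close>

definition ce_unit :: "((nat \<Rightarrow> complex) \<Rightarrow> (nat \<Rightarrow> complex) \<Rightarrow> complex) \<Rightarrow> bool" where
  "ce_unit p \<longleftrightarrow> curvewise_entire p \<and> curvewise_entire (\<lambda>x y. inverse (p x y))"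

lemma ce_unit_coords: "ce_unit (\<lambda>x y. x i)" "ce_unit (\<lambda>x y. y i)"
  by (auto simp: ce_unit_def intro!: ce_intros)

lemma ce_unit_cmult: "ce_unit p \<Longrightarrow> ce_unit (\<lambda>x y. c * p x y)"
  by (auto simp: ce_unit_def intro!: ce_intros)

lemma ce_unit_inverse: "ce_unit p \<Longrightarrow> ce_unit (\<lambda>x y. inverse (p x y))"
  by (auto simp: ce_unit_def)

abbreviation ev :: "((nat \<Rightarrow> complex) \<Rightarrow> (nat \<Rightarrow> complex) \<Rightarrow> complex) list \<Rightarrow> (nat \<Rightarrow> complex) \<Rightarrow> (nat \<Rightarrow> complex) \<Rightarrow> complex list" where
  "ev ps x y \<equiv> map (\<lambda>p. p x y) ps"

lemma curvewise_entire_vandermonde: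
  assumes "\<And>p. p \<in> set ps \<Longrightarrow> ce_unit p"
  shows "curvewise_entire (\<lambda>x y. vandermonde (ev ps x y))"
  using assms
proof (induction ps)
  case (Cons p ps)
  have "curvewise_entire (\<lambda>x y. sigma (1 * (q x y * inverse (p x y))))" if "q \<in> set ps" for q
    using Cons.prems[of p] Cons.prems[of q] that
    by (intro curvewise_entire_sigma) (auto simp: ce_unit_def intro!: ce_intros)
  then show ?case using Cons by (auto intro!: ce_intros simp: comp_def)
qed (auto intro: ce_intros)

context six_vertex
begin

lemma det_entry_skip:
  assumes "k < length (p @ r)"
  shows "det_entry x (p @ [y] @ r) (skip (length p) k) = sw x y * sw y x * det_entry x (p @ r) k"
proof -
  let ?j = "length p"
  let ?n = "length (p @ r)"
  let ?q = "\<lambda>l. sw x ((p @ [y] @ r) ! l) * sw ((p @ [y] @ r) ! l) x"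
  have "{..<Suc ?n} = insert ?j (skip ?j ` {..<?n})"
    using lessThan_skip[of ?j ?n] by auto
  then have "{..<Suc ?n} - {skip ?j k} = insert ?j (skip ?j ` ({..<?n} - {k}))"
    by auto
  moreover have "?j \<notin> skip ?j ` ({..<?n} - {k})" by auto
  ultimately have "prod ?q ({..<Suc ?n} - {skip ?j k}) = ?q ?j * prod ?q (skip ?j ` ({..<?n} - {k}))"
    by simp
  also have "prod ?q (skip ?j ` ({..<?n} - {k})) = (\<Prod>l\<in>{..<?n} - {k}. sw x ((p @ r) ! l) * sw ((p @ r) ! l) x)"
    by (subst prod.reindex) (auto simp: inj_on_def nth_skip simp del: append_Cons append_assoc length_append)
  finally show ?thesis
    unfolding det_entry_def nth_skip by (simp add: mult_ac)
qed

text \<open>With denominators cleared, every entry of row \<open>x\<close> outside column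
  \<open>y\<close> contains the factor \<open>sw x y * sw y x = 0\<close>, so expansion along this
  row has a single term. In the minor each remaining row still carries its factor for the deleted
  column, which is pulled out of the sum over permutations.\<close>

lemma half_turn_det_extract:
  assumes q: "sw x y * sw y x = 0" and s: "sigma a * (x * inverse y + y * inverse x) = sigma (a\<^sup>2)"
    and len: "length (p @ r) = length xs"
  shows "half_turn_det (x # xs) (p @ [y] @ r) = (-1) ^ length p * sigma (a\<^sup>2) *
    (\<Prod>z\<leftarrow>p @ r. sw x z * sw z x) * (\<Prod>z\<leftarrow>xs. sw z y * sw y z) * half_turn_det xs (p @ r)"
proof -
  let ?j = "length p" and ?ys = "p @ [y] @ r" and ?n = "length xs"
  have "det_entry x ?ys k = 0" if "k \<noteq> ?j" for k
  proof -
    have "(\<Prod>l\<in>{..<length ?ys} - {k}. sw x (?ys ! l) * sw (?ys ! l) x) = 0"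
      using that q by (intro prod_zero bexI[of _ ?j]) auto
    then show ?thesis by (simp add: det_entry_def)
  qed
  then have "half_turn_det (x # xs) ?ys = (\<Sum>k\<le>?n. if k = ?j then det_entry x ?ys ?j * minor xs ?ys ?j else 0)"
    unfolding half_turn_det_Cons by (intro sum.cong) auto
  also have "\<dots> = det_entry x ?ys ?j * minor xs ?ys ?j"
    using len by simp
  also have "det_entry x ?ys ?j = sigma (a\<^sup>2) * (\<Prod>z\<leftarrow>p @ r. sw x z * sw z x)"
    unfolding det_entry_def prod_skip[where f = "\<lambda>z. sw x z * sw z x"] using s by simp
  also have "minor xs ?ys ?j = (-1) ^ ?j * ((\<Prod>z\<leftarrow>xs. sw z y * sw y z) * half_turn_det xs (p @ r))"
  proof -
    let ?q = "\<lambda>i. sw (xs ! i) y * sw y (xs ! i)"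
    have "det (mat ?n ?n (\<lambda>(i, k). det_entry (xs ! i) ?ys (skip ?j k))) =
      (\<Sum>\<pi> | \<pi> permutes {0..<?n}. signof \<pi> * (\<Prod>i = 0..<?n. det_entry (xs ! i) ?ys (skip ?j (\<pi> i))))"
      by (subst det_def'[of _ ?n]) (auto intro!: sum.cong prod.cong simp: permutes_lt)
    also have "\<dots> = (\<Sum>\<pi> | \<pi> permutes {0..<?n}. (\<Prod>i = 0..<?n. ?q i) * (signof \<pi> * (\<Prod>i = 0..<?n. det_entry (xs ! i) (p @ r) (\<pi> i))))"
    proof (intro sum.cong refl)
      fix \<pi> assume "\<pi> \<in> {\<pi>. \<pi> permutes {0..<?n}}"
      then have "(\<Prod>i = 0..<?n. det_entry (xs ! i) ?ys (skip ?j (\<pi> i))) =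
         (\<Prod>i = 0..<?n. ?q i * det_entry (xs ! i) (p @ r) (\<pi> i))"
        using len by (intro prod.cong refl det_entry_skip) (auto simp: permutes_lt)
      then show "signof \<pi> * (\<Prod>i = 0..<?n. det_entry (xs ! i) ?ys (skip ?j (\<pi> i))) =
        (\<Prod>i = 0..<?n. ?q i) * (signof \<pi> * (\<Prod>i = 0..<?n. det_entry (xs ! i) (p @ r) (\<pi> i)))"
        by (simp add: prod.distrib mult_ac)
    qed
    also have "\<dots> = (\<Prod>i = 0..<?n. ?q i) * half_turn_det xs (p @ r)"
      unfolding half_turn_det_def
      by (subst det_def'[of _ ?n]) (auto intro!: sum.cong prod.cong simp: permutes_lt sum_distrib_left)
    also have "(\<Prod>i = 0..<?n. ?q i) = (\<Prod>z\<leftarrow>xs. sw z y * sw y z)"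
      by (simp add: prod_list_nth atLeast0LessThan)
    finally show ?thesis by (simp add: minor_def skip_def)
  qed
  finally show ?thesis by (simp add: mult_ac)
qed

lemma curvewise_entire_sw:
  assumes "ce_unit p" "ce_unit q"
  shows "curvewise_entire (\<lambda>x y. sw (p x y) (q x y))"
  unfolding sw_def using assms
  by (intro curvewise_entire_sigma) (auto simp: ce_unit_def intro!: ce_intros)

lemma curvewise_entire_block:
  assumes "\<And>p. p \<in> set ps \<Longrightarrow> ce_unit p" "\<And>q. q \<in> set qs \<Longrightarrow> ce_unit q"
  shows "curvewise_entire (\<lambda>x y. block (ev ps x y) (ev qs x y) es ds)"
  unfolding block_def length_map using assms
  by (intro curvewise_entire_grid) (auto simp: ce_unit_def)

lemma curvewise_entire_Z_dom:
  assumes "\<And>p. p \<in> set ps \<Longrightarrow> ce_unit p" "\<And>q. q \<in> set qs \<Longrightarrow> ce_unit q"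
  shows "curvewise_entire (\<lambda>x y. Z_dom (ev ps x y) (ev qs x y))"
  unfolding Z_dom_def length_map using assms by (intro curvewise_entire_block)

lemma curvewise_entire_inverse_block:
  assumes "\<And>p. p \<in> set ps \<Longrightarrow> ce_unit p" "\<And>q. q \<in> set qs \<Longrightarrow> ce_unit q"
  shows "curvewise_entire (\<lambda>x y. block (map inverse (ev ps x y)) (map inverse (ev qs x y)) es ds)"
proof -
  have "curvewise_entire (\<lambda>x y. block (ev (map (\<lambda>p x y. inverse (p x y)) ps) x y) (ev (map (\<lambda>p x y. inverse (p x y)) qs) x y) es ds)"
    using assms by (intro curvewise_entire_block) (auto intro: ce_unit_inverse)
  then show ?thesis by (simp add: comp_def)
qed

lemma curvewise_entire_Z_even:
  assumes "\<And>p. p \<in> set ps \<Longrightarrow> ce_unit p" "\<And>q. q \<in> set qs \<Longrightarrow> ce_unit q"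
  shows "curvewise_entire (\<lambda>x y. Z_even (ev ps x y) (ev qs x y))"
  unfolding Z_even_alt length_map using assms
  by (intro ce_intros curvewise_entire_block curvewise_entire_inverse_block)

lemma curvewise_entire_Z_odd:
  assumes "\<And>p. p \<in> set ps \<Longrightarrow> ce_unit p" "\<And>q. q \<in> set qs \<Longrightarrow> ce_unit q" "ce_unit p" "ce_unit q"
  shows "curvewise_entire (\<lambda>x y. Z_odd s (ev ps x y) (p x y) (ev qs x y) (q x y))"
proof -
  have "curvewise_entire (\<lambda>x y. block (ev (ps @ [p]) x y) (ev qs x y) es ds *
     block (map inverse (ev ps x y)) (map inverse (ev (qs @ [q]) x y)) es' ds')" for es ds es' ds'
    using assms by (intro ce_intros curvewise_entire_block curvewise_entire_inverse_block) auto
  then have "curvewise_entire (\<lambda>x y. block (ev ps x y @ [p x y]) (ev qs x y) es ds *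
     block (map inverse (ev ps x y)) (map inverse (ev qs x y @ [q x y])) es' ds')" for es ds es' ds'
    by simp
  then show ?thesis unfolding Z_odd_alt length_map
    by (intro curvewise_entire_sum)
qed

lemma curvewise_entire_half_turn_det:
  assumes "\<And>p. p \<in> set ps \<Longrightarrow> ce_unit p" "\<And>q. q \<in> set qs \<Longrightarrow> ce_unit q" "length qs = length ps"
  shows "curvewise_entire (\<lambda>x y. half_turn_det (ev ps x y) (ev qs x y))"
proof -
  let ?n = "length ps"
  have e: "curvewise_entire (\<lambda>x y. det_entry (ev ps x y ! i) (ev qs x y) j)" if "i < ?n" "j < ?n" for i j
  proof -
    have u: "ce_unit (ps ! i)" "\<And>j. j < ?n \<Longrightarrow> ce_unit (qs ! j)" using that assms by auto
    have "curvewise_entire (\<lambda>x y. sigma a * ((ps ! i) x y * inverse ((qs ! j) x y) + (qs ! j) x y * inverse ((ps ! i) x y)) *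
       (\<Prod>k\<in>{..<?n} - {j}. sw ((ps ! i) x y) ((qs ! k) x y) * sw ((qs ! k) x y) ((ps ! i) x y)))"
      using u that by (intro ce_intros curvewise_entire_sw) (auto simp: ce_unit_def)
    moreover have "det_entry (ev ps x y ! i) (ev qs x y) j = sigma a * ((ps ! i) x y * inverse ((qs ! j) x y) + (qs ! j) x y * inverse ((ps ! i) x y)) *
       (\<Prod>k\<in>{..<?n} - {j}. sw ((ps ! i) x y) ((qs ! k) x y) * sw ((qs ! k) x y) ((ps ! i) x y))" for x y
      using that assms(3) by (simp add: det_entry_def cong: prod.cong_simp)
    ultimately show ?thesis by simp
  qed
  have "half_turn_det (ev ps x y) (ev qs x y) = (\<Sum>\<pi> | \<pi> permutes {0..<?n}. signof \<pi> *
     (\<Prod>i = 0..<?n. det_entry (ev ps x y ! i) (ev qs x y) (\<pi> i)))" for x y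
    unfolding half_turn_det_def
    by (subst det_def'[of _ ?n]) (auto intro!: sum.cong prod.cong simp: permutes_lt)
  moreover have "curvewise_entire (\<lambda>x y. \<Sum>\<pi> | \<pi> permutes {0..<?n}. signof \<pi> *
     (\<Prod>i = 0..<?n. det_entry (ev ps x y ! i) (ev qs x y) (\<pi> i)))"
    by (intro ce_intros e) (auto simp: permutes_lt)
  ultimately show ?thesis by simp
qed

section \<open>Generic parameters\<close>

text \<open>The excluded ratios are those at which interpolation nodes coincide: 1 for equal
  squares, \<open>a\<^sup>2\<close> for a frozen corner against a repeated parameter, and
  \<open>a ^ 4\<close> for the two kinds of frozen corner against each other.\<close>

definition generic :: "complex list \<Rightarrow> bool" where
  "generic zs \<longleftrightarrow> (\<forall>i<length zs. \<forall>j<length zs. i \<noteq> j \<longrightarrow>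
     (\<forall>c\<in>{1, a\<^sup>2, a ^ 4}. c * (zs ! i)\<^sup>2 \<noteq> (zs ! j)\<^sup>2))"

text \<open>A geometric progression works if its ratio is so large that no factor \<open>c\<close>
  or its inverse bridges the gap between two squares.\<close>

lemma generic_exists: "\<exists>R::complex. R \<noteq> 0 \<and> generic (map (\<lambda>i. R ^ i) [0..<n])"
proof -
  let ?C = "{1, a\<^sup>2, a ^ 4}"
  \<comment> \<open>The summand 2 gives \<open>r > 1\<close> and takes care of \<open>c = 1\<close>;
    the others dominate the remaining \<open>c\<close> and their inverses.\<close>
  define r where "r = 2 + norm a ^ 2 + norm a ^ 4 + norm (inverse a) ^ 2 + norm (inverse a) ^ 4"
  have r1: "r > 1" unfolding r_def by (simp add: add_pos_nonneg)
  have rc: "norm c < r" "norm (inverse c) < r" if "c \<in> ?C" for c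
    using that by (auto simp: r_def norm_power norm_inverse power_inverse add_pos_nonneg add_strict_increasing2)
  define R where "R = complex_of_real r"
  have "c * (R ^ i)\<^sup>2 \<noteq> (R ^ j)\<^sup>2" if "i \<noteq> j" "c \<in> ?C" for i j c
  proof
    assume "c * (R ^ i)\<^sup>2 = (R ^ j)\<^sup>2"
    then have "norm (c * (R ^ i)\<^sup>2) = norm ((R ^ j)\<^sup>2)" by simp
    then have eq: "norm c * r ^ (2 * i) = r ^ (2 * j)"
      using r1 by (simp add: norm_mult norm_power R_def power_mult[symmetric] mult.commute)
    have c0: "norm c > 0" using that(2) a_nonzero by auto
    show False
    proof (cases "i < j")
      case True
      have "norm c * r ^ (2 * i) < r * r ^ (2 * i)" using rc(1)[OF that(2)] r1 by simp
      also have "\<dots> \<le> r ^ (2 * j)" using True r1 power_increasing[of "Suc (2 * i)" "2 * j" r] by simp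
      finally show False using eq by simp
    next
      case False
      then have "j < i" using that(1) by simp
      have "r ^ (2 * j) * norm (inverse c) < r ^ (2 * j) * r" using rc(2)[OF that(2)] r1 by simp
      also have "\<dots> \<le> r ^ (2 * i)" using \<open>j < i\<close> r1 power_increasing[of "Suc (2 * j)" "2 * i" r] by (simp add: mult.commute)
      finally have "r ^ (2 * j) * norm (inverse c) < r ^ (2 * i)" .
      moreover have "r ^ (2 * i) = r ^ (2 * j) * norm (inverse c)"
        unfolding norm_inverse using eq c0 by (simp add: field_simps)
      ultimately show False by simp
    qed
  qed
  then have "generic (map (\<lambda>i. R ^ i) [0..<n])" by (auto simp: generic_def)
  moreover have "R \<noteq> 0" using r1 by (auto simp: R_def)
  ultimately show ?thesis by blast
qed

text \<open>Genericity is the nonvanishing of one curvewise entire product \<open>g\<close>, which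
  is nonzero at a suitable geometric progression; so \<open>g\<close> can be cancelled.\<close>

lemma generic_extend:
  assumes f: "curvewise_entire f"
    and gen: "\<And>x y. (\<forall>i. x i \<noteq> 0) \<Longrightarrow> (\<forall>i. y i \<noteq> 0) \<Longrightarrow> generic (map x [0..<k] @ map y [0..<l]) \<Longrightarrow> f x y = 0"
    and x: "\<forall>i. x i \<noteq> 0" and y: "\<forall>i. y i \<noteq> 0"
  shows "f x y = 0"
proof -
  define z :: "nat \<Rightarrow> (nat \<Rightarrow> complex) \<Rightarrow> (nat \<Rightarrow> complex) \<Rightarrow> complex"
    where "z i x y = (if i < k then x i else y (i - k))" for i x y
  define C where "C = {1, a\<^sup>2, a ^ 4}"
  have C: "finite C" by (simp add: C_def)
  let ?I = "{(i, j, c). i < k + l \<and> j < k + l \<and> i \<noteq> j \<and> c \<in> C}"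
  define g where "g x y = (\<Prod>(i, j, c)\<in>?I. c * (z i x y)\<^sup>2 - (z j x y)\<^sup>2)" for x y
  have "?I \<subseteq> {..<k + l} \<times> {..<k + l} \<times> C" by auto
  then have fin: "finite ?I" by (rule finite_subset) (auto simp: C)
  have zlist: "map x [0..<k] @ map y [0..<l] = map (\<lambda>i. z i x y) [0..<k + l]" for x y
    by (rule nth_equalityI) (auto simp: z_def nth_append)
  have g0: "g x y \<noteq> 0 \<longleftrightarrow> generic (map x [0..<k] @ map y [0..<l])" for x y
    unfolding g_def zlist generic_def C_def[symmetric] prod_zero_iff[OF fin] by auto
  have z: "curvewise_entire (z i)" for i
    unfolding z_def[abs_def] by (cases "i < k") (simp_all add: ce_intros)
  have g: "curvewise_entire g"
    unfolding g_def by (auto intro!: ce_intros z)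
  obtain R :: complex where R: "R \<noteq> 0" "generic (map (\<lambda>i. R ^ i) [0..<k + l])"
    using generic_exists by blast
  have "map (\<lambda>i. R ^ i) [0..<k] @ map (\<lambda>j. R ^ (k + j)) [0..<l] = map (\<lambda>i. R ^ i) [0..<k + l]"
    by (rule nth_equalityI) (auto simp: nth_append)
  then have "g (\<lambda>i. R ^ i) (\<lambda>j. R ^ (k + j)) \<noteq> 0"
    using R by (simp add: g0)
  with R show ?thesis
    using gen g0 by (intro curvewise_entire_cancel[OF f g _ _ _ _ x y, of "\<lambda>i. R ^ i" "\<lambda>j. R ^ (k + j)"]) auto
qed

lemma sigma_a: "sigma a \<noteq> 0"
proof
  assume "sigma a = 0"
  then have "a * a = 1" using a_nonzero by (simp add: sigma_def field_simps)
  then show False using sigma_a2 by (simp add: sigma_def power2_eq_square)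
qed

end

section \<open>Determinant formula for the even model\<close>

text \<open>By \<open>laurent_roots\<close> both functions are multiples of the same product. The
  crosswise form avoids a division by either of them.\<close>

lemma laurent_cross:
  assumes f: "laurent d f" and g: "laurent d g" and W: "finite W" "card W = d"
    and root: "\<And>w. w \<in> W \<Longrightarrow> \<exists>b. b \<noteq> 0 \<and> b\<^sup>2 = w \<and> f b = 0 \<and> g b = 0"
    and "u \<noteq> 0" "v \<noteq> 0"
  shows "f u * g v = f v * g u"
proof -
  obtain c where c: "\<forall>x. x \<noteq> 0 \<longrightarrow> f x * x ^ d = c * (\<Prod>w\<in>W. x\<^sup>2 - w)"
    using laurent_roots[OF f W] root by blast
  obtain c' where c': "\<forall>x. x \<noteq> 0 \<longrightarrow> g x * x ^ d = c' * (\<Prod>w\<in>W. x\<^sup>2 - w)"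
    using laurent_roots[OF g W] root by blast
  have "(f u * u ^ d) * (g v * v ^ d) = (f v * v ^ d) * (g u * u ^ d)"
    unfolding c[rule_format, OF assms(6)] c[rule_format, OF assms(7)]
      c'[rule_format, OF assms(6)] c'[rule_format, OF assms(7)]
    by (simp only: mult_ac)
  moreover have "(f u * u ^ d) * (g v * v ^ d) = (u ^ d * v ^ d) * (f u * g v)"
    "(f v * v ^ d) * (g u * u ^ d) = (u ^ d * v ^ d) * (f v * g u)"
    by (simp_all only: mult_ac)
  ultimately have "(u ^ d * v ^ d) * (f u * g v) = (u ^ d * v ^ d) * (f v * g u)"
    by (simp only:)
  then show ?thesis using assms(6,7) by simp
qed

lemma laurent_prod_sigma: "laurent (length xs) (\<lambda>u. \<Prod>x\<leftarrow>xs. sigma (x * inverse u))"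
  using laurent_prod_list[of xs 1 "\<lambda>x u. sigma (x * inverse u)"] laurent_inverse[OF laurent_sigma] by simp

lemma curvewise_entire_vandermonde_inverse:
  assumes "\<And>p. p \<in> set ps \<Longrightarrow> ce_unit p"
  shows "curvewise_entire (\<lambda>x y. vandermonde (map inverse (ev ps x y)))"
proof -
  have "curvewise_entire (\<lambda>x y. vandermonde (ev (map (\<lambda>p x y. inverse (p x y)) ps) x y))"
    using assms by (intro curvewise_entire_vandermonde) (auto intro: ce_unit_inverse)
  then show ?thesis by (simp add: comp_def)
qed

abbreviation nonzero :: "complex list \<Rightarrow> bool" where
  "nonzero zs \<equiv> \<forall>z\<in>set zs. z \<noteq> 0"

context six_vertex
begin

definition separated :: "complex \<Rightarrow> complex \<Rightarrow> bool" where
  "separated u v \<longleftrightarrow> (\<forall>c\<in>{1, a\<^sup>2, a ^ 4}. c * u\<^sup>2 \<noteq> v\<^sup>2 \<and> c * v\<^sup>2 \<noteq> u\<^sup>2)"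

text \<open>In this form genericity passes to sublists and splits along \<open>@\<close>.\<close>

lemma generic_iff: "generic zs \<longleftrightarrow> sorted_wrt separated zs"
proof -
  define P where "P u v \<longleftrightarrow> (\<forall>c\<in>{1, a\<^sup>2, a ^ 4}. c * u\<^sup>2 \<noteq> v\<^sup>2)" for u v
  have P: "separated u v \<longleftrightarrow> P u v \<and> P v u" for u v
    unfolding separated_def P_def by (rule ball_conj_distrib)
  have "generic zs \<longleftrightarrow> (\<forall>i<length zs. \<forall>j<length zs. i \<noteq> j \<longrightarrow> P (zs ! i) (zs ! j))"
    by (simp only: generic_def P_def)
  also have "\<dots> \<longleftrightarrow> (\<forall>i j. i < j \<longrightarrow> j < length zs \<longrightarrow> P (zs ! i) (zs ! j) \<and> P (zs ! j) (zs ! i))"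
  proof (intro iffI allI impI)
    fix i j assume *: "\<forall>i<length zs. \<forall>j<length zs. i \<noteq> j \<longrightarrow> P (zs ! i) (zs ! j)" and ij: "i < j" "j < length zs"
    have "i < length zs" "i \<noteq> j" "j \<noteq> i" using ij by auto
    with * ij(2) show "P (zs ! i) (zs ! j) \<and> P (zs ! j) (zs ! i)" by blast
  next
    fix i j assume *: "\<forall>i j. i < j \<longrightarrow> j < length zs \<longrightarrow> P (zs ! i) (zs ! j) \<and> P (zs ! j) (zs ! i)"
      and ij: "i < length zs" "j < length zs" "i \<noteq> j"
    from ij(3) consider "i < j" | "j < i" by linarith
    then show "P (zs ! i) (zs ! j)" using * ij(1,2) by cases blast+
  qed
  finally show ?thesis
    by (simp only: sorted_wrt_iff_nth_less P)
qed

lemma a_power_4: "a ^ 4 \<noteq> 1"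
proof
  assume "a ^ 4 = 1"
  then have "a\<^sup>2 * a\<^sup>2 = 1" by (simp flip: power_add)
  then show False using sigma_a2 a_nonzero by (simp add: sigma_def field_simps)
qed

text \<open>Squares of the values of a further row parameter that can be dealt with: the first two
  families freeze a corner with a column of \<open>ys\<close>; at the third a row is repeated, so
  determinant and Vandermonde product vanish.\<close>

definition nodes :: "complex list \<Rightarrow> complex list \<Rightarrow> complex set" where
  "nodes xs ys = (\<lambda>y. (a * y)\<^sup>2) ` set ys \<union> (\<lambda>y. (y / a)\<^sup>2) ` set ys \<union> (\<lambda>x. x\<^sup>2) ` set xs"

lemma generic_distinct_squares: "generic zs \<Longrightarrow> distinct (map (\<lambda>z. z\<^sup>2) zs)"
  by (induction zs) (auto simp: generic_iff separated_def)

lemma finite_nodes: "finite (nodes xs ys)"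
  by (simp add: nodes_def)

text \<open>Each ratio in \<open>generic\<close> rules out one kind of coincidence. For the two
  corners belonging to the same \<open>y\<close>, \<open>a ^ 4 \<noteq> 1\<close> is used as
  well.\<close>

lemma card_nodes:
  assumes gen: "generic (xs @ ys)" and "nonzero ys"
  shows "card (nodes xs ys) = 2 * length ys + length xs"
proof -
  have g: "generic xs" "generic ys" "\<forall>x\<in>set xs. \<forall>y\<in>set ys. separated x y"
    using gen by (auto simp: generic_iff sorted_wrt_append)
  have sep: "separated y y' \<or> y = y'" if "y \<in> set ys" "y' \<in> set ys" for y y'
    using g(2) that unfolding generic_iff
    by (metis in_set_conv_nth linorder_neqE_nat separated_def sorted_wrt_nth_less)
  have 1: "card ((\<lambda>y. (a * y)\<^sup>2) ` set ys) = length ys"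
    using generic_distinct_squares[OF g(2)] a_nonzero
    by (subst card_image) (auto simp: distinct_map inj_on_def power_mult_distrib distinct_card)
  have 2: "card ((\<lambda>y. (y / a)\<^sup>2) ` set ys) = length ys"
    using generic_distinct_squares[OF g(2)] a_nonzero
    by (subst card_image) (auto simp: distinct_map inj_on_def power_divide distinct_card)
  have 3: "card ((\<lambda>x. x\<^sup>2) ` set xs) = length xs"
    using generic_distinct_squares[OF g(1)] by (metis distinct_card length_map set_map)
  have 4: "(a * y)\<^sup>2 \<noteq> (y' / a)\<^sup>2" if "y \<in> set ys" "y' \<in> set ys" for y y'
  proof
    assume "(a * y)\<^sup>2 = (y' / a)\<^sup>2"
    then have eq: "a ^ 4 * y\<^sup>2 = y'\<^sup>2"
      using a_nonzero by (simp add: power_mult_distrib power_divide field_simps flip: power_add)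
    show False
      using sep[OF that] eq a_power_4 assms(2) that by (auto simp: separated_def)
  qed
  have 5: "(a * y)\<^sup>2 \<noteq> x\<^sup>2" "(y / a)\<^sup>2 \<noteq> x\<^sup>2" if "y \<in> set ys" "x \<in> set xs" for x y
  proof -
    have "separated x y" using g(3) that by blast
    then show "(a * y)\<^sup>2 \<noteq> x\<^sup>2" by (auto simp: separated_def power_mult_distrib)
    show "(y / a)\<^sup>2 \<noteq> x\<^sup>2"
    proof
      assume "(y / a)\<^sup>2 = x\<^sup>2"
      then have "a\<^sup>2 * x\<^sup>2 = y\<^sup>2" using a_nonzero by (simp add: power_divide field_simps)
      with \<open>separated x y\<close> show False by (auto simp: separated_def)
    qed
  qed
  have "card (nodes xs ys) = card ((\<lambda>y. (a * y)\<^sup>2) ` set ys \<union> (\<lambda>y. (y / a)\<^sup>2) ` set ys) + card ((\<lambda>x. x\<^sup>2) ` set xs)"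
    unfolding nodes_def using 5 by (intro card_Un_disjoint) fastforce+
  also have "card ((\<lambda>y. (a * y)\<^sup>2) ` set ys \<union> (\<lambda>y. (y / a)\<^sup>2) ` set ys) = length ys + length ys"
    using 4 1 2 by (subst card_Un_disjoint) fastforce+
  finally show ?thesis using 3 by simp
qed

lemma nodes_cases:
  assumes "w \<in> nodes xs ys" "nonzero xs" "nonzero ys"
  obtains (corner) b p y r where "ys = p @ [y] @ r" "b \<noteq> 0" "y \<noteq> 0" "b\<^sup>2 = w" "a * b = y \<or> a * y = b"
    | (repeat) b where "b \<in> set xs" "b \<noteq> 0" "b\<^sup>2 = w"
proof -
  from assms(1) consider y where "y \<in> set ys" "w = (a * y)\<^sup>2" | y where "y \<in> set ys" "w = (y / a)\<^sup>2"
    | x where "x \<in> set xs" "w = x\<^sup>2"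
    unfolding nodes_def by blast
  then show ?thesis
  proof cases
    case 1
    then obtain p r where "ys = p @ [y] @ r" by (metis append_Cons append_Nil in_set_conv_decomp)
    with 1 show ?thesis using corner[of p y r "a * y"] a_nonzero assms(3) by auto
  next
    case 2
    then obtain p r where "ys = p @ [y] @ r" by (metis append_Cons append_Nil in_set_conv_decomp)
    with 2 show ?thesis using corner[of p y r "y / a"] a_nonzero assms(3) by auto
  next
    case 3
    with assms(2) show ?thesis using repeat[of x] by auto
  qed
qed

text \<open>Covers both ways of freezing a corner; \<open>a * y = b\<close> is the transpose of
  \<open>a * b = y\<close>.\<close>

definition corner_weight :: "complex \<Rightarrow> complex list \<Rightarrow> complex \<Rightarrow> complex list \<Rightarrow> complex" where
  "corner_weight b xs y ys = (if a * b = y then frozen b xs y ys else frozen y ys b xs)"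

lemma Z_dom_corner:
  assumes "a * b = y \<or> a * y = b" "b \<noteq> 0" "y \<noteq> 0" "nonzero xs" "nonzero ys"
  shows "Z_dom (b # xs) (y # ys) = corner_weight b xs y ys * Z_dom xs ys"
proof (cases "a * b = y")
  case False
  then have "Z_dom (y # ys) (b # xs) = frozen y ys b xs * Z_dom ys xs"
    using assms by (intro Z_dom_frozen) auto
  then show ?thesis using False assms Z_dom_commute[of "b # xs" "y # ys"] Z_dom_commute[of xs ys]
    by (simp add: corner_weight_def)
qed (use assms in \<open>simp add: corner_weight_def Z_dom_frozen\<close>)

lemma Z_even_corner:
  assumes "a * b = y \<or> a * y = b" "b \<noteq> 0" "y \<noteq> 0"
  shows "Z_even (b # xs) (y # ys) = (corner_weight b xs y ys)\<^sup>2 * Z_even xs ys"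
proof (cases "a * b = y")
  case False
  then have "Z_even (y # ys) (b # xs) = (frozen y ys b xs)\<^sup>2 * Z_even ys xs"
    using assms by (intro Z_even_frozen) auto
  then show ?thesis using False Z_even_commute[of "b # xs" "y # ys"] Z_even_commute[of xs ys]
    by (simp add: corner_weight_def)
qed (use assms in \<open>simp add: corner_weight_def Z_even_frozen\<close>)

lemma Z_odd_corner:
  assumes "a * b = y \<or> a * y = b" "b \<noteq> 0" "y \<noteq> 0"
  shows "Z_odd s (b # xs) X (y # ys) Y =
    corner_weight b xs y ys * corner_weight b (xs @ [X]) y (ys @ [Y]) * Z_odd s xs X ys Y"
proof (cases "a * b = y")
  case False
  then have "Z_odd s (y # ys) Y (b # xs) X = frozen y ys b xs * frozen y (ys @ [Y]) b (xs @ [X]) * Z_odd s ys Y xs X"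
    using assms by (intro Z_odd_frozen) auto
  then show ?thesis using False Z_odd_commute[of s "b # xs" X "y # ys" Y] Z_odd_commute[of s xs X ys Y]
    by (simp add: corner_weight_def)
qed (use assms in \<open>simp add: corner_weight_def Z_odd_frozen\<close>)

lemma prod_list_mult:
  "(\<Prod>z\<leftarrow>zs. f z * g z :: complex) = (\<Prod>z\<leftarrow>zs. f z) * (\<Prod>z\<leftarrow>zs. g z)"
  by (induction zs) auto

lemma prod_list_uminus:
  "(\<Prod>z\<leftarrow>zs. - f z :: complex) = (-1) ^ length zs * (\<Prod>z\<leftarrow>zs. f z)"
  by (induction zs) auto

lemma corner_weight_vandermonde:
  assumes "a * b = y \<or> a * y = b" "b \<noteq> 0" "y \<noteq> 0" "length xs = length ys"
  shows "corner_weight b xs y ys * (\<Prod>x\<leftarrow>xs. sigma (x * inverse b)) * (\<Prod>z\<leftarrow>ys. sigma (y * inverse z)) =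
    sigma (a\<^sup>2) * (\<Prod>z\<leftarrow>ys. sw b z * sw z b) * (\<Prod>x\<leftarrow>xs. sw x y * sw y x)"
proof (cases "a * b = y")
  case True
  have "sigma (x * inverse b) = sw x y" for x
    using True assms a_nonzero by (auto simp: sw_def field_simps)
  moreover have "sigma (y * inverse z) = sw b z" for z
    using True by (auto simp: sw_def mult.assoc)
  ultimately show ?thesis
    by (simp add: True corner_weight_def frozen_def prod_list_mult)
next
  case False
  with assms(1) have b: "a * y = b" by blast
  have "sigma (x * inverse b) = - sw y x" for x
    using sigma_inverse[of "b * inverse x"] by (simp add: sw_def b[symmetric] mult_ac)
  moreover have "sigma (y * inverse z) = - sw z b" for z
  proof -
    have "a * inverse b = inverse y"
      using b assms a_nonzero by (auto simp: field_simps)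
    then have "a * (z * inverse b) = inverse (y * inverse z)"
      unfolding mult.left_commute[of a] by (simp add: mult.commute)
    then show ?thesis by (simp only: sw_def sigma_inverse minus_minus)
  qed
  ultimately have s: "(\<Prod>x\<leftarrow>xs. sigma (x * inverse b)) * (\<Prod>z\<leftarrow>ys. sigma (y * inverse z)) =
     (\<Prod>x\<leftarrow>xs. sw y x) * (\<Prod>z\<leftarrow>ys. sw z b)"
  proof -
    have sign: "(-1) ^ length ys * (-1) ^ length ys = (1 :: complex)"
      by (cases "even (length ys)") simp_all
    have "s * u * (s * v) = u * v" if "s * s = 1" for s u v :: complex
    proof -
      have "s * u * (s * v) = (s * s) * (u * v)" by (simp only: mult_ac)
      then show ?thesis using that by simp
    qed
    from this[OF sign] \<open>\<And>x. sigma (x * inverse b) = - sw y x\<close> \<open>\<And>z. sigma (y * inverse z) = - sw z b\<close>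
    show ?thesis by (simp only: prod_list_uminus assms(4))
  qed
  then show ?thesis
    by (simp add: False corner_weight_def frozen_def prod_list_mult mult_ac)
qed

lemma half_turn_det_corner:
  assumes "a * b = y \<or> a * y = b" "b \<noteq> 0" "y \<noteq> 0" "length (p @ r) = length xs"
  shows "half_turn_det (b # xs) (p @ [y] @ r) = (-1) ^ length p * sigma (a\<^sup>2) *
    (\<Prod>z\<leftarrow>p @ r. sw b z * sw z b) * (\<Prod>z\<leftarrow>xs. sw z y * sw y z) * half_turn_det xs (p @ r)"
proof (rule half_turn_det_extract)
  show "sw b y * sw y b = 0" using assms sw_eq_0[of b y] sw_eq_0[of y b] by auto
  show "sigma a * (b * inverse y + y * inverse b) = sigma (a\<^sup>2)"
    using assms(1)
  proof
    assume "a * b = y"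
    then show ?thesis using assms(2,3) a_nonzero by (auto simp: sigma_def field_simps power2_eq_square)
  next
    assume "a * y = b"
    then show ?thesis using assms(2,3) a_nonzero by (auto simp: sigma_def field_simps power2_eq_square)
  qed
qed (use assms in simp)

text \<open>Interpolation in the first row parameter: at frozen corners both sides reduce to the
  smaller case by the same factor, at repeated parameters both vanish. The degree is
  \<open>3 * n + 1\<close>.\<close>

theorem Z_even_determinant:
  assumes "length xs = length ys" "nonzero xs" "nonzero ys"
  shows "Z_even xs ys * vandermonde xs * vandermonde (map inverse ys) = Z_dom xs ys * half_turn_det xs ys"
  using assms
proof (induction "length xs" arbitrary: xs ys)
  case 0
  then show ?case by (simp add: Z_even_alt Z_dom_def block_def half_turn_det_def)
next
  case (Suc n)
  define defect where "defect xs ys = Z_even xs ys * vandermonde xs * vandermonde (map inverse ys) - Z_dom xs ys * half_turn_det xs ys" for xs ys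
  have IH: "defect xs ys = 0" if "length xs = n" "length ys = n" "nonzero xs" "nonzero ys" for xs ys
    using Suc.hyps(1) that by (simp add: defect_def)
  have generic_case: "defect (u # xs) ys = 0"
    if len: "length xs = n" "length ys = Suc n" and nz: "nonzero xs" "nonzero ys" "u \<noteq> 0" and gen: "generic (xs @ ys)"
    for u xs ys
  proof (rule laurent_many_roots[where W = "nodes xs ys" and x = u and f = "\<lambda>u. defect (u # xs) ys"])
    have "ys \<noteq> []" using len by auto
    then have l1: "laurent (2 * length ys - 1 + length xs) (\<lambda>u. Z_even (u # xs) ys * (\<Prod>x\<leftarrow>xs. sigma (x * inverse u)) * (vandermonde xs * vandermonde (map inverse ys)))"
      by (intro laurent_multc laurent_mult laurent_Z_even laurent_prod_sigma)
    have l2: "laurent (length ys - 1 + (2 * length ys - 1)) (\<lambda>u. Z_dom (u # xs) ys * half_turn_det (u # xs) ys)"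
      using len by (intro laurent_mult laurent_Z_dom laurent_half_turn_det) simp
    have "2 * length ys - 1 + length xs = 3 * n + 1" "length ys - 1 + (2 * length ys - 1) = 3 * n + 1"
      using len by simp_all
    note laurent_diff[OF l1[unfolded this(1)] l2[unfolded this(2)]]
    then show "laurent (3 * n + 1) (\<lambda>u. defect (u # xs) ys)"
      by (simp add: defect_def mult.assoc)
    show "finite (nodes xs ys)" by (rule finite_nodes)
    \<comment> \<open>There are \<open>2 * (n + 1)\<close> nodes from frozen corners and
      \<open>n\<close> from repeated parameters, one more than the degree.\<close>
    show "card (nodes xs ys) > 3 * n + 1" using card_nodes[OF gen] nz len by simp
    show "u \<noteq> 0" by fact
    fix w assume "w \<in> nodes xs ys"
    then show "\<exists>b. b \<noteq> 0 \<and> b\<^sup>2 = w \<and> defect (b # xs) ys = 0"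
      using nz(1,2)
    proof (cases rule: nodes_cases)
      case (corner b p y r)
      let ?c = "corner_weight b xs y (p @ r)"
      have nzr: "nonzero (p @ r)" "nonzero (y # p @ r)" using nz corner by auto
      have m: "mset ys = mset (y # p @ r)" using corner by simp
      have even: "Z_even (b # xs) ys = ?c\<^sup>2 * Z_even xs (p @ r)"
        using Z_even_perm_right[of "b # xs" ys "y # p @ r"] m nz corner Z_even_corner[of b y xs "p @ r"] by auto
      have "Z_dom (b # xs) ys = ?c * Z_dom xs (p @ r)"
        using Z_dom_perm_right[of "b # xs" ys "y # p @ r"] m nz corner Z_dom_corner[of b y xs "p @ r"] by auto
      note dom = this
      let ?P = "\<Prod>x\<leftarrow>xs. sigma (x * inverse b)" and ?Q = "\<Prod>z\<leftarrow>p @ r. sigma (y * inverse z)"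
      have "half_turn_det (b # xs) ys = (-1) ^ length p * (?c * ?P * ?Q) * half_turn_det xs (p @ r)"
        using half_turn_det_corner[of b y p r xs] corner_weight_vandermonde[of b y xs "p @ r"] corner len
        by (simp only: mult.assoc) simp
      then have "defect (b # xs) ys = ?c\<^sup>2 * Z_even xs (p @ r) * (?P * vandermonde xs) * ((-1) ^ length p * ?Q * vandermonde (map inverse (p @ r)))
          - ?c * Z_dom xs (p @ r) * ((-1) ^ length p * (?c * ?P * ?Q) * half_turn_det xs (p @ r))"
        unfolding defect_def by (simp only: corner(1) even[unfolded corner(1)] dom[unfolded corner(1)] vandermonde_inverse_extract vandermonde.simps)
      also have "\<dots> = (-1) ^ length p * ?c * (?c * ?P * ?Q) * defect xs (p @ r)"
        unfolding defect_def by (simp only: right_diff_distrib power2_eq_square mult_ac)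
      also have "defect xs (p @ r) = 0"
        using IH[of xs "p @ r"] len nz nzr corner by simp
      finally show ?thesis using corner by auto
    next
      \<comment> \<open>The Vandermonde product and the determinant vanish separately here.\<close>
      case (repeat b)
      then have "(\<Prod>x\<leftarrow>xs. sigma (x * inverse b)) = 0"
        unfolding prod_list_zero_iff by (auto simp: sigma_def image_iff intro!: bexI[of _ b])
      then have "defect (b # xs) ys = 0"
        using half_turn_det_repeat[OF repeat(1)] by (simp add: defect_def)
      then show ?thesis using repeat by blast
    qed
  qed
  let ?xs = "map (\<lambda>i x y. x i) [0..<Suc n]" and ?ys = "map (\<lambda>i x y. y i) [0..<Suc n]"
  define f where "f x y = defect (ev ?xs x y) (ev ?ys x y)" for x y
  have f: "curvewise_entire f"
  proof -
    show ?thesis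
      unfolding f_def defect_def
      by (intro ce_intros curvewise_entire_Z_even curvewise_entire_Z_dom curvewise_entire_vandermonde
          curvewise_entire_vandermonde_inverse curvewise_entire_half_turn_det) (auto intro: ce_unit_coords)
  qed
  define x where "x i = (if i < length xs then xs ! i else 1)" for i
  define y where "y i = (if i < length ys then ys ! i else 1)" for i
  have "f x y = 0"
  proof (rule generic_extend[OF f])
    show "\<forall>i. x i \<noteq> 0" "\<forall>i. y i \<noteq> 0" using Suc.prems by (auto simp: x_def y_def)
    fix x y :: "nat \<Rightarrow> complex"
    assume nz: "\<forall>i. x i \<noteq> 0" "\<forall>i. y i \<noteq> 0" and gen: "generic (map x [0..<Suc n] @ map y [0..<Suc n])"
    have xs: "map x [0..<Suc n] = x 0 # map x [1..<Suc n]"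
      by (simp add: upt_conv_Cons del: upt_Suc)
    have "defect (x 0 # map x [1..<Suc n]) (map y [0..<Suc n]) = 0"
      using gen nz unfolding xs by (intro generic_case) (auto simp: generic_iff simp del: upt_Suc)
    then show "f x y = 0" by (simp only: f_def xs[symmetric]) (simp add: comp_def)
  qed
  moreover have "map x [0..<Suc n] = xs" "map y [0..<Suc n] = ys"
    using Suc.hyps(2) Suc.prems(1) by (auto simp: x_def y_def intro!: nth_equalityI simp del: upt_Suc)
  then have "ev ?xs x y = xs" "ev ?ys x y = ys" by (simp_all only: map_map comp_def)
  ultimately have "defect xs ys = 0" by (simp only: f_def)
  then show ?case by (simp add: defect_def)
qed

end

section \<open>The odd model\<close>

text \<open>Lists with and without the last parameter: \<open>ext \<beta>\<close> and
  \<open>ext (\<not> \<beta>)\<close> let one statement cover both assignments of the sizes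
  \<open>m\<close> and \<open>m + 1\<close>.\<close>

definition ext :: "bool \<Rightarrow> 'b \<Rightarrow> 'b list" where
  "ext \<beta> X = (if \<beta> then [X] else [])"

lemma ext_simps [simp]: "ext True X = [X]" "ext False X = []"
  by (simp_all add: ext_def)

lemma set_ext: "set (ext \<beta> X) \<subseteq> {X}"
  by (auto simp: ext_def)

lemma vandermonde_nonzero:
  "distinct (map (\<lambda>z. z\<^sup>2) zs) \<Longrightarrow> nonzero zs \<Longrightarrow> vandermonde zs \<noteq> 0"
proof (induction zs)
  case (Cons z zs)
  have "sigma (w * inverse z) \<noteq> 0" if "w \<in> set zs" for w
  proof
    assume "sigma (w * inverse z) = 0"
    then have "w\<^sup>2 = z\<^sup>2" using Cons.prems(2) that by (auto simp: sigma_def field_simps power2_eq_square)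
    then have "z\<^sup>2 \<in> (\<lambda>z. z\<^sup>2) ` set zs" using that by (metis image_eqI)
    then show False using Cons.prems(1) by simp
  qed
  then show ?case using Cons by (auto simp: prod_list_zero_iff)
qed simp

lemma distinct_inverse_squares:
  "distinct (map (\<lambda>z :: complex. z\<^sup>2) zs) \<Longrightarrow> distinct (map (\<lambda>z. z\<^sup>2) (map inverse zs))"
  by (auto simp: distinct_map inj_on_def power_inverse)

context six_vertex
begin

text \<open>
  The two identities for the odd model are treated at once: \<open>\<beta> = False\<close> is the one expressing \<open>Z(m+1) Z\<^bsub>HT\<^esub>(2m)\<close>,
  \<open>\<beta> = True\<close> the one expressing \<open>Z(m) Z\<^bsub>HT\<^esub>(2m+2)\<close>.
\<close>

definition odd_comb :: "bool \<Rightarrow> complex list \<Rightarrow> complex \<Rightarrow> complex list \<Rightarrow> complex \<Rightarrow> complex" where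
  "odd_comb \<beta> xs X ys Y = sigma a * ((X * inverse Y + Y * inverse X) * Z_odd \<beta> xs X ys Y +
     (a + inverse a) * Z_odd (\<not> \<beta>) xs X ys Y)"

text \<open>The identity with its quotient of partition functions multiplied out, so that it is
  meaningful where these vanish.\<close>

definition defect :: "bool \<Rightarrow> complex list \<Rightarrow> complex \<Rightarrow> complex list \<Rightarrow> complex \<Rightarrow> complex" where
  "defect \<beta> xs X ys Y = Z_dom (xs @ ext \<beta> X) (ys @ ext \<beta> Y) * odd_comb \<beta> xs X ys Y -
     Z_dom (xs @ ext (\<not> \<beta>) X) (ys @ ext (\<not> \<beta>) Y) * Z_even (xs @ ext \<beta> X) (ys @ ext \<beta> Y)"

text \<open>The same identity with the quotient of even by domain-wall function expressed through
  the determinant. A factor \<open>Z_dom\<close> is thereby gone, and the degree in a row parameter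
  falls to the number of nodes.\<close>

definition det_defect :: "bool \<Rightarrow> complex list \<Rightarrow> complex \<Rightarrow> complex list \<Rightarrow> complex \<Rightarrow> complex" where
  "det_defect \<beta> xs X ys Y = odd_comb \<beta> xs X ys Y * vandermonde (xs @ ext \<beta> X) * vandermonde (map inverse (ys @ ext \<beta> Y)) -
     Z_dom (xs @ ext (\<not> \<beta>) X) (ys @ ext (\<not> \<beta>) Y) * half_turn_det (xs @ ext \<beta> X) (ys @ ext \<beta> Y)"

text \<open>The expected shape of a nonzero \<open>defect\<close>: the double product has the zeros
  at frozen corners, and \<open>Z_dom\<close> is the factor by which \<open>defect\<close> and
  \<open>det_defect\<close> differ apart from Vandermonde products.\<close>

definition nodal_factor :: "bool \<Rightarrow> complex list \<Rightarrow> complex \<Rightarrow> complex list \<Rightarrow> complex \<Rightarrow> complex" where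
  "nodal_factor \<beta> xs X ys Y = Z_dom (xs @ ext \<beta> X) (ys @ ext \<beta> Y) * (\<Prod>x\<leftarrow>xs. \<Prod>y\<leftarrow>ys. sw x y * sw y x)"

lemma nonzero_ext: "nonzero xs \<Longrightarrow> X \<noteq> 0 \<Longrightarrow> nonzero (xs @ ext \<beta> X)"
  using set_ext[of \<beta> X] by auto

lemma odd_comb_perm_left:
  assumes "nonzero xs" "Y \<noteq> 0" "nonzero ys" "mset xs = mset xs'"
  shows "odd_comb \<beta> xs X ys Y = odd_comb \<beta> xs' X ys Y"
  unfolding odd_comb_def using assms by (simp add: Z_odd_perm_left[of xs Y ys xs'])

lemma odd_comb_perm_right:
  assumes "nonzero xs" "X \<noteq> 0" "nonzero ys" "mset ys = mset ys'"
  shows "odd_comb \<beta> xs X ys Y = odd_comb \<beta> xs X ys' Y"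
  unfolding odd_comb_def using assms by (simp add: Z_odd_perm_right[of xs X ys ys'])

lemma odd_comb_commute: "odd_comb \<beta> xs X ys Y = odd_comb \<beta> ys Y xs X"
  unfolding odd_comb_def by (simp add: Z_odd_commute[of _ xs] add.commute)

lemma defect_commute:
  assumes "nonzero xs" "X \<noteq> 0" "nonzero ys" "Y \<noteq> 0"
  shows "defect \<beta> xs X ys Y = defect \<beta> ys Y xs X"
proof -
  have "Z_dom (xs @ ext b X) (ys @ ext b Y) = Z_dom (ys @ ext b Y) (xs @ ext b X)" for b
    using assms by (intro Z_dom_commute nonzero_ext)
  from this[of \<beta>] this[of "\<not> \<beta>"] show ?thesis
    unfolding defect_def odd_comb_commute[of \<beta> xs X ys Y] Z_even_commute[of "xs @ ext \<beta> X" "ys @ ext \<beta> Y"]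
    by (simp only:)
qed

lemma prod_list_swap:
  "(\<Prod>x\<leftarrow>xs. \<Prod>y\<leftarrow>ys. f x y :: complex) = (\<Prod>y\<leftarrow>ys. \<Prod>x\<leftarrow>xs. f x y)"
proof (induction xs)
  case Nil
  show ?case by (induction ys) auto
qed (simp add: prod_list_mult)

lemma nodal_factor_commute:
  assumes "nonzero xs" "X \<noteq> 0" "nonzero ys" "Y \<noteq> 0"
  shows "nodal_factor \<beta> xs X ys Y = nodal_factor \<beta> ys Y xs X"
proof -
  have "Z_dom (xs @ ext \<beta> X) (ys @ ext \<beta> Y) = Z_dom (ys @ ext \<beta> Y) (xs @ ext \<beta> X)"
    using assms by (intro Z_dom_commute nonzero_ext)
  moreover have "(\<Prod>x\<leftarrow>xs. \<Prod>y\<leftarrow>ys. sw x y * sw y x) = (\<Prod>y\<leftarrow>ys. \<Prod>x\<leftarrow>xs. sw y x * sw x y)"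
    by (subst prod_list_swap) (simp only: mult.commute)
  ultimately show ?thesis unfolding nodal_factor_def by (simp only:)
qed

lemma prod_list_perm: "mset xs = mset ys \<Longrightarrow> (\<Prod>x\<leftarrow>xs. f x :: complex) = (\<Prod>x\<leftarrow>ys. f x)"
  by (metis mset_map prod_mset_prod_list)

lemma defect_perm:
  assumes "nonzero xs" "X \<noteq> 0" "nonzero ys" "Y \<noteq> 0" "mset xs = mset xs'"
  shows "defect \<beta> xs X ys Y = defect \<beta> xs' X ys Y"
proof -
  have "Z_dom (xs @ ext b X) (ys @ ext b Y) = Z_dom (xs' @ ext b X) (ys @ ext b Y)" for b
    using assms by (intro Z_dom_perm_left nonzero_ext) simp_all
  moreover have "Z_even (xs @ ext \<beta> X) (ys @ ext \<beta> Y) = Z_even (xs' @ ext \<beta> X) (ys @ ext \<beta> Y)"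
    using assms by (intro Z_even_perm_left nonzero_ext) simp_all
  ultimately show ?thesis
    unfolding defect_def using odd_comb_perm_left[of xs Y ys xs'] assms by simp
qed

lemma nodal_factor_perm:
  assumes "nonzero xs" "X \<noteq> 0" "nonzero ys" "Y \<noteq> 0" "mset xs = mset xs'"
  shows "nodal_factor \<beta> xs X ys Y = nodal_factor \<beta> xs' X ys Y"
proof -
  have "Z_dom (xs @ ext b X) (ys @ ext b Y) = Z_dom (xs' @ ext b X) (ys @ ext b Y)" for b
    using assms by (intro Z_dom_perm_left nonzero_ext) simp_all
  then show ?thesis
    unfolding nodal_factor_def using prod_list_perm[OF assms(5)] by simp
qed

text \<open>Freezing yields one corner weight without and one with the last pair; written with
  \<open>\<beta>\<close> and its negation the factor has one form for both identities.\<close>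

lemma odd_comb_corner:
  assumes "a * b = y \<or> a * y = b" "b \<noteq> 0" "y \<noteq> 0"
  shows "odd_comb \<beta> (b # xs) X (y # ys) Y =
    corner_weight b (xs @ ext \<beta> X) y (ys @ ext \<beta> Y) * corner_weight b (xs @ ext (\<not> \<beta>) X) y (ys @ ext (\<not> \<beta>) Y)
    * odd_comb \<beta> xs X ys Y"
  unfolding odd_comb_def Z_odd_corner[OF assms]
  by (cases \<beta>) (simp_all only: ext_simps append_Nil2 simp_thms not_True_eq_False not_False_eq_True distrib_left distrib_right mult_ac)

text \<open>Both terms of the difference pick up the same factor at a frozen corner, so the
  vanishing for one pair of lines less carries over.\<close>

lemma det_defect_corner:
  assumes c: "a * b = y \<or> a * y = b" "b \<noteq> 0" "y \<noteq> 0"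
    and len: "length (p @ r) = length xs"
    and nz: "nonzero xs" "nonzero (p @ r)" "X \<noteq> 0" "Y \<noteq> 0"
    and zero: "det_defect \<beta> xs X (p @ r) Y = 0"
  shows "det_defect \<beta> (b # xs) X (p @ [y] @ r) Y = 0"
proof -
  let ?cw = "\<lambda>\<beta>. corner_weight b (xs @ ext \<beta> X) y ((p @ r) @ ext \<beta> Y)"
  let ?P = "\<Prod>x\<leftarrow>xs @ ext \<beta> X. sigma (x * inverse b)"
  let ?Q = "\<Prod>z\<leftarrow>p @ r @ ext \<beta> Y. sigma (y * inverse z)"
  have odd: "odd_comb \<beta> (b # xs) X (p @ [y] @ r) Y = ?cw \<beta> * ?cw (\<not> \<beta>) * odd_comb \<beta> xs X (p @ r) Y"
    unfolding odd_comb_corner[OF c, symmetric]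
    using assms by (intro odd_comb_perm_right) auto
  have dom: "Z_dom ((b # xs) @ ext (\<not> \<beta>) X) ((p @ [y] @ r) @ ext (\<not> \<beta>) Y) =
      ?cw (\<not> \<beta>) * Z_dom (xs @ ext (\<not> \<beta>) X) ((p @ r) @ ext (\<not> \<beta>) Y)"
  proof -
    have "Z_dom ((b # xs) @ ext (\<not> \<beta>) X) ((p @ [y] @ r) @ ext (\<not> \<beta>) Y) =
        Z_dom (b # xs @ ext (\<not> \<beta>) X) (y # (p @ r) @ ext (\<not> \<beta>) Y)"
      using assms unfolding append_Cons[of b, symmetric] by (intro Z_dom_perm_right nonzero_ext) auto
    then show ?thesis
      using Z_dom_corner[OF c nonzero_ext[OF nz(1,3)] nonzero_ext[OF nz(2,4)]] by (simp only:)
  qed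
  have det: "half_turn_det ((b # xs) @ ext \<beta> X) ((p @ [y] @ r) @ ext \<beta> Y) =
      (-1) ^ length p * (?cw \<beta> * ?P * ?Q) * half_turn_det (xs @ ext \<beta> X) ((p @ r) @ ext \<beta> Y)"
  proof -
    have l: "length (p @ r @ ext \<beta> Y) = length (xs @ ext \<beta> X)" using len by (simp add: ext_def)
    have "?cw \<beta> * ?P * ?Q = sigma (a\<^sup>2) * (\<Prod>z\<leftarrow>p @ r @ ext \<beta> Y. sw b z * sw z b) * (\<Prod>z\<leftarrow>xs @ ext \<beta> X. sw z y * sw y z)"
      using corner_weight_vandermonde[OF c l[symmetric]] by (simp only: append_assoc)
    then show ?thesis
      using half_turn_det_corner[OF c l] by (simp only: append_assoc append_Cons mult.assoc)
  qed
  have V: "vandermonde ((b # xs) @ ext \<beta> X) = ?P * vandermonde (xs @ ext \<beta> X)" by simp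
  have W: "vandermonde (map inverse ((p @ [y] @ r) @ ext \<beta> Y)) =
     (-1) ^ length p * ?Q * vandermonde (map inverse ((p @ r) @ ext \<beta> Y))"
    using vandermonde_inverse_extract[of p y "r @ ext \<beta> Y"] by (simp only: append_assoc)
  have "det_defect \<beta> (b # xs) X (p @ [y] @ r) Y = (-1) ^ length p * (?cw (\<not> \<beta>) * (?cw \<beta> * ?P * ?Q)) * det_defect \<beta> xs X (p @ r) Y"
    unfolding det_defect_def odd dom det V W by (simp only: right_diff_distrib mult_ac)
  then show ?thesis using zero by simp
qed

lemma Z_dom_det_defect:
  assumes "length xs = length ys" "nonzero xs" "nonzero ys" "X \<noteq> 0" "Y \<noteq> 0"
  shows "Z_dom (xs @ ext \<beta> X) (ys @ ext \<beta> Y) * det_defect \<beta> xs X ys Y =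
    vandermonde (xs @ ext \<beta> X) * vandermonde (map inverse (ys @ ext \<beta> Y)) * defect \<beta> xs X ys Y"
proof -
  have K: "Z_even (xs @ ext \<beta> X) (ys @ ext \<beta> Y) * vandermonde (xs @ ext \<beta> X) * vandermonde (map inverse (ys @ ext \<beta> Y)) =
     Z_dom (xs @ ext \<beta> X) (ys @ ext \<beta> Y) * half_turn_det (xs @ ext \<beta> X) (ys @ ext \<beta> Y)"
    using assms by (intro Z_even_determinant nonzero_ext) (simp_all add: ext_def)
  let ?Z = "Z_dom (xs @ ext \<beta> X) (ys @ ext \<beta> Y)" and ?Z' = "Z_dom (xs @ ext (\<not> \<beta>) X) (ys @ ext (\<not> \<beta>) Y)"
  let ?O = "odd_comb \<beta> xs X ys Y" and ?V = "vandermonde (xs @ ext \<beta> X)" and ?W = "vandermonde (map inverse (ys @ ext \<beta> Y))"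
  have "?Z * det_defect \<beta> xs X ys Y = ?Z * ?O * ?V * ?W - ?Z' * (?Z * half_turn_det (xs @ ext \<beta> X) (ys @ ext \<beta> Y))"
    unfolding det_defect_def by (simp only: right_diff_distrib mult_ac)
  also have "\<dots> = ?V * ?W * defect \<beta> xs X ys Y"
    unfolding K[symmetric] defect_def by (simp only: right_diff_distrib mult_ac)
  finally show ?thesis .
qed

section \<open>The defect as a multiple of the nodal factor\<close>

text \<open>Degree and number of nodes agree, so \<open>laurent_cross\<close> makes
  \<open>det_defect\<close> proportional, as a function of its first parameter, to
  \<open>?q u * ?s u\<close>, which has the same degree and vanishes at the same nodes.
  \<open>Z_dom_det_defect\<close> translates this back to \<open>defect\<close>, and the nonzero
  Vandermonde products are cancelled at the end.\<close>

lemma defect_cross_generic: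
  assumes zero: "\<And>xs ys. length xs = n \<Longrightarrow> length ys = n \<Longrightarrow> nonzero xs \<Longrightarrow> nonzero ys \<Longrightarrow> det_defect \<beta> xs X ys Y = 0"
    and len: "length xs = n" "length ys = Suc n"
    and nz: "nonzero xs" "nonzero ys" "X \<noteq> 0" "Y \<noteq> 0" "u \<noteq> 0" "v \<noteq> 0"
    and gen: "generic ((xs @ ext \<beta> X) @ ys)"
    and V: "vandermonde (u # xs @ ext \<beta> X) \<noteq> 0" "vandermonde (v # xs @ ext \<beta> X) \<noteq> 0"
      "vandermonde (map inverse (ys @ ext \<beta> Y)) \<noteq> 0"
  shows "defect \<beta> (u # xs) X ys Y * nodal_factor \<beta> (v # xs) X ys Y = defect \<beta> (v # xs) X ys Y * nodal_factor \<beta> (u # xs) X ys Y"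
proof -
  let ?e = "if \<beta> then 1 else 0 :: nat"
  \<comment> \<open>Two nodes for each of the \<open>Suc n\<close> columns and one for each entry of
    \<open>xs @ ext \<beta> X\<close>.\<close>
  let ?d = "2 * Suc n + n + ?e"
  let ?s = "\<lambda>u. \<Prod>x\<leftarrow>xs @ ext \<beta> X. sigma (x * inverse u)"
  let ?q = "\<lambda>u. \<Prod>z\<leftarrow>ys. sw u z * sw z u"
  let ?V = "vandermonde (xs @ ext \<beta> X)" and ?W = "vandermonde (map inverse (ys @ ext \<beta> Y))"
  let ?Z = "\<lambda>u. Z_dom ((u # xs) @ ext \<beta> X) (ys @ ext \<beta> Y)"
  have lext: "length (ext b (Z :: complex)) = (if b then 1 else 0)" for b Z by (simp add: ext_def)
  have "det_defect \<beta> (u # xs) X ys Y * (?q v * ?s v) = det_defect \<beta> (v # xs) X ys Y * (?q u * ?s u)"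
  proof (rule laurent_cross[where W = "nodes (xs @ ext \<beta> X) ys" and d = ?d])
    have "ys \<noteq> []" using len by auto
    then have l1: "laurent (2 * length ys + length (xs @ ext \<beta> X)) (\<lambda>u. odd_comb \<beta> (u # xs) X ys Y * ?s u * (?V * ?W))"
      unfolding odd_comb_def
      by (intro laurent_multc laurent_mult laurent_cmult laurent_add laurent_Z_odd laurent_prod_sigma)
    have l2: "laurent (length (ys @ ext (\<not> \<beta>) Y) - 1 + (2 * length (ys @ ext \<beta> Y) - 1))
        (\<lambda>u. Z_dom (u # xs @ ext (\<not> \<beta>) X) (ys @ ext (\<not> \<beta>) Y) * half_turn_det (u # xs @ ext \<beta> X) (ys @ ext \<beta> Y))"
      using len by (intro laurent_mult laurent_Z_dom laurent_half_turn_det) (simp add: lext)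
    have eq: "2 * length ys + length (xs @ ext \<beta> X) = ?d" 
      "length (ys @ ext (\<not> \<beta>) Y) - 1 + (2 * length (ys @ ext \<beta> Y) - 1) = ?d"
      using len by (simp_all add: lext)
    note laurent_diff[OF l1[unfolded eq(1)] l2[unfolded eq(2)]]
    then show "laurent ?d (\<lambda>u. det_defect \<beta> (u # xs) X ys Y)"
      by (simp only: det_defect_def append_Cons vandermonde.simps mult.assoc)
    have "laurent ((1 + 1) * length ys + length (xs @ ext \<beta> X)) (\<lambda>u. ?q u * ?s u)"
      by (intro laurent_mult laurent_prod_list laurent_sw laurent_prod_sigma)
    moreover have "(1 + 1) * length ys + length (xs @ ext \<beta> X) = ?d" using len by (simp add: lext)
    ultimately show "laurent ?d (\<lambda>u. ?q u * ?s u)" by (simp only:)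
    show "finite (nodes (xs @ ext \<beta> X) ys)" by (rule finite_nodes)
    show "card (nodes (xs @ ext \<beta> X) ys) = ?d"
      using card_nodes[OF gen nz(2)] len by (simp add: lext)
    show "u \<noteq> 0" "v \<noteq> 0" by fact+
    have nze: "nonzero (xs @ ext \<beta> X)" using nz by (intro nonzero_ext)
    fix w assume "w \<in> nodes (xs @ ext \<beta> X) ys"
    then show "\<exists>b. b \<noteq> 0 \<and> b\<^sup>2 = w \<and> det_defect \<beta> (b # xs) X ys Y = 0 \<and> ?q b * ?s b = 0"
      using nze nz(2)
    proof (cases rule: nodes_cases)
      case (corner b p y r)
      have "det_defect \<beta> (b # xs) X ys Y = 0"
        unfolding corner(1) using corner len nz by (intro det_defect_corner zero) auto
      moreover have "?q b = 0"
        using corner sw_eq_0[of b y] sw_eq_0[of y b] by auto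
      ultimately show ?thesis using corner by auto
    next
      case (repeat b)
      have "?s b = 0"
        using repeat unfolding prod_list_zero_iff by (auto simp: sigma_def image_iff intro!: bexI[of _ b])
      moreover have "det_defect \<beta> (b # xs) X ys Y = 0"
        using \<open>?s b = 0\<close> half_turn_det_repeat[OF repeat(1)] by (simp add: det_defect_def)
      ultimately show ?thesis using repeat by auto
    qed
  qed
  note cross = this
  have Zd: "?Z t * det_defect \<beta> (t # xs) X ys Y = ?s t * ?V * ?W * defect \<beta> (t # xs) X ys Y" if "t \<noteq> 0" for t
    using Z_dom_det_defect[of "t # xs" ys X Y \<beta>] len nz that by simp
  let ?r = "\<Prod>x\<leftarrow>xs. \<Prod>y\<leftarrow>ys. sw x y * sw y x"
  have sc: "nodal_factor \<beta> (t # xs) X ys Y = ?Z t * (?q t * ?r)" for t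
    by (simp add: nodal_factor_def)
  let ?k = "?s u * ?s v * ?V * ?W"
  have "?k * (defect \<beta> (u # xs) X ys Y * nodal_factor \<beta> (v # xs) X ys Y) =
      (?s u * ?V * ?W * defect \<beta> (u # xs) X ys Y) * (?s v * (?Z v * (?q v * ?r)))"
    unfolding sc by (simp only: mult_ac)
  also have "\<dots> = (?Z u * ?Z v * ?r) * (det_defect \<beta> (u # xs) X ys Y * (?q v * ?s v))"
    unfolding Zd[OF nz(5), symmetric] by (simp only: mult_ac)
  also have "\<dots> = (?Z v * det_defect \<beta> (v # xs) X ys Y) * (?s u * (?Z u * (?q u * ?r)))"
    unfolding cross by (simp only: mult_ac)
  also have "\<dots> = ?k * (defect \<beta> (v # xs) X ys Y * nodal_factor \<beta> (u # xs) X ys Y)"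
    unfolding sc Zd[OF nz(6)] by (simp only: mult_ac)
  finally show ?thesis using V by simp
qed


lemma curvewise_entire_odd_comb:
  assumes "\<And>p. p \<in> set ps \<Longrightarrow> ce_unit p" "\<And>q. q \<in> set qs \<Longrightarrow> ce_unit q" "ce_unit p" "ce_unit q"
  shows "curvewise_entire (\<lambda>x y. odd_comb \<beta> (ev ps x y) (p x y) (ev qs x y) (q x y))"
proof -
  have "curvewise_entire p" "curvewise_entire q" "curvewise_entire (\<lambda>x y. inverse (p x y))" "curvewise_entire (\<lambda>x y. inverse (q x y))"
    using assms by (auto simp: ce_unit_def)
  then show ?thesis
    unfolding odd_comb_def using assms by (intro ce_intros curvewise_entire_Z_odd)
qed

lemma ev_append_ext: "ev ps x y @ ext \<beta> (p x y) = ev (ps @ ext \<beta> p) x y"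
  by (simp add: ext_def)

lemma ce_unit_ext:
  "(\<And>p. p \<in> set ps \<Longrightarrow> ce_unit p) \<Longrightarrow> ce_unit p \<Longrightarrow> q \<in> set (ps @ ext \<beta> p) \<Longrightarrow> ce_unit q"
  using set_ext[of \<beta> p] by auto

lemma curvewise_entire_defect:
  assumes "\<And>p. p \<in> set ps \<Longrightarrow> ce_unit p" "\<And>q. q \<in> set qs \<Longrightarrow> ce_unit q" "ce_unit p" "ce_unit q"
  shows "curvewise_entire (\<lambda>x y. defect \<beta> (ev ps x y) (p x y) (ev qs x y) (q x y))"
proof -
  have u: "\<And>b r. r \<in> set (ps @ ext b p) \<Longrightarrow> ce_unit r" "\<And>b r. r \<in> set (qs @ ext b q) \<Longrightarrow> ce_unit r"
    using ce_unit_ext[OF assms(1,3)] ce_unit_ext[OF assms(2,4)] by blast+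
  show ?thesis
    unfolding defect_def ev_append_ext
    by (intro ce_intros curvewise_entire_odd_comb[OF assms] curvewise_entire_Z_dom[OF u] curvewise_entire_Z_even[OF u])
qed

lemma curvewise_entire_det_defect:
  assumes "\<And>p. p \<in> set ps \<Longrightarrow> ce_unit p" "\<And>q. q \<in> set qs \<Longrightarrow> ce_unit q" "ce_unit p" "ce_unit q"
    "length qs = length ps"
  shows "curvewise_entire (\<lambda>x y. det_defect \<beta> (ev ps x y) (p x y) (ev qs x y) (q x y))"
proof -
  have u: "\<And>b r. r \<in> set (ps @ ext b p) \<Longrightarrow> ce_unit r" "\<And>b r. r \<in> set (qs @ ext b q) \<Longrightarrow> ce_unit r"
    using ce_unit_ext[OF assms(1,3)] ce_unit_ext[OF assms(2,4)] by blast+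
  have l: "length (qs @ ext \<beta> q) = length (ps @ ext \<beta> p)" using assms(5) by (simp add: ext_def)
  show ?thesis
    unfolding det_defect_def ev_append_ext
    by (intro ce_intros curvewise_entire_odd_comb[OF assms(1-4)] curvewise_entire_Z_dom[OF u]
      curvewise_entire_vandermonde[OF u(1)] curvewise_entire_vandermonde_inverse[OF u(2)]
      curvewise_entire_half_turn_det[OF u l])
qed

lemma curvewise_entire_nodal_factor:
  assumes "\<And>p. p \<in> set ps \<Longrightarrow> ce_unit p" "\<And>q. q \<in> set qs \<Longrightarrow> ce_unit q" "ce_unit p" "ce_unit q"
  shows "curvewise_entire (\<lambda>x y. nodal_factor \<beta> (ev ps x y) (p x y) (ev qs x y) (q x y))"
proof -
  have u: "\<And>b r. r \<in> set (ps @ ext b p) \<Longrightarrow> ce_unit r" "\<And>b r. r \<in> set (qs @ ext b q) \<Longrightarrow> ce_unit r"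
    using ce_unit_ext[OF assms(1,3)] ce_unit_ext[OF assms(2,4)] by blast+
  have "curvewise_entire (\<lambda>x y. \<Prod>p\<leftarrow>ps. \<Prod>q\<leftarrow>qs. sw (p x y) (q x y) * sw (q x y) (p x y))"
    using assms by (intro ce_intros curvewise_entire_sw) auto
  then have "curvewise_entire (\<lambda>x y. \<Prod>p\<leftarrow>ev ps x y. \<Prod>q\<leftarrow>ev qs x y. sw p q * sw q p)"
    by (simp add: comp_def)
  then show ?thesis
    unfolding nodal_factor_def ev_append_ext
    by (intro ce_intros curvewise_entire_Z_dom[OF u])
qed

text \<open>Repeated freezing; all weights met are \<open>sigma (a\<^sup>2)\<close>. This is the
  point of nonvanishing for later cancellations of \<open>Z_dom\<close>.\<close>

lemma Z_dom_replicate_nonzero: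
  assumes "a * x = y" "x \<noteq> 0"
  shows "Z_dom (replicate n x) (replicate n y) \<noteq> 0"
proof (induction n)
  case 0
  show ?case by (simp add: Z_dom_def block_def)
next
  case (Suc n)
  have "frozen x (replicate n x) y (replicate n y) \<noteq> 0"
    using sw_eq_sigma_a2[OF assms] sigma_a2 by (simp add: frozen_def)
  then show ?case using Suc Z_dom_frozen[OF assms, of "replicate n x" "replicate n y"] by simp
qed

lemma list_as_map:
  assumes "nonzero xs" "X \<noteq> 0"
  obtains x where "\<forall>i. x i \<noteq> 0" "map x [0..<length xs] = xs" "x (length xs) = X"
proof
  let ?x = "\<lambda>i. if i < length xs then xs ! i else X"
  show "\<forall>i. ?x i \<noteq> 0" using assms by auto
  show "map ?x [0..<length xs] = xs" by (rule nth_equalityI) auto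
  show "?x (length xs) = X" by simp
qed

text \<open>\<open>Z_dom_det_defect\<close> yields only the product with \<open>Z_dom\<close>, which
  is cancelled by continuation from the point with all rows 1 and all columns
  \<open>a\<close>.\<close>

lemma det_defect_zero:
  assumes zero: "\<And>xs X ys Y. length xs = n \<Longrightarrow> length ys = n \<Longrightarrow> nonzero xs \<Longrightarrow> nonzero ys \<Longrightarrow> X \<noteq> 0 \<Longrightarrow> Y \<noteq> 0
      \<Longrightarrow> defect \<beta> xs X ys Y = 0"
    and len: "length xs = n" "length ys = n" and nz: "nonzero xs" "nonzero ys" "X \<noteq> 0" "Y \<noteq> 0"
  shows "det_defect \<beta> xs X ys Y = 0"
proof -
  obtain x where x: "\<forall>i. x i \<noteq> 0" "map x [0..<n] = xs" "x n = X"
    using list_as_map[OF nz(1,3)] len by metis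
  obtain y where y: "\<forall>i. y i \<noteq> 0" "map y [0..<n] = ys" "y n = Y"
    using list_as_map[OF nz(2,4)] len by metis
  let ?f = "\<lambda>x y. det_defect \<beta> (map x [0..<n]) (x n) (map y [0..<n]) (y n)"
  let ?g = "\<lambda>x y. Z_dom (map x [0..<n] @ ext \<beta> (x n)) (map y [0..<n] @ ext \<beta> (y n))"
  let ?ps = "map (\<lambda>i x y. x i) [0..<n] :: ((nat \<Rightarrow> complex) \<Rightarrow> (nat \<Rightarrow> complex) \<Rightarrow> complex) list"
  let ?qs = "map (\<lambda>i x y. y i) [0..<n] :: ((nat \<Rightarrow> complex) \<Rightarrow> (nat \<Rightarrow> complex) \<Rightarrow> complex) list"
  have ps: "ev ?ps x y = map x [0..<n]" "ev ?qs x y = map y [0..<n]" for x y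
    by (simp_all add: comp_def)
  have u: "\<And>p. p \<in> set ?ps \<Longrightarrow> ce_unit p" "\<And>q. q \<in> set ?qs \<Longrightarrow> ce_unit q"
    by (auto intro: ce_unit_coords)
  have "?f x y = 0"
  proof (rule curvewise_entire_cancel[of ?f ?g "\<lambda>_. 1" "\<lambda>_. a" x y])
    show "curvewise_entire ?f"
    proof -
      have "curvewise_entire (\<lambda>x y. det_defect \<beta> (ev ?ps x y) (x n) (ev ?qs x y) (y n))"
        by (rule curvewise_entire_det_defect) (auto intro: ce_unit_coords)
      then show ?thesis by (simp only: ps)
    qed
    have "curvewise_entire (\<lambda>x y. Z_dom (ev (?ps @ ext \<beta> (\<lambda>x y. x n)) x y) (ev (?qs @ ext \<beta> (\<lambda>x y. y n)) x y))"
      by (rule curvewise_entire_Z_dom) (auto simp: ext_def ce_unit_coords split: if_splits)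
    then show "curvewise_entire ?g"
      unfolding ev_append_ext[symmetric] ps .
    show "?f x y * ?g x y = 0" if "\<forall>i. x i \<noteq> 0" "\<forall>i. y i \<noteq> 0" for x y
      using Z_dom_det_defect[of "map x [0..<n]" "map y [0..<n]" "x n" "y n" \<beta>] that
      by (simp add: zero mult.commute)
    have "map (\<lambda>_. 1) [0..<n] @ ext \<beta> (1::complex) = replicate (length ([0..<n] @ ext \<beta> n)) 1"
      "map (\<lambda>_. a) [0..<n] @ ext \<beta> a = replicate (length ([0..<n] @ ext \<beta> n)) a"
      by (simp_all add: ext_def map_replicate_const replicate_append_same)
    then show "?g (\<lambda>_. 1) (\<lambda>_. a) \<noteq> 0"
      by (simp only: Z_dom_replicate_nonzero mult_1_right one_neq_zero not_False_eq_True simp_thms)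
  qed (use a_nonzero x y in auto)
  then show ?thesis by (simp only: x y)
qed

lemma generic_sublists:
  assumes "sorted_wrt separated ((u # v # xs @ [X]) @ ys @ [Y])"
  shows "generic ((xs @ ext \<beta> X) @ ys)" "generic (u # xs @ ext \<beta> X)" "generic (v # xs @ ext \<beta> X)"
    "generic (ys @ ext \<beta> Y)"
proof -
  note s = assms[unfolded sorted_wrt_append sorted_wrt.simps set_append list.set]
  show "generic ((xs @ ext \<beta> X) @ ys)"
    using s by (cases \<beta>) (simp_all add: generic_iff sorted_wrt_append)
  show "generic (u # xs @ ext \<beta> X)" using s by (cases \<beta>) (simp_all add: generic_iff sorted_wrt_append)
  show "generic (v # xs @ ext \<beta> X)" using s by (cases \<beta>) (simp_all add: generic_iff sorted_wrt_append)
  show "generic (ys @ ext \<beta> Y)" using s by (cases \<beta>) (simp_all add: generic_iff sorted_wrt_append)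
qed

text \<open>Removes the genericity and Vandermonde conditions of \<open>defect_cross_generic\<close>
  by continuation.\<close>

lemma defect_cross:
  assumes zero: "\<And>xs X ys Y. length xs = n \<Longrightarrow> length ys = n \<Longrightarrow> nonzero xs \<Longrightarrow> nonzero ys \<Longrightarrow> X \<noteq> 0 \<Longrightarrow> Y \<noteq> 0
      \<Longrightarrow> defect \<beta> xs X ys Y = 0"
    and len: "length xs = n" "length ys = Suc n"
    and nz: "nonzero xs" "nonzero ys" "X \<noteq> 0" "Y \<noteq> 0" "u \<noteq> 0" "v \<noteq> 0"
  shows "defect \<beta> (u # xs) X ys Y * nodal_factor \<beta> (v # xs) X ys Y =
    defect \<beta> (v # xs) X ys Y * nodal_factor \<beta> (u # xs) X ys Y"
proof -
  have dz: "det_defect \<beta> xs X ys Y = 0"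
    if "length xs = n" "length ys = n" "nonzero xs" "nonzero ys" "X \<noteq> 0" "Y \<noteq> 0" for xs ys X Y
    using zero that by (rule det_defect_zero)
  \<comment> \<open>The two competing first parameters become coordinates 0 and 1 of one point, so
    that both sides of the relation are functions of the same variables.\<close>
  obtain x where x: "\<forall>i. x i \<noteq> 0" "map x [0..<n + 2] = u # v # xs" "x (n + 2) = X"
    using list_as_map[of "u # v # xs" X] nz len by (auto simp del: upt_Suc)
  obtain y where y: "\<forall>i. y i \<noteq> 0" "map y [0..<Suc n] = ys" "y (Suc n) = Y"
    using list_as_map[OF nz(2,4)] len by metis
  define js where "js = [2..<n + 2]"
  have js: "[0..<n + 2] = 0 # 1 # js" "length js = n"
    by (simp_all add: js_def upt_conv_Cons numeral_2_eq_2 del: upt_Suc)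
  let ?ps = "\<lambda>i. map (\<lambda>i x y. x i) (i # js) :: ((nat \<Rightarrow> complex) \<Rightarrow> (nat \<Rightarrow> complex) \<Rightarrow> complex) list"
  let ?qs = "map (\<lambda>i x y. y i) [0..<Suc n] :: ((nat \<Rightarrow> complex) \<Rightarrow> (nat \<Rightarrow> complex) \<Rightarrow> complex) list"
  let ?D = "\<lambda>i x y. defect \<beta> (ev (?ps i) x y) (x (n + 2)) (ev ?qs x y) (y (Suc n))"
  let ?N = "\<lambda>i x y. nodal_factor \<beta> (ev (?ps i) x y) (x (n + 2)) (ev ?qs x y) (y (Suc n))"
  let ?f = "\<lambda>x y. ?D 0 x y * ?N 1 x y - ?D 1 x y * ?N 0 x y"
  have ps: "ev (?ps i) x y = x i # map x js" "ev ?qs x y = map y [0..<Suc n]" for i x y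
    by (simp_all only: list.map map_map comp_def)
  have f: "curvewise_entire ?f"
    by (intro ce_intros curvewise_entire_defect curvewise_entire_nodal_factor ce_unit_coords)
       (auto intro: ce_unit_coords)
  have "?f x y = 0"
  proof (rule generic_extend[OF f _ x(1) y(1), where k = "n + 3" and l = "n + 2"])
    fix x y :: "nat \<Rightarrow> complex"
    assume nz: "\<forall>i. x i \<noteq> 0" "\<forall>i. y i \<noteq> 0" and gen: "generic (map x [0..<n + 3] @ map y [0..<n + 2])"
    have "[0..<n + 3] = [0..<n + 2] @ [n + 2]" "[0..<n + 2] = [0..<Suc n] @ [Suc n]"
      by (simp_all add: numeral_3_eq_3)
    then have sorted: "sorted_wrt separated ((x 0 # x 1 # map x js @ [x (n + 2)]) @ map y [0..<Suc n] @ [y (Suc n)])"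
      using gen unfolding generic_iff js(1) by simp
    have g: "generic ((map x js @ ext \<beta> (x (n + 2))) @ map y [0..<Suc n])"
      "generic (x 0 # map x js @ ext \<beta> (x (n + 2)))" "generic (x 1 # map x js @ ext \<beta> (x (n + 2)))"
      "generic (map y [0..<Suc n] @ ext \<beta> (y (Suc n)))"
      using generic_sublists[OF sorted] by blast+
    have nzx: "nonzero (x i # map x js @ ext \<beta> (x (n + 2)))" for i
      using nz by (auto simp: ext_def split: if_splits)
    have nzy: "nonzero (map inverse (map y [0..<Suc n] @ ext \<beta> (y (Suc n))))"
      using nz by (auto simp: ext_def split: if_splits simp del: upt_Suc)
    have nzl: "nonzero (map x js)" "nonzero (map y [0..<Suc n])"
      using nz by (auto simp del: upt_Suc)
    note V = vandermonde_nonzero[OF generic_distinct_squares nzx]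
    note W = vandermonde_nonzero[OF distinct_inverse_squares[OF generic_distinct_squares[OF g(4)]] nzy]
    have "defect \<beta> (x 0 # map x js) (x (n + 2)) (map y [0..<Suc n]) (y (Suc n)) *
        nodal_factor \<beta> (x 1 # map x js) (x (n + 2)) (map y [0..<Suc n]) (y (Suc n)) =
        defect \<beta> (x 1 # map x js) (x (n + 2)) (map y [0..<Suc n]) (y (Suc n)) *
        nodal_factor \<beta> (x 0 # map x js) (x (n + 2)) (map y [0..<Suc n]) (y (Suc n))"
    proof (rule defect_cross_generic[where n = n])
      show "det_defect \<beta> xs (x (n + 2)) ys (y (Suc n)) = 0"
        if "length xs = n" "length ys = n" "nonzero xs" "nonzero ys" for xs ys
        using that nz by (intro dz) auto
      show "length (map x js) = n" by (simp add: js)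
    qed (rule g(1) V[OF g(2)] V[OF g(3)] W nzl nz(1)[rule_format] nz(2)[rule_format]
        | simp only: length_map length_upt minus_nat.diff_0)+
    then show "?f x y = 0" unfolding ps by (simp only: diff_self)
  qed
  moreover have "x 0 = u" "x 1 = v" "map x js = xs"
    using x(2) unfolding js(1) by simp_all
  ultimately show ?thesis by (simp only: ps x y) simp
qed

section \<open>The reconnection point\<close>

lemma frozen_turn:
  assumes x: "x = a * Y" and y: "y = a * X" and nz: "X \<noteq> 0" "Y \<noteq> 0"
  shows "frozen X (replicate (Suc n) x) y (replicate n y @ [Y]) * frozen Y (replicate n y) x (replicate n x) =
    (sigma (a\<^sup>2))\<^sup>2 ^ Suc n * (sw x y * sw y x) ^ Suc n"
proof -
  have "sw y X = sigma (a\<^sup>2)" "sw x Y = sigma (a\<^sup>2)" using assms sw_eq_sigma_a2 by auto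
  moreover have "x * inverse y = Y * inverse X"
    using assms a_nonzero by (simp add: field_simps)
  then have "sw Y X = sw x y" by (simp add: sw_def)
  ultimately show ?thesis
    by (simp add: frozen_def power_mult_distrib power2_eq_square mult_ac)
qed

lemma Z_turn:
  assumes x: "x = a * Y" and y: "y = a * X" and nz: "X \<noteq> 0" "Y \<noteq> 0"
    and E_def: "E = (sigma (a\<^sup>2))\<^sup>2 ^ Suc n * (sw x y * sw y x) ^ Suc n"
  shows "Z_dom (replicate (Suc n) x @ [X]) (replicate (Suc n) y @ [Y]) = E * Z_dom (replicate n x) (replicate n y)"
    and "Z_even (replicate (Suc n) x @ [X]) (replicate (Suc n) y @ [Y]) = E\<^sup>2 * Z_even (replicate n x) (replicate n y)"
proof -
  let ?rx = "replicate n x" and ?ry = "replicate n y"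
  let ?f = "frozen X (replicate (Suc n) x) y (?ry @ [Y])" and ?g = "frozen Y ?ry x ?rx"
  have E: "E = ?f * ?g" unfolding E_def frozen_turn[OF x y nz] ..
  have n0: "x \<noteq> 0" "y \<noteq> 0" using x y nz a_nonzero by auto
  have "Z_dom (replicate (Suc n) x @ [X]) (replicate (Suc n) y @ [Y]) = Z_dom (X # replicate (Suc n) x) (replicate (Suc n) y @ [Y])"
    using n0 nz by (intro Z_dom_perm_left) auto
  also have "\<dots> = ?f * Z_dom (replicate (Suc n) x) (?ry @ [Y])"
    using y nz Z_dom_frozen[of X y] by simp
  also have "Z_dom (replicate (Suc n) x) (?ry @ [Y]) = Z_dom (replicate (Suc n) x) (Y # ?ry)"
    using n0 nz by (intro Z_dom_perm_right) auto
  also have "\<dots> = Z_dom (Y # ?ry) (x # ?rx)"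
    using n0 nz by (subst Z_dom_commute) auto
  also have "\<dots> = ?g * Z_dom ?ry ?rx"
    using x nz by (intro Z_dom_frozen) auto
  also have "Z_dom ?ry ?rx = Z_dom ?rx ?ry" using n0 by (intro Z_dom_commute) auto
  finally show "Z_dom (replicate (Suc n) x @ [X]) (replicate (Suc n) y @ [Y]) = E * Z_dom ?rx ?ry"
    unfolding E by (simp only: mult.assoc)
  have "Z_even (replicate (Suc n) x @ [X]) (replicate (Suc n) y @ [Y]) = Z_even (X # replicate (Suc n) x) (replicate (Suc n) y @ [Y])"
    using n0 nz by (intro Z_even_perm_left) auto
  also have "\<dots> = ?f\<^sup>2 * Z_even (replicate (Suc n) x) (?ry @ [Y])"
    using y nz Z_even_frozen[of X y] by simp
  also have "Z_even (replicate (Suc n) x) (?ry @ [Y]) = Z_even (replicate (Suc n) x) (Y # ?ry)"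
    using n0 nz by (intro Z_even_perm_right) auto
  also have "\<dots> = Z_even (Y # ?ry) (x # ?rx)"
    by (subst Z_even_commute) simp
  also have "\<dots> = ?g\<^sup>2 * Z_even ?ry ?rx"
    using x nz by (intro Z_even_frozen) auto
  also have "Z_even ?ry ?rx = Z_even ?rx ?ry" by (rule Z_even_commute)
  finally show "Z_even (replicate (Suc n) x @ [X]) (replicate (Suc n) y @ [Y]) = E\<^sup>2 * Z_even ?rx ?ry"
    unfolding E power_mult_distrib by (simp only: mult.assoc)
qed

text \<open>Since \<open>y / x = X / Y\<close>, the coefficient formed from the ratio of the last
  two parameters is preserved, whereas the middle edge is negated; the two combinations change
  places.\<close>

lemma odd_comb_turn:
  assumes x: "x = a * Y" and y: "y = a * X" and nz: "X \<noteq> 0" "Y \<noteq> 0"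
  shows "odd_comb \<beta> (replicate (Suc n) x) X (replicate (Suc n) y) Y =
    (sigma (a\<^sup>2))\<^sup>2 ^ Suc n * (sw x y * sw y x) ^ Suc n *
    odd_comb (\<not> \<beta>) (replicate n (inverse x)) (inverse x) (replicate n (inverse y)) (inverse y)"
proof -
  have "inverse x * inverse (inverse y) + inverse y * inverse (inverse x) = X * inverse Y + Y * inverse X"
    using assms a_nonzero by (simp add: field_simps)
  then show ?thesis
    unfolding odd_comb_def Z_odd_turn[OF assms]
    by (simp only: not_not distrib_left mult_ac)
qed

text \<open>\<open>E\<close> or its square factors out, leaving the identity for
  \<open>\<not> \<beta>\<close> with \<open>n\<close> pairs. Each identity thus rests on the other
  one of smaller size.\<close>

lemma defect_turn:
  assumes zero: "\<And>\<beta> xs X ys Y. length xs = n \<Longrightarrow> length ys = n \<Longrightarrow> nonzero xs \<Longrightarrow> nonzero ys \<Longrightarrow> X \<noteq> 0 \<Longrightarrow> Y \<noteq> 0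
      \<Longrightarrow> defect \<beta> xs X ys Y = 0"
    and nz: "X \<noteq> 0" "Y \<noteq> 0"
  shows "defect \<beta> (replicate (Suc n) (a * Y)) X (replicate (Suc n) (a * X)) Y = 0"
proof -
  define x where "x = a * Y"
  define y where "y = a * X"
  have n0: "x \<noteq> 0" "y \<noteq> 0" using nz a_nonzero by (auto simp: x_def y_def)
  define E where "E = (sigma (a\<^sup>2))\<^sup>2 ^ Suc n * (sw x y * sw y x) ^ Suc n"
  note turn = Z_turn[OF x_def y_def nz E_def]
  let ?O = "odd_comb (\<not> \<beta>) (replicate n (inverse x)) (inverse x) (replicate n (inverse y)) (inverse y)"
  have odd: "odd_comb \<beta> (replicate (Suc n) x) X (replicate (Suc n) y) Y = E * ?O"
    unfolding E_def by (rule odd_comb_turn[OF x_def y_def nz])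
  have dom: "Z_dom (replicate k (inverse x)) (replicate k (inverse y)) = Z_dom (replicate k x) (replicate k y)" for k
    using Z_dom_inverse[of "replicate k x" "replicate k y"] n0 by simp
  have even: "Z_even (replicate k (inverse x)) (replicate k (inverse y)) = Z_even (replicate k x) (replicate k y)" for k
    using Z_even_inverse[of "replicate k x" "replicate k y"] by simp
  have IH: "defect (\<not> \<beta>) (replicate n (inverse x)) (inverse x) (replicate n (inverse y)) (inverse y) = 0"
    using n0 by (intro zero) auto
  have "defect \<beta> (replicate (Suc n) x) X (replicate (Suc n) y) Y = 0"
  proof (cases \<beta>)
    case False
    have IH': "Z_dom (replicate (Suc n) x) (replicate (Suc n) y) * ?O =
        Z_dom (replicate n x) (replicate n y) * Z_even (replicate (Suc n) x) (replicate (Suc n) y)"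
      using IH False dom[of n] dom[of "Suc n"] even[of "Suc n"]
      by (simp add: defect_def replicate_append_same)
    have "defect \<beta> (replicate (Suc n) x) X (replicate (Suc n) y) Y =
        Z_dom (replicate (Suc n) x) (replicate (Suc n) y) * (E * ?O) -
        E * Z_dom (replicate n x) (replicate n y) * Z_even (replicate (Suc n) x) (replicate (Suc n) y)"
      unfolding defect_def odd using False by (simp only: ext_simps append_Nil2 turn not_False_eq_True)
    also have "\<dots> = E * (Z_dom (replicate (Suc n) x) (replicate (Suc n) y) * ?O) -
        E * (Z_dom (replicate n x) (replicate n y) * Z_even (replicate (Suc n) x) (replicate (Suc n) y))"
      by (simp only: mult_ac)
    finally show ?thesis unfolding IH' by simp
  next
    case True
    have IH': "Z_dom (replicate n x) (replicate n y) * ?O =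
        Z_dom (replicate (Suc n) x) (replicate (Suc n) y) * Z_even (replicate n x) (replicate n y)"
      using IH True dom[of n] dom[of "Suc n"] even[of n]
      by (simp add: defect_def replicate_append_same)
    have "defect \<beta> (replicate (Suc n) x) X (replicate (Suc n) y) Y =
        E * Z_dom (replicate n x) (replicate n y) * (E * ?O) -
        Z_dom (replicate (Suc n) x) (replicate (Suc n) y) * (E\<^sup>2 * Z_even (replicate n x) (replicate n y))"
      unfolding defect_def odd using True by (simp only: ext_simps append_Nil2 turn not_True_eq_False)
    also have "\<dots> = E\<^sup>2 * (Z_dom (replicate n x) (replicate n y) * ?O) -
        E\<^sup>2 * (Z_dom (replicate (Suc n) x) (replicate (Suc n) y) * Z_even (replicate n x) (replicate n y))"
      by (simp only: mult_ac power2_eq_square)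
    finally show ?thesis unfolding IH' by simp
  qed
  then show ?thesis by (simp only: x_def y_def)
qed

text \<open>Curvewise entire functions that are each nonzero somewhere have a product that is
  nonzero somewhere, by two cancellations. The functions \<open>h k\<close> are nonzero for
  \<open>X = a\<close>, \<open>Y = 1\<close>; \<open>q\<close> is the square of
  \<open>sigma a\<close> for \<open>X = Y = 1\<close>. For \<open>\<beta> = True\<close> the larger
  \<open>Z_dom\<close> is reduced to \<open>h n\<close> by \<open>Z_turn\<close>.\<close>

lemma turn_point_exists:
  "\<exists>X Y. X \<noteq> 0 \<and> Y \<noteq> 0 \<and> nodal_factor \<beta> (replicate (Suc n) (a * Y)) X (replicate (Suc n) (a * X)) Y \<noteq> 0"
proof -
  define h where "h k x y = Z_dom (replicate k (a * y (0::nat))) (replicate k (a * x (0::nat)))" for k x y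
  define q where "q x y = sw (a * y (0::nat)) (a * x (0::nat)) * sw (a * x 0) (a * y 0)" for x y
  have h: "curvewise_entire (h k)" for k
  proof -
    have "curvewise_entire (\<lambda>x y. Z_dom (ev (replicate k (\<lambda>x y. a * y 0)) x y) (ev (replicate k (\<lambda>x y. a * x 0)) x y))"
      by (intro curvewise_entire_Z_dom) (auto simp: ce_unit_cmult ce_unit_coords)
    then show ?thesis unfolding h_def[abs_def] by simp
  qed
  have q: "curvewise_entire q"
    unfolding q_def[abs_def] by (intro ce_intros curvewise_entire_sw ce_unit_cmult ce_unit_coords)
  have hn: "h k (\<lambda>_. a) (\<lambda>_. 1) \<noteq> 0" for k
    unfolding h_def using a_nonzero by (intro Z_dom_replicate_nonzero) auto
  have "\<exists>x y. (\<forall>i. x i \<noteq> 0) \<and> (\<forall>i. y i \<noteq> 0) \<and> q x y * h n x y * h (Suc n) x y \<noteq> 0"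
  proof (rule ccontr)
    assume "\<not> ?thesis"
    then have z: "q x y * h n x y * h (Suc n) x y = 0" if "\<forall>i. x i \<noteq> 0" "\<forall>i. y i \<noteq> 0" for x y
      using that by blast
    have qh: "q x y * h n x y = 0" if "\<forall>i. x i \<noteq> 0" "\<forall>i. y i \<noteq> 0" for x y
    proof (rule curvewise_entire_cancel[of "\<lambda>x y. q x y * h n x y" "h (Suc n)" "\<lambda>_. a" "\<lambda>_. 1" x y])
      show "curvewise_entire (\<lambda>x y. q x y * h n x y)" by (intro ce_intros q h)
    qed (rule h z hn that | assumption | simp add: a_nonzero)+
    have "q (\<lambda>_. 1) (\<lambda>_. 1) = 0"
      by (rule curvewise_entire_cancel[of q "h n" "\<lambda>_. a" "\<lambda>_. 1" "\<lambda>_. 1" "\<lambda>_. 1"])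
         (rule q h qh hn | assumption | simp add: a_nonzero)+
    then show False using sigma_a a_nonzero by (simp add: q_def sw_def)
  qed
  then obtain x y :: "nat \<Rightarrow> complex" where nz: "\<forall>i. x i \<noteq> 0" "\<forall>i. y i \<noteq> 0"
    and ne: "q x y \<noteq> 0" "h n x y \<noteq> 0" "h (Suc n) x y \<noteq> 0" by auto
  define X where "X = x 0"
  define Y where "Y = y 0"
  have XY: "X \<noteq> 0" "Y \<noteq> 0" using nz by (auto simp: X_def Y_def)
  have q': "sw (a * Y) (a * X) * sw (a * X) (a * Y) \<noteq> 0" using ne(1) by (simp add: q_def X_def Y_def)
  have "Z_dom (replicate (Suc n) (a * Y) @ ext \<beta> X) (replicate (Suc n) (a * X) @ ext \<beta> Y) \<noteq> 0"
  proof (cases \<beta>)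
    case True
    then show ?thesis
      using Z_turn(1)[OF refl refl XY refl, of n] q' sigma_a2 ne(2) by (simp add: h_def X_def Y_def)
  next
    case False
    then show ?thesis using ne(3) by (simp add: h_def X_def Y_def)
  qed
  moreover have "(\<Prod>x\<leftarrow>replicate (Suc n) (a * Y). \<Prod>y\<leftarrow>replicate (Suc n) (a * X). sw x y * sw y x) \<noteq> 0"
    unfolding map_replicate prod_list_replicate using q' by (simp only: power_eq_0_iff simp_thms)
  ultimately have "nodal_factor \<beta> (replicate (Suc n) (a * Y)) X (replicate (Suc n) (a * X)) Y \<noteq> 0"
    unfolding nodal_factor_def by (simp only: mult_eq_0_iff simp_thms)
  with XY show ?thesis by blast
qed

section \<open>Propagation from the reconnection point\<close>

text \<open>The entries \<open>b\<close> are exchanged for those of \<open>xs\<close> one by one.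
  The cross relation hands the zero on as long as the nodal factor at the current point is
  nonzero.\<close>

lemma defect_chain:
  assumes cross: "\<And>xs u v. length xs = n \<Longrightarrow> nonzero xs \<Longrightarrow> u \<noteq> 0 \<Longrightarrow> v \<noteq> 0 \<Longrightarrow>
      defect \<beta> (u # xs) X ys Y * nodal_factor \<beta> (v # xs) X ys Y = defect \<beta> (v # xs) X ys Y * nodal_factor \<beta> (u # xs) X ys Y"
    and len: "length xs = Suc n" and nz: "nonzero xs" "nonzero ys" "X \<noteq> 0" "Y \<noteq> 0" "b \<noteq> 0"
    and start: "defect \<beta> (replicate (Suc n) b) X ys Y = 0"
    and factor: "\<And>k. k \<le> n \<Longrightarrow> nodal_factor \<beta> (take k xs @ replicate (Suc n - k) b) X ys Y \<noteq> 0"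
  shows "defect \<beta> xs X ys Y = 0"
proof -
  have "defect \<beta> (take k xs @ replicate (Suc n - k) b) X ys Y = 0" if "k \<le> Suc n" for k
    using that
  proof (induction k)
    case 0
    then show ?case using start by simp
  next
    case (Suc k)
    let ?L = "take k xs @ replicate (n - k) b"
    have k: "k < length xs" using Suc.prems len by simp
    have nzL: "nonzero ?L" "xs ! k \<noteq> 0" using nz k by (auto dest: in_set_takeD)
    have "Suc n - k = Suc (n - k)" using Suc.prems by simp
    then have m1: "mset (take k xs @ replicate (Suc n - k) b) = mset (b # ?L)" by simp
    have m2: "mset (take (Suc k) xs @ replicate (Suc n - Suc k) b) = mset (xs ! k # ?L)"
      using k by (simp add: take_Suc_conv_app_nth)
    have "defect \<beta> (b # ?L) X ys Y = 0"
      using Suc.IH Suc.prems defect_perm[OF _ nz(3,2,4) m1, of \<beta>] nz nzL by (auto dest: in_set_takeD)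
    moreover have "nodal_factor \<beta> (b # ?L) X ys Y \<noteq> 0"
      using factor[of k] Suc.prems nodal_factor_perm[OF _ nz(3,2,4) m1, of \<beta>] nz nzL by (auto dest: in_set_takeD)
    moreover have "defect \<beta> (xs ! k # ?L) X ys Y * nodal_factor \<beta> (b # ?L) X ys Y =
        defect \<beta> (b # ?L) X ys Y * nodal_factor \<beta> (xs ! k # ?L) X ys Y"
      using Suc.prems len nz nzL by (intro cross) auto
    ultimately have "defect \<beta> (xs ! k # ?L) X ys Y = 0" by simp
    moreover have "nonzero (take (Suc k) xs @ replicate (Suc n - Suc k) b)"
      using nz by (auto dest: in_set_takeD)
    ultimately show ?case
      using defect_perm[OF _ nz(3,2,4) m2, of \<beta>] by simp
  qed
  from this[of "Suc n"] show ?thesis using len by simp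
qed

text \<open>With no vertices only the middle edge in state True contributes. The identities become
  \<open>sigma a * (a + inverse a) = sigma (a\<^sup>2)\<close> and the splitting of
  \<open>sw X Y + sw Y X\<close> as \<open>sigma a\<close> times the sum of the ratio of
  \<open>X\<close> and \<open>Y\<close> and its inverse.\<close>

lemma defect_base:
  assumes "X \<noteq> 0" "Y \<noteq> 0"
  shows "defect \<beta> [] X [] Y = 0"
proof -
  have odd: "Z_odd s [] X [] Y = of_bool s" for s
    by (simp add: Z_odd_alt block_def)
  have b: "block [x] [y] [e] [d] = (if e = d then (if e then sw x y else sigma (a\<^sup>2)) else 0)" for x y e d
    by (cases e; cases d) (simp_all add: block_def UNIV_bool vweight_simps)
  have d0: "Z_dom [] [] = 1" "Z_even [] [] = 1" by (simp_all add: Z_dom_def Z_even_alt block_def)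
  have d1: "Z_dom [X] [Y] = sigma (a\<^sup>2)" by (simp add: Z_dom_def b)
  have e1: "Z_even [X] [Y] = sigma (a\<^sup>2) * (sw X Y + sw Y X)"
    by (simp add: Z_even_alt UNIV_bool b algebra_simps)
  have "sw X Y + sw Y X = sigma a * (X * inverse Y + Y * inverse X)" "sigma a * (a + inverse a) = sigma (a\<^sup>2)"
    using assms a_nonzero by (simp_all add: sw_def sigma_def field_simps power2_eq_square)
  then show ?thesis
    by (cases \<beta>) (simp_all add: defect_def odd_comb_def odd d0 d1 e1)
qed

text \<open>Two chains lead from the reconnection point of \<open>X\<close> and \<open>Y\<close> to
  arbitrary parameters: one changes the rows, the other, after transposition, the columns. They need
  nonzero nodal factors at every stage; the product of all these factors is cancelled by
  continuation.\<close>

theorem defect_zero: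
  assumes "length xs = n" "length ys = n" "nonzero xs" "nonzero ys" "X \<noteq> 0" "Y \<noteq> 0"
  shows "defect \<beta> xs X ys Y = 0"
  using assms
proof (induction n arbitrary: \<beta> xs X ys Y)
  case 0
  then show ?case by (simp add: defect_base)
next
  case (Suc n)
  note zero = Suc.IH
  let ?M = "Suc n"
  obtain x where x: "\<forall>i. x i \<noteq> 0" "map x [0..<?M] = xs" "x ?M = X"
    using list_as_map[of xs X] Suc.prems by metis
  obtain y where y: "\<forall>i. y i \<noteq> 0" "map y [0..<?M] = ys" "y ?M = Y"
    using list_as_map[of ys Y] Suc.prems by metis
  let ?f = "\<lambda>x y. defect \<beta> (map x [0..<?M]) (x ?M) (map y [0..<?M]) (y ?M)"
  \<comment> \<open>\<open>?gx k\<close> and \<open>?gy k\<close> are the nodal factors after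
    \<open>k\<close> replacements in the chain of rows and in the chain of columns.\<close>
  let ?gx = "\<lambda>k x y. nodal_factor \<beta> (map x [0..<k] @ replicate (?M - k) (a * y ?M)) (x ?M) (replicate ?M (a * x ?M)) (y ?M)"
  let ?gy = "\<lambda>k x y. nodal_factor \<beta> (map y [0..<k] @ replicate (?M - k) (a * x ?M)) (y ?M) (map x [0..<?M]) (x ?M)"
  let ?g = "\<lambda>x y. (\<Prod>k\<le>n. ?gx k x y) * (\<Prod>k\<le>n. ?gy k x y)"
  let ?px = "\<lambda>k. map (\<lambda>i x y. x i) [0..<k] :: ((nat \<Rightarrow> complex) \<Rightarrow> (nat \<Rightarrow> complex) \<Rightarrow> complex) list"
  let ?py = "\<lambda>k. map (\<lambda>i x y. y i) [0..<k] :: ((nat \<Rightarrow> complex) \<Rightarrow> (nat \<Rightarrow> complex) \<Rightarrow> complex) list"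
  have p: "ev (?px k) x y = map x [0..<k]" "ev (?py k) x y = map y [0..<k]" for k x y
    by (simp_all only: map_map comp_def)
  have u: "\<And>k p. p \<in> set (?px k) \<Longrightarrow> ce_unit p" "\<And>k q. q \<in> set (?py k) \<Longrightarrow> ce_unit q"
    by (auto intro: ce_unit_coords)
  obtain X0 Y0 where XY0: "X0 \<noteq> 0" "Y0 \<noteq> 0"
    "nodal_factor \<beta> (replicate ?M (a * Y0)) X0 (replicate ?M (a * X0)) Y0 \<noteq> 0"
    using turn_point_exists by blast
  have "?f x y = 0"
  \<comment> \<open>At the reconnection point replacing an entry changes nothing, so all factors of
    \<open>?g\<close> have one common nonzero value.\<close>
  proof (rule curvewise_entire_cancel[of ?f ?g "\<lambda>i. if i < ?M then a * Y0 else X0" "\<lambda>i. if i < ?M then a * X0 else Y0" x y])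
    show "curvewise_entire ?f"
    proof -
      have "curvewise_entire (\<lambda>x y. defect \<beta> (ev (?px ?M) x y) (x ?M) (ev (?py ?M) x y) (y ?M))"
        by (rule curvewise_entire_defect) (auto intro: ce_unit_coords)
      then show ?thesis by (simp only: p)
    qed
    have "curvewise_entire (?gx k)" for k
    proof -
      have "curvewise_entire (\<lambda>x y. nodal_factor \<beta> (ev (?px k @ replicate (?M - k) (\<lambda>x y. a * y ?M)) x y) (x ?M)
          (ev (replicate ?M (\<lambda>x y. a * x ?M)) x y) (y ?M))"
        by (intro curvewise_entire_nodal_factor) (auto simp: ce_unit_coords ce_unit_cmult)
      then show ?thesis by (simp only: map_append p map_replicate)
    qed
    moreover have "curvewise_entire (?gy k)" for k
    proof -
      have "curvewise_entire (\<lambda>x y. nodal_factor \<beta> (ev (?py k @ replicate (?M - k) (\<lambda>x y. a * x ?M)) x y) (y ?M)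
          (ev (?px ?M) x y) (x ?M))"
        by (intro curvewise_entire_nodal_factor) (auto simp: ce_unit_coords ce_unit_cmult)
      then show ?thesis by (simp only: map_append p map_replicate)
    qed
    ultimately show "curvewise_entire ?g" by (intro ce_intros)
    show "?f x y * ?g x y = 0" if nz: "\<forall>i. x i \<noteq> 0" "\<forall>i. y i \<noteq> 0" for x y
    proof (cases "?g x y = 0")
      case False
      then have P: "(\<Prod>k\<le>n. ?gx k x y) \<noteq> 0" "(\<Prod>k\<le>n. ?gy k x y) \<noteq> 0"
        by (simp_all only: mult_eq_0_iff de_Morgan_disj not_False_eq_True simp_thms)
      have nonzero_factor: "h k \<noteq> 0" if "prod h {..n} \<noteq> 0" "k \<le> n" for k and h :: "nat \<Rightarrow> complex"
      proof
        assume "h k = 0"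
        then have "prod h {..n} = 0" using that(2) by (intro prod_zero bexI[of _ k]) auto
        with that(1) show False by simp
      qed
      note gx = nonzero_factor[OF P(1)] and gy = nonzero_factor[OF P(2)]
      let ?xs = "map x [0..<?M]" and ?ys = "map y [0..<?M]" and ?X = "x ?M" and ?Y = "y ?M"
      have nzl: "nonzero ?xs" "nonzero ?ys" "?X \<noteq> 0" "?Y \<noteq> 0" "nonzero (replicate ?M (a * ?X))"
        using nz a_nonzero by auto
      have take: "take k (map z [0..<?M]) = map z [0..<k]" if "k \<le> n" for k and z :: "nat \<Rightarrow> complex"
        using that by (simp add: take_map del: upt_Suc)
      have 1: "defect \<beta> ?xs ?X (replicate ?M (a * ?X)) ?Y = 0"
      proof (rule defect_chain[where b = "a * ?Y"])
        show "defect \<beta> (replicate ?M (a * ?Y)) ?X (replicate ?M (a * ?X)) ?Y = 0"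
          by (rule defect_turn; (rule zero; assumption | rule nzl(3) | rule nzl(4)))
        show "nodal_factor \<beta> (take k ?xs @ replicate (?M - k) (a * ?Y)) ?X (replicate ?M (a * ?X)) ?Y \<noteq> 0" if "k \<le> n" for k
          unfolding take[OF that] by (rule gx[OF that])
        show "defect \<beta> (u # xs) ?X (replicate ?M (a * ?X)) ?Y * nodal_factor \<beta> (v # xs) ?X (replicate ?M (a * ?X)) ?Y =
          defect \<beta> (v # xs) ?X (replicate ?M (a * ?X)) ?Y * nodal_factor \<beta> (u # xs) ?X (replicate ?M (a * ?X)) ?Y"
          if "length xs = n" "nonzero xs" "u \<noteq> 0" "v \<noteq> 0" for xs u v
          by (rule defect_cross[where n = n]; (rule zero; assumption | rule that nzl | simp only: length_replicate length_map length_upt minus_nat.diff_0))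
      qed (rule nzl | simp only: length_map length_upt minus_nat.diff_0 | simp add: a_nonzero nz)+
      have "defect \<beta> ?ys ?Y ?xs ?X = 0"
      proof (rule defect_chain[where b = "a * ?X"])
        show "defect \<beta> (replicate ?M (a * ?X)) ?Y ?xs ?X = 0"
          using 1 unfolding defect_commute[OF nzl(1,3,5,4), of \<beta>] .
        show "nodal_factor \<beta> (take k ?ys @ replicate (?M - k) (a * ?X)) ?Y ?xs ?X \<noteq> 0" if "k \<le> n" for k
          unfolding take[OF that] by (rule gy[OF that])
        show "defect \<beta> (u # ys) ?Y ?xs ?X * nodal_factor \<beta> (v # ys) ?Y ?xs ?X =
          defect \<beta> (v # ys) ?Y ?xs ?X * nodal_factor \<beta> (u # ys) ?Y ?xs ?X"
          if "length ys = n" "nonzero ys" "u \<noteq> 0" "v \<noteq> 0" for ys u v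
          by (rule defect_cross[where n = n]; (rule zero; assumption | rule that nzl | simp only: length_replicate length_map length_upt minus_nat.diff_0))
      qed (rule nzl | simp only: length_map length_upt minus_nat.diff_0 | simp add: a_nonzero nz)+
      then show ?thesis unfolding defect_commute[OF nzl(1,3,2,4), of \<beta>] by (simp only: mult_zero_left)
    qed (simp only: mult_zero_right)
    let ?x0 = "\<lambda>i. if i < ?M then a * Y0 else X0" and ?y0 = "\<lambda>i. if i < ?M then a * X0 else Y0"
    have l: "map ?x0 [0..<k] = replicate k (a * Y0)" "map ?y0 [0..<k] = replicate k (a * X0)" if "k \<le> ?M" for k
      by (rule nth_equalityI; use that in \<open>simp del: upt_Suc\<close>)+
    have r: "replicate k z @ replicate (?M - k) z = replicate ?M z" if "k \<le> n" for k and z :: complex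
      using that by (simp only: replicate_add[symmetric] le_add_diff_inverse le_SucI)
    let ?C = "nodal_factor \<beta> (replicate ?M (a * Y0)) X0 (replicate ?M (a * X0)) Y0"
    have gx0: "?gx k ?x0 ?y0 = ?C" if "k \<le> n" for k
      unfolding l(1)[OF le_SucI[OF that]] by (simp only: less_irrefl if_False r[OF that])
    have gy0: "?gy k ?x0 ?y0 = ?C" if "k \<le> n" for k
    proof -
      have "?gy k ?x0 ?y0 = nodal_factor \<beta> (replicate ?M (a * X0)) Y0 (replicate ?M (a * Y0)) X0"
        unfolding l(2)[OF le_SucI[OF that]] l(1)[OF order_refl] by (simp only: less_irrefl if_False r[OF that])
      also have "\<dots> = ?C"
        by (rule nodal_factor_commute) (simp_all add: XY0 a_nonzero)
      finally show ?thesis .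
    qed
    have "(\<Prod>k\<le>n. ?gx k ?x0 ?y0) = (\<Prod>k\<le>n. ?C)" "(\<Prod>k\<le>n. ?gy k ?x0 ?y0) = (\<Prod>k\<le>n. ?C)"
      by (rule prod.cong[OF refl]; simp only: gx0 gy0 atMost_iff)+
    moreover have "(\<Prod>k\<le>n. ?C) * (\<Prod>k\<le>n. ?C) \<noteq> 0"
      unfolding prod_constant using XY0(3) by (simp only: mult_eq_0_iff power_eq_0_iff simp_thms)
    ultimately show "?g ?x0 ?y0 \<noteq> 0" by (simp only: simp_thms)
  qed (use x(1) y(1) XY0(1,2) a_nonzero in auto)
  then show ?case by (simp only: x y)
qed

end

section \<open>From states to transfer matrices\<close>

abbreviation states :: "edge set \<Rightarrow> (edge \<Rightarrow> bool) set" where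
  "states E \<equiv> PiE E (\<lambda>_. UNIV)"

text \<open>Configurations violating the ice rule have weight 0. Summing over all orientations makes
  the sum factor over disjoint sets of edges.\<close>

lemma pf_eq_sum_states:
  assumes "finite V" "finite E"
  shows "pf a V zf E slots = (\<Sum>s\<in>states E. \<Prod>v\<in>V. case slots s v of (L, R, U, D) \<Rightarrow> vweight a (zf v) L R U D)"
  unfolding pf_def
proof (rule sum.mono_neutral_left)
  show "finite (states E)" using assms(2) by (intro finite_PiE) auto
  have zero: "vweight a z L R U D = 0" if "\<not> ice L R U D" for z L R U D
    using that by (auto simp: ice_def vweight_def)
  show "\<forall>s\<in>states E - {s \<in> states E. \<forall>v\<in>V. case slots s v of (L, R, U, D) \<Rightarrow> ice L R U D}.
     (\<Prod>v\<in>V. case slots s v of (L, R, U, D) \<Rightarrow> vweight a (zf v) L R U D) = 0"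
  proof
    fix s assume "s \<in> states E - {s \<in> states E. \<forall>v\<in>V. case slots s v of (L, R, U, D) \<Rightarrow> ice L R U D}"
    then have "\<not> (\<forall>v\<in>V. case slots s v of (L, R, U, D) \<Rightarrow> ice L R U D)"
      by (auto simp only: Diff_iff mem_Collect_eq)
    then obtain v where v: "v \<in> V" "\<not> (case slots s v of (L, R, U, D) \<Rightarrow> ice L R U D)"
      unfolding ball_simps by (rule bexE)
    then have "(case slots s v of (L, R, U, D) \<Rightarrow> vweight a (zf v) L R U D) = 0"
      by (auto split: prod.splits simp: zero)
    then show "(\<Prod>v\<in>V. case slots s v of (L, R, U, D) \<Rightarrow> vweight a (zf v) L R U D) = 0"
      using v(1) assms(1) by (intro prod_zero) auto
  qed
qed auto

definition merge :: "edge set \<Rightarrow> (edge \<Rightarrow> bool) \<Rightarrow> (edge \<Rightarrow> bool) \<Rightarrow> edge \<Rightarrow> bool" where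
  "merge A s t e = (if e \<in> A then s e else t e)"

lemma sum_states_Un:
  assumes "A \<inter> B = {}"
  shows "sum f (states (A \<union> B)) = (\<Sum>s\<in>states A. \<Sum>t\<in>states B. (f (merge A s t) :: complex))"
proof -
  have "(\<Sum>s\<in>states A. \<Sum>t\<in>states B. f (merge A s t)) = (\<Sum>p\<in>states A \<times> states B. f (merge A (fst p) (snd p)))"
    by (simp add: sum.cartesian_product case_prod_beta)
  also have "\<dots> = sum f (states (A \<union> B))"
  proof (rule sum.reindex_bij_witness[where i = "\<lambda>s. (restrict s A, restrict s B)" and j = "\<lambda>p. merge A (fst p) (snd p)"])
    fix p assume p: "p \<in> states A \<times> states B"
    then have "restrict (merge A (fst p) (snd p)) A = fst p" "restrict (merge A (fst p) (snd p)) B = snd p"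
      using assms by (auto simp: merge_def restrict_def PiE_def extensional_def fun_eq_iff)
    then show "(restrict (merge A (fst p) (snd p)) A, restrict (merge A (fst p) (snd p)) B) = p" by simp
    show "merge A (fst p) (snd p) \<in> states (A \<union> B)"
      using p by (auto simp: merge_def PiE_def extensional_def)
  next
    fix s assume s: "s \<in> states (A \<union> B)"
    then show "merge A (fst (restrict s A, restrict s B)) (snd (restrict s A, restrict s B)) = s"
      by (auto simp: merge_def restrict_def PiE_def extensional_def fun_eq_iff)
    show "(restrict s A, restrict s B) \<in> states A \<times> states B" by auto
  qed auto
  finally show ?thesis ..
qed

lemma sum_states_list:
  assumes "distinct es"
  shows "(\<Sum>s\<in>states (set es). f (map s es)) = (\<Sum>bs\<in>bools (length es). (f bs :: complex))"
proof (rule sum.reindex_bij_witness[where j = "\<lambda>s. map s es"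
      and i = "\<lambda>bs e. if e \<in> set es then the (map_of (zip es bs) e) else undefined"])
  fix s assume s: "s \<in> states (set es)"
  show "(\<lambda>e. if e \<in> set es then the (map_of (zip es (map s es)) e) else undefined) = s"
    using s by (auto simp: fun_eq_iff PiE_def extensional_def map_of_zip_map)
  show "map s es \<in> bools (length es)" by simp
next
  fix bs assume bs: "bs \<in> bools (length es)"
  show "map (\<lambda>e. if e \<in> set es then the (map_of (zip es bs) e) else undefined) es = bs"
    using bs assms by (intro nth_equalityI) (auto simp: map_of_zip_nth)
  show "(\<lambda>e. if e \<in> set es then the (map_of (zip es bs) e) else undefined) \<in> states (set es)" by auto
qed simp

lemma sum_states_insert:
  assumes "e \<notin> B"
  shows "sum f (states (insert e B)) = (\<Sum>b\<in>UNIV. \<Sum>t\<in>states B. (f (t(e := b)) :: complex))"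
proof -
  have "sum f (states ({e} \<union> B)) = (\<Sum>s\<in>states (set [e]). \<Sum>t\<in>states B. f (merge {e} s t))"
    using assms by (subst sum_states_Un) auto
  also have "\<dots> = (\<Sum>s\<in>states (set [e]). (\<lambda>bs. \<Sum>t\<in>states B. f (t(e := hd bs))) (map s [e]))"
    by (intro sum.cong refl arg_cong[where f = f]) (auto simp: merge_def fun_eq_iff)
  also have "\<dots> = (\<Sum>bs\<in>bools (length [e]). \<Sum>t\<in>states B. f (t(e := hd bs)))"
    by (rule sum_states_list) simp
  finally show ?thesis by simp
qed

context six_vertex
begin

text \<open>The first row \<open>r\<close> is arbitrary because the half column of the odd model
  starts at row \<open>m + 2\<close>.\<close>

lemma sum_states_col:
  assumes "r \<le> p"
  shows "(\<Sum>s\<in>states {Ver i j | i. r \<le> i \<and> i < p}. \<Prod>i\<in>{r..p}. vweight a (z i) (l i) (k i)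
      (if i = r then u else s (Ver (i - 1) j)) (if i = p then d else s (Ver i j))) =
    col (map z [r..<Suc p]) u (map l [r..<Suc p]) (map k [r..<Suc p]) d"
  using assms
proof (induction r arbitrary: u rule: inc_induct)
  case base
  have empty: "{Ver i j | i. p \<le> i \<and> i < p} = {}" by auto
  show ?case unfolding empty PiE_empty_domain by (simp add: UNIV_bool)
next
  case (step r)
  let ?e = "Ver r j" and ?B = "{Ver i j | i. Suc r \<le> i \<and> i < p}"
  let ?w = "\<lambda>r u s i. vweight a (z i) (l i) (k i) (if i = r then u else s (Ver (i - 1) j)) (if i = p then d else s (Ver i j))"
  have E: "{Ver i j | i. r \<le> i \<and> i < p} = insert ?e ?B"
    using step.hyps by (auto simp: Suc_le_eq)
  have "(\<Sum>s\<in>states {Ver i j | i. r \<le> i \<and> i < p}. \<Prod>i\<in>{r..p}. ?w r u s i) =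
     (\<Sum>b\<in>UNIV. \<Sum>t\<in>states ?B. \<Prod>i\<in>{r..p}. ?w r u (t(?e := b)) i)"
    unfolding E by (rule sum_states_insert) auto
  also have "\<dots> = (\<Sum>b\<in>UNIV. \<Sum>t\<in>states ?B. vweight a (z r) (l r) (k r) u b * (\<Prod>i\<in>{Suc r..p}. ?w (Suc r) b t i))"
  proof (intro sum.cong refl)
    fix b t
    have "{r..p} = insert r {Suc r..p}" using step.hyps by auto
    then have "(\<Prod>i\<in>{r..p}. ?w r u (t(?e := b)) i) = ?w r u (t(?e := b)) r * (\<Prod>i\<in>{Suc r..p}. ?w r u (t(?e := b)) i)"
      by simp
    also have "(\<Prod>i\<in>{Suc r..p}. ?w r u (t(?e := b)) i) = (\<Prod>i\<in>{Suc r..p}. ?w (Suc r) b t i)"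
      by (intro prod.cong refl) auto
    finally show "(\<Prod>i\<in>{r..p}. ?w r u (t(?e := b)) i) = vweight a (z r) (l r) (k r) u b * (\<Prod>i\<in>{Suc r..p}. ?w (Suc r) b t i)"
      using step.hyps by simp
  qed
  also have "\<dots> = (\<Sum>b\<in>UNIV. vweight a (z r) (l r) (k r) u b *
      col (map z [Suc r..<Suc p]) b (map l [Suc r..<Suc p]) (map k [Suc r..<Suc p]) d)"
    unfolding sum_distrib_left[symmetric] step.IH ..
  also have "\<dots> = col (map z [r..<Suc p]) u (map l [r..<Suc p]) (map k [r..<Suc p]) d"
  proof -
    have "[r..<Suc p] = r # [Suc r..<Suc p]" using step.hyps by (simp add: upt_conv_Cons del: upt_Suc)
    then show ?thesis by (simp del: upt_Suc)
  qed
  finally show ?case .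
qed

section \<open>Summation over states column by column\<close>

definition col_edges :: "nat \<Rightarrow> nat \<Rightarrow> edge set" where
  "col_edges p j = {Ver i j | i. 1 \<le> i \<and> i < p}"

text \<open>Contains the edges to the right of column \<open>n\<close>, to which the rest of a model
  is attached.\<close>

definition grid_edges :: "nat \<Rightarrow> nat \<Rightarrow> nat \<Rightarrow> edge set" where
  "grid_edges p c n = {Hor i j | i j. 1 \<le> i \<and> i \<le> p \<and> c \<le> j \<and> j \<le> n} \<union> {Ver i j | i j. 1 \<le> i \<and> i < p \<and> c \<le> j \<and> j \<le> n}"

definition grid_weight :: "nat \<Rightarrow> (nat \<Rightarrow> complex) \<Rightarrow> (nat \<Rightarrow> complex) \<Rightarrow> nat \<Rightarrow> (nat \<Rightarrow> bool) \<Rightarrow> (edge \<Rightarrow> bool) \<Rightarrow> nat \<Rightarrow> nat \<Rightarrow> complex" where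
  "grid_weight p x y c l s i j = vweight a (x i * inverse (y j)) (if j = c then l i else s (Hor i (j - 1))) (s (Hor i j))
     (if i = 1 then True else s (Ver (i - 1) j)) (if i = p then False else s (Ver i j))"

text \<open>Columns are summed off from the left; \<open>g\<close> stands for whatever is attached
  to the right edges. For \<open>c = Suc n\<close> no column is left and the right edges are
  \<open>l\<close> itself, hence the conditional.\<close>

lemma sum_states_grid:
  assumes "c \<le> Suc n" "1 \<le> p"
  shows "(\<Sum>s\<in>states (grid_edges p c n). (\<Prod>j\<in>{c..n}. \<Prod>i\<in>{1..p}. grid_weight p x y c l s i j) *
      g (map (\<lambda>i. if c \<le> n then s (Hor i n) else l i) [1..<Suc p])) =
    (\<Sum>ks\<in>bools p. grid (map x [1..<Suc p]) (map y [c..<Suc n]) (replicate (Suc n - c) True) (map l [1..<Suc p]) ks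
       (replicate (Suc n - c) False) * g ks)"
  using assms(1)
proof (induction c arbitrary: l rule: inc_induct)
  case base
  have "grid_edges p (Suc n) n = {}" by (auto simp: grid_edges_def)
  moreover have "(\<Sum>ks\<in>bools p. of_bool (map l [1..<Suc p] = ks) * g ks) = (\<Sum>ks\<in>bools p. if ks = map l [1..<Suc p] then g ks else 0)"
    by (intro sum.cong refl) auto
  ultimately show ?case by (simp del: upt_Suc)
next
  case (step c)
  define H where "H = set (map (\<lambda>i. Hor i c) [1..<Suc p])"
  define V where "V = col_edges p c"
  have H: "Hor i j \<in> H \<longleftrightarrow> j = c \<and> 1 \<le> i \<and> i \<le> p" "Ver i j \<notin> H" for i j
    by (auto simp: H_def simp del: upt_Suc)
  have V: "Ver i j \<in> V \<longleftrightarrow> j = c \<and> 1 \<le> i \<and> i < p" "Hor i j \<notin> V" for i j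
    by (auto simp: V_def col_edges_def)
  let ?B = "grid_edges p (Suc c) n"
  let ?m = "\<lambda>s t r. merge H s (merge V t r)"
  have c: "c \<le> n" using step.hyps by simp
  have E: "grid_edges p c n = H \<union> (V \<union> ?B)"
  proof (rule Set.set_eqI)
    fix e
    show "e \<in> grid_edges p c n \<longleftrightarrow> e \<in> H \<union> (V \<union> ?B)"
      using c by (cases e) (auto simp: H V grid_edges_def)
  qed
  have "e \<notin> H \<or> e \<notin> V \<union> ?B" "e \<notin> V \<or> e \<notin> ?B" for e
    by (cases e; auto simp: H V grid_edges_def)+
  then have d1: "H \<inter> (V \<union> ?B) = {}" and d2: "V \<inter> ?B = {}"
    by blast+
  let ?l = "\<lambda>s i. s (Hor i c)"
  let ?xs = "map x [1..<Suc p]"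
  let ?cw = "\<lambda>s t i. vweight a (x i * inverse (y c)) (l i) (s (Hor i c))
      (if i = 1 then True else t (Ver (i - 1) c)) (if i = p then False else t (Ver i c))"
  let ?last = "\<lambda>c l s. map (\<lambda>i. if c \<le> n then s (Hor i n) else l i) [1..<Suc p]"
  let ?col = "\<lambda>ks. col (map (\<lambda>x. x * inverse (y c)) ?xs) True (map l [1..<Suc p]) ks False"
  have weight_split: "(\<Prod>j\<in>{c..n}. \<Prod>i\<in>{1..p}. grid_weight p x y c l (?m s t r) i j) * g (?last c l (?m s t r)) =
      (\<Prod>i\<in>{1..p}. ?cw s t i) * ((\<Prod>j\<in>{Suc c..n}. \<Prod>i\<in>{1..p}. grid_weight p x y (Suc c) (?l s) r i j) * g (?last (Suc c) (?l s) r))" for s t r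
  proof -
    have "(\<Prod>j\<in>{c..n}. \<Prod>i\<in>{1..p}. grid_weight p x y c l (?m s t r) i j) =
       (\<Prod>i\<in>{1..p}. grid_weight p x y c l (?m s t r) i c) * (\<Prod>j\<in>{Suc c..n}. \<Prod>i\<in>{1..p}. grid_weight p x y c l (?m s t r) i j)"
      using c by (simp add: atLeastAtMost_insertL[symmetric])
    also have "(\<Prod>i\<in>{1..p}. grid_weight p x y c l (?m s t r) i c) = (\<Prod>i\<in>{1..p}. ?cw s t i)"
    proof (intro prod.cong refl)
      fix i assume "i \<in> {1..p}"
      then have i: "1 \<le> i" "i \<le> p" by auto
      have "?m s t r (Hor i c) = s (Hor i c)" "i \<noteq> p \<Longrightarrow> ?m s t r (Ver i c) = t (Ver i c)"
        "i \<noteq> 1 \<Longrightarrow> ?m s t r (Ver (i - 1) c) = t (Ver (i - 1) c)"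
        using i by (auto simp: merge_def H V)
      then show "grid_weight p x y c l (?m s t r) i c = ?cw s t i"
        unfolding grid_weight_def by (cases "i = 1"; cases "i = p") (simp_all only: if_True if_False simp_thms)
    qed
    also have "(\<Prod>j\<in>{Suc c..n}. \<Prod>i\<in>{1..p}. grid_weight p x y c l (?m s t r) i j) =
        (\<Prod>j\<in>{Suc c..n}. \<Prod>i\<in>{1..p}. grid_weight p x y (Suc c) (?l s) r i j)"
    proof (intro prod.cong refl)
      fix j i assume "j \<in> {Suc c..n}" "i \<in> {1..p}"
      then have ij: "j \<noteq> c" "1 \<le> i" "i \<le> p" "j - 1 = c \<longleftrightarrow> j = Suc c" by auto
      then have "?m s t r (Hor i j) = r (Hor i j)" "?m s t r (Ver k j) = r (Ver k j)"
        "?m s t r (Hor i (j - 1)) = (if j = Suc c then s (Hor i c) else r (Hor i (j - 1)))" for k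
        by (auto simp: merge_def H V)
      then show "grid_weight p x y c l (?m s t r) i j = grid_weight p x y (Suc c) (?l s) r i j"
        unfolding grid_weight_def using ij(1) by (simp only: if_False)
    qed
    finally have weights: "(\<Prod>j\<in>{c..n}. \<Prod>i\<in>{1..p}. grid_weight p x y c l (?m s t r) i j) =
        (\<Prod>i\<in>{1..p}. ?cw s t i) * (\<Prod>j\<in>{Suc c..n}. \<Prod>i\<in>{1..p}. grid_weight p x y (Suc c) (?l s) r i j)" .
    have last: "?last c l (?m s t r) = ?last (Suc c) (?l s) r"
      using c by (cases "c = n") (auto simp: merge_def H V simp del: upt_Suc)
    show ?thesis unfolding weights last by (simp only: mult.assoc)
  qed
  have colsum: "(\<Sum>t\<in>states V. \<Prod>i\<in>{1..p}. ?cw s t i) = ?col (map s (map (\<lambda>i. Hor i c) [1..<Suc p]))" for s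
    using sum_states_col[OF assms(2), where j = c and z = "\<lambda>i. x i * inverse (y c)" and l = l
      and k = "\<lambda>i. s (Hor i c)" and u = True and d = False]
    unfolding V_def col_edges_def by (simp add: comp_def del: upt_Suc)
  let ?G = "\<lambda>js ks. grid ?xs (map y [Suc c..<Suc n]) (replicate (Suc n - Suc c) True) js ks (replicate (Suc n - Suc c) False)"
  have IH: "(\<Sum>r\<in>states ?B. (\<Prod>j\<in>{Suc c..n}. \<Prod>i\<in>{1..p}. grid_weight p x y (Suc c) (?l s) r i j) * g (?last (Suc c) (?l s) r)) =
      (\<Sum>ks\<in>bools p. ?G (map s (map (\<lambda>i. Hor i c) [1..<Suc p])) ks * g ks)" for s
    unfolding step.IH by (simp add: comp_def del: upt_Suc)
  have "(\<Sum>s\<in>states (grid_edges p c n). (\<Prod>j\<in>{c..n}. \<Prod>i\<in>{1..p}. grid_weight p x y c l s i j) * g (?last c l s)) =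
     (\<Sum>s\<in>states H. \<Sum>t\<in>states V. \<Sum>r\<in>states ?B. (\<Prod>i\<in>{1..p}. ?cw s t i) *
       ((\<Prod>j\<in>{Suc c..n}. \<Prod>i\<in>{1..p}. grid_weight p x y (Suc c) (?l s) r i j) * g (?last (Suc c) (?l s) r)))"
    unfolding E sum_states_Un[OF d1] sum_states_Un[OF d2] weight_split ..
  also have "\<dots> = (\<Sum>s\<in>states H. (\<Sum>t\<in>states V. \<Prod>i\<in>{1..p}. ?cw s t i) *
      (\<Sum>r\<in>states ?B. (\<Prod>j\<in>{Suc c..n}. \<Prod>i\<in>{1..p}. grid_weight p x y (Suc c) (?l s) r i j) * g (?last (Suc c) (?l s) r)))"
    unfolding sum_product ..
  also have "\<dots> = (\<Sum>s\<in>states H. (\<lambda>js. ?col js * (\<Sum>ks\<in>bools p. ?G js ks * g ks)) (map s (map (\<lambda>i. Hor i c) [1..<Suc p])))"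
    unfolding IH colsum ..
  also have "\<dots> = (\<Sum>js\<in>bools (length (map (\<lambda>i. Hor i c) [1..<Suc p])). ?col js * (\<Sum>ks\<in>bools p. ?G js ks * g ks))"
    unfolding H_def by (rule sum_states_list) (auto simp: distinct_map inj_on_def simp del: upt_Suc)
  also have "\<dots> = (\<Sum>ks\<in>bools p. (\<Sum>js\<in>bools p. ?col js * ?G js ks) * g ks)"
    by (simp only: length_map length_upt diff_Suc_1 sum_distrib_left sum_distrib_right mult.assoc, rule sum.swap)
  also have "\<dots> = (\<Sum>ks\<in>bools p. grid ?xs (map y [c..<Suc n]) (replicate (Suc n - c) True) (map l [1..<Suc p]) ks
       (replicate (Suc n - c) False) * g ks)"
  proof -
    have "[c..<Suc n] = c # [Suc c..<Suc n]" "Suc n - c = Suc (Suc n - Suc c)"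
      using c by (simp_all add: upt_conv_Cons del: upt_Suc)
    then show ?thesis by (simp only: list.map replicate.simps grid.simps length_map length_upt diff_Suc_1)
  qed
  finally show ?case .
qed

text \<open>In the domain-wall and even models the right edges of the last column are prescribed:
  constant, or determined by the U-turns. This column is therefore kept apart from
  \<open>grid_edges\<close>.\<close>

lemma sum_states_last_col:
  assumes "1 \<le> p"
  shows "(\<Sum>s\<in>states (grid_edges p 1 k). \<Sum>t\<in>states (col_edges p (Suc k)).
      (\<Prod>j\<in>{1..k}. \<Prod>i\<in>{1..p}. grid_weight p x y 1 (\<lambda>_. True) s i j) *
      (\<Prod>i\<in>{1..p}. vweight a (x i * inverse (y (Suc k))) (if 1 \<le> k then s (Hor i k) else True) (b i)
         (if i = 1 then True else t (Ver (i - 1) (Suc k))) (if i = p then False else t (Ver i (Suc k))))) =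
    grid (map x [1..<Suc p]) (map y [1..<Suc (Suc k)]) (replicate (Suc k) True) (replicate p True) (map b [1..<Suc p])
      (replicate (Suc k) False)"
proof -
  let ?xs = "map x [1..<Suc p]" and ?last = "\<lambda>s. map (\<lambda>i. if 1 \<le> k then s (Hor i k) else True) [1..<Suc p]"
  let ?col = "\<lambda>ks. col (map (\<lambda>x. x * inverse (y (Suc k))) ?xs) True ks (map b [1..<Suc p]) False"
  have colsum: "(\<Sum>t\<in>states (col_edges p (Suc k)). (\<Prod>i\<in>{1..p}. vweight a (x i * inverse (y (Suc k)))
      (if 1 \<le> k then s (Hor i k) else True) (b i)
         (if i = 1 then True else t (Ver (i - 1) (Suc k))) (if i = p then False else t (Ver i (Suc k))))) = ?col (?last s)" for s
    unfolding col_edges_def sum_states_col[OF assms] by (simp add: comp_def del: upt_Suc)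
  have T: "map (\<lambda>_. True) [1..<Suc p] = replicate p True"
    by (simp add: map_replicate_const del: upt_Suc)
  have "(\<Sum>s\<in>states (grid_edges p 1 k). (\<Prod>j\<in>{1..k}. \<Prod>i\<in>{1..p}. grid_weight p x y 1 (\<lambda>_. True) s i j) * ?col (?last s)) =
    (\<Sum>ks\<in>bools p. grid ?xs (map y [1..<Suc k]) (replicate k True) (replicate p True) ks (replicate k False) * ?col ks)"
    using sum_states_grid[of 1 k p x y "\<lambda>_. True" ?col] assms unfolding T by simp
  also have "\<dots> = (\<Sum>ks\<in>bools (length ?xs). grid ?xs (map y [1..<Suc k]) (replicate k True) (replicate p True) ks (replicate k False) *
      grid ?xs [y (Suc k)] [True] ks (map b [1..<Suc p]) [False])"
    by (simp only: length_map length_upt diff_Suc_1)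
       (intro sum.cong refl, subst grid_single_col, simp_all del: upt_Suc)
  also have "\<dots> = grid ?xs (map y [1..<Suc k] @ [y (Suc k)]) (replicate k True @ [True]) (replicate p True) (map b [1..<Suc p]) (replicate k False @ [False])"
    by (rule grid_append_col[symmetric]) (simp_all del: upt_Suc)
  finally show ?thesis
    unfolding sum_distrib_left[symmetric] colsum by (simp add: replicate_append_same)
qed

lemma finite_grid_edges: "finite (grid_edges p c n)" "finite (col_edges p j)"
proof -
  have "grid_edges p c n \<subseteq> (\<lambda>(i, j). Hor i j) ` ({..p} \<times> {..n}) \<union> (\<lambda>(i, j). Ver i j) ` ({..p} \<times> {..n})"
    by (auto simp: grid_edges_def)
  then show "finite (grid_edges p c n)" by (rule finite_subset) auto
  have "col_edges p j \<subseteq> (\<lambda>i. Ver i j) ` {..p}" by (auto simp: col_edges_def)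
  then show "finite (col_edges p j)" by (rule finite_subset) auto
qed

lemma prod_grid_vertices:
  "(\<Prod>v\<in>{1..p} \<times> {1..Suc k}. f v :: complex) = (\<Prod>j\<in>{1..k}. \<Prod>i\<in>{1..p}. f (i, j)) * (\<Prod>i\<in>{1..p}. f (i, Suc k))"
proof -
  have "(\<Prod>v\<in>{1..p} \<times> {1..Suc k}. f v) = (\<Prod>i\<in>{1..p}. \<Prod>j\<in>{1..Suc k}. f (i, j))"
    unfolding prod.cartesian_product by simp
  also have "\<dots> = (\<Prod>j\<in>{1..Suc k}. \<Prod>i\<in>{1..p}. f (i, j))" by (rule prod.swap)
  finally show ?thesis by simp
qed

lemma merge_grid:
  assumes "i \<in> {1..p}" "j \<in> {1..k}"
  shows "merge (grid_edges p 1 k) s t (Hor i j) = s (Hor i j)"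
    "(if j = 1 then True else merge (grid_edges p 1 k) s t (Hor i (j - 1))) = (if j = 1 then True else s (Hor i (j - 1)))"
    "(if i = 1 then True else merge (grid_edges p 1 k) s t (Ver (i - 1) j)) = (if i = 1 then True else s (Ver (i - 1) j))"
    "(if i = p then False else merge (grid_edges p 1 k) s t (Ver i j)) = (if i = p then False else s (Ver i j))"
  using assms by (auto simp: merge_def grid_edges_def)

section \<open>The three models in terms of blocks\<close>

lemma Z_dw_eq_Z_dom: "Z_dw a n x y = Z_dom (map x [1..<Suc n]) (map y [1..<Suc n])"
proof (cases n)
  case 0
  have "dw_edges 0 = {}" by (auto simp: dw_edges_def)
  then show ?thesis using 0 by (simp add: Z_dw_def pf_def Z_dom_def block_def)
next
  case (Suc k)
  let ?E = "grid_edges n 1 k" and ?C = "col_edges n (Suc k)"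
  have E: "dw_edges n = ?E \<union> ?C"
  proof (rule Set.set_eqI)
    fix e show "e \<in> dw_edges n \<longleftrightarrow> e \<in> ?E \<union> ?C"
      by (cases e) (auto simp: dw_edges_def grid_edges_def col_edges_def Suc)
  qed
  have disj: "?E \<inter> ?C = {}" by (auto simp: grid_edges_def col_edges_def)
  have fin: "finite (dw_edges n)" unfolding E using finite_grid_edges by blast
  let ?W = "\<lambda>s v. case dw_slots n s v of (L, R, U, D) \<Rightarrow> vweight a ((\<lambda>(i, j). x i * inverse (y j)) v) L R U D"
  let ?cw = "\<lambda>s t i. vweight a (x i * inverse (y (Suc k))) (if 1 \<le> k then s (Hor i k) else True) False
         (if i = 1 then True else t (Ver (i - 1) (Suc k))) (if i = n then False else t (Ver i (Suc k)))"
  have w1: "?W (merge ?E s t) (i, j) = grid_weight n x y 1 (\<lambda>_. True) s i j" if "i \<in> {1..n}" "j \<in> {1..k}" for s t i j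
  proof -
    have "j \<noteq> n" using that Suc by auto
    then show ?thesis
      by (simp only: dw_slots_def prod.case grid_weight_def merge_grid[OF that] if_False)
  qed
  have w2: "?W (merge ?E s t) (i, Suc k) = ?cw s t i" if "i \<in> {1..n}" for s t i
  proof -
    have m: "1 \<le> k \<Longrightarrow> merge ?E s t (Hor i k) = s (Hor i k)"
      "merge ?E s t (Ver i (Suc k)) = t (Ver i (Suc k))" "merge ?E s t (Ver (i - 1) (Suc k)) = t (Ver (i - 1) (Suc k))"
      using that by (auto simp: merge_def grid_edges_def)
    then show ?thesis using Suc by (auto simp: dw_slots_def)
  qed
  have "Z_dw a n x y = (\<Sum>s\<in>states ?E. \<Sum>t\<in>states ?C. \<Prod>v\<in>{1..n} \<times> {1..Suc k}. ?W (merge ?E s t) v)"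
  proof -
    have "Z_dw a n x y = (\<Sum>s\<in>states (?E \<union> ?C). \<Prod>v\<in>{1..n} \<times> {1..n}. ?W s v)"
      unfolding Z_dw_def E[symmetric] by (rule pf_eq_sum_states[OF _ fin]) simp
    also have "{1..n} \<times> {1..n} = {1..n} \<times> {1..Suc k}" by (simp only: Suc)
    finally show ?thesis unfolding sum_states_Un[OF disj] .
  qed
  also have "\<dots> = (\<Sum>s\<in>states ?E. \<Sum>t\<in>states ?C. (\<Prod>j\<in>{1..k}. \<Prod>i\<in>{1..n}. grid_weight n x y 1 (\<lambda>_. True) s i j) * (\<Prod>i\<in>{1..n}. ?cw s t i))"
    unfolding prod_grid_vertices by (intro sum.cong refl arg_cong2[where f = "(*)"] prod.cong w1 w2)
  also have "\<dots> = grid (map x [1..<Suc n]) (map y [1..<Suc (Suc k)]) (replicate (Suc k) True) (replicate n True) (map (\<lambda>_. False) [1..<Suc n])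
      (replicate (Suc k) False)"
    by (rule sum_states_last_col) (simp add: Suc)
  finally show ?thesis
    using Suc by (simp add: Z_dom_def block_def map_replicate_const del: upt_Suc replicate.simps)
qed

lemma map_reverse_upt: "map (\<lambda>i. f (k + m + 1 - i)) [k + 1..<k + m + 1] = rev (map f [1..<m + 1])"
  by (rule nth_equalityI) (auto simp: rev_nth simp del: upt_Suc intro!: arg_cong[where f = f])

text \<open>Rows \<open>r\<close> and \<open>2 * m + 1 - r\<close> share a U-turn, so the right
  boundary from top to bottom is \<open>es @ rev (map Not es)\<close> and the row parameters are a
  list followed by its reverse. Cutting in the middle and reflecting the lower half gives
  \<open>Z_even\<close>.\<close>

lemma Z_HT_even_eq_Z_even: "Z_HT_even a m x y = Z_even (map x [1..<Suc m]) (map y [1..<Suc m])"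
proof (cases m)
  case 0
  have "hte_edges 0 = {}" by (auto simp: hte_edges_def)
  then show ?thesis using 0 by (simp add: Z_HT_even_def pf_def Z_even_alt block_def)
next
  case (Suc k)
  define p where "p = 2 * m"
  define x' where "x' r = x (min r (2 * m + 1 - r))" for r
  define hs where "hs = map (\<lambda>i. Hor i m) [1..<Suc m]"
  let ?E = "grid_edges p 1 k" and ?C = "col_edges p (Suc k)"
  have hs: "Hor i j \<in> set hs \<longleftrightarrow> j = m \<and> 1 \<le> i \<and> i \<le> m" "Ver i j \<notin> set hs" for i j
    by (auto simp: hs_def simp del: upt_Suc)
  have E: "hte_edges m = ?E \<union> (?C \<union> set hs)"
  proof (rule Set.set_eqI)
    fix e show "e \<in> hte_edges m \<longleftrightarrow> e \<in> ?E \<union> (?C \<union> set hs)"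
      by (cases e) (auto simp: hte_edges_def grid_edges_def col_edges_def hs p_def Suc)
  qed
  have disj: "?E \<inter> (?C \<union> set hs) = {}" "?C \<inter> set hs = {}"
    by (auto simp: grid_edges_def col_edges_def hs_def Suc simp del: upt_Suc)
  have fin: "finite (hte_edges m)" unfolding E using finite_grid_edges by blast
  let ?m = "\<lambda>s t h. merge ?E s (merge ?C t h)"
  let ?b = "\<lambda>h i. if i \<le> m then h (Hor i m) else \<not> h (Hor (2 * m + 1 - i) m)"
  let ?W = "\<lambda>s v. case hte_slots m s v of (L, R, U, D) \<Rightarrow> vweight a ((\<lambda>(r, j). x (min r (2 * m + 1 - r)) * inverse (y j)) v) L R U D"
  let ?cw = "\<lambda>s t h i. vweight a (x' i * inverse (y (Suc k))) (if 1 \<le> k then s (Hor i k) else True) (?b h i)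
         (if i = 1 then True else t (Ver (i - 1) (Suc k))) (if i = p then False else t (Ver i (Suc k)))"
  have w1: "?W (?m s t h) (i, j) = grid_weight p x' y 1 (\<lambda>_. True) s i j" if "i \<in> {1..p}" "j \<in> {1..k}" for s t h i j
  proof -
    have "j \<noteq> m" using that Suc by auto
    then show ?thesis
      by (simp only: hte_slots_def prod.case grid_weight_def merge_grid[OF that] if_False x'_def p_def[symmetric])
  qed
  have w2: "?W (?m s t h) (i, Suc k) = ?cw s t h i" if "i \<in> {1..p}" for s t h i
  proof -
    have m: "1 \<le> k \<Longrightarrow> ?m s t h (Hor i k) = s (Hor i k)" "?m s t h (Hor r m) = h (Hor r m)"
      "i \<noteq> p \<Longrightarrow> ?m s t h (Ver i (Suc k)) = t (Ver i (Suc k))" "i \<noteq> 1 \<Longrightarrow> ?m s t h (Ver (i - 1) (Suc k)) = t (Ver (i - 1) (Suc k))" for r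
      using that Suc by (auto simp: merge_def grid_edges_def col_edges_def)
    then show ?thesis using Suc by (auto simp: hte_slots_def x'_def p_def)
  qed
  let ?xs = "map x [1..<Suc m]" and ?ys = "map y [1..<Suc m]"
  let ?T = "\<lambda>n. replicate n True" and ?F = "\<lambda>n. replicate n False"
  have up: "[1..<Suc p] = [1..<m + 1] @ [m + 1..<m + m + 1]"
  proof -
    have eqs: "Suc p = (m + 1) + m" "m + m + 1 = (m + 1) + m" by (simp_all add: p_def)
    show ?thesis unfolding eqs by (rule upt_add_eq_append) simp
  qed
  have xs: "map x' [1..<Suc p] = ?xs @ rev ?xs"
  proof -
    have "map x' [1..<m + 1] = ?xs" by (auto simp: x'_def intro!: nth_equalityI arg_cong[where f = x] simp del: upt_Suc)
    moreover have "map x' [m + 1..<m + m + 1] = map (\<lambda>i. x (m + m + 1 - i)) [m + 1..<m + m + 1]"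
      by (auto simp: x'_def mult_2 intro!: arg_cong[where f = x] simp del: upt_Suc)
    ultimately show ?thesis unfolding up map_append map_reverse_upt by simp
  qed
  have bs: "map (?b h) [1..<Suc p] = map h hs @ rev (map Not (map h hs))" for h
  proof -
    have "map (?b h) [1..<m + 1] = map h hs" by (auto simp: hs_def simp del: upt_Suc)
    moreover have "map (?b h) [m + 1..<m + m + 1] = map (\<lambda>i. \<not> h (Hor (m + m + 1 - i) m)) [m + 1..<m + m + 1]"
      by (auto simp: mult_2 simp del: upt_Suc)
    ultimately show ?thesis
      unfolding up map_append map_reverse_upt[of "\<lambda>i. \<not> h (Hor i m)" m m] by (simp add: hs_def comp_def del: upt_Suc)
  qed
  have "Z_HT_even a m x y = (\<Sum>s\<in>states ?E. \<Sum>t\<in>states ?C. \<Sum>h\<in>states (set hs). \<Prod>v\<in>{1..p} \<times> {1..Suc k}. ?W (?m s t h) v)"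
  proof -
    have "Z_HT_even a m x y = (\<Sum>s\<in>states (?E \<union> (?C \<union> set hs)). \<Prod>v\<in>{1..2 * m} \<times> {1..m}. ?W s v)"
      unfolding Z_HT_even_def E[symmetric] by (rule pf_eq_sum_states[OF _ fin]) simp
    also have "{1..2 * m} \<times> {1..m} = {1..p} \<times> {1..Suc k}" by (simp only: Suc p_def)
    finally show ?thesis unfolding sum_states_Un[OF disj(1)] sum_states_Un[OF disj(2)] .
  qed
  also have "\<dots> = (\<Sum>s\<in>states ?E. \<Sum>t\<in>states ?C. \<Sum>h\<in>states (set hs). (\<Prod>j\<in>{1..k}. \<Prod>i\<in>{1..p}. grid_weight p x' y 1 (\<lambda>_. True) s i j) * (\<Prod>i\<in>{1..p}. ?cw s t h i))"
    unfolding prod_grid_vertices by (intro sum.cong refl arg_cong2[where f = "(*)"] prod.cong w1 w2)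
  \<comment> \<open>The U-turn edges move outermost: for fixed \<open>h\<close> the right boundary
    \<open>?b h\<close> is constant.\<close>
  also have "\<dots> = (\<Sum>s\<in>states ?E. \<Sum>h\<in>states (set hs). \<Sum>t\<in>states ?C. (\<Prod>j\<in>{1..k}. \<Prod>i\<in>{1..p}. grid_weight p x' y 1 (\<lambda>_. True) s i j) * (\<Prod>i\<in>{1..p}. ?cw s t h i))"
    by (intro sum.cong refl sum.swap)
  also have "\<dots> = (\<Sum>h\<in>states (set hs). \<Sum>s\<in>states ?E. \<Sum>t\<in>states ?C. (\<Prod>j\<in>{1..k}. \<Prod>i\<in>{1..p}. grid_weight p x' y 1 (\<lambda>_. True) s i j) * (\<Prod>i\<in>{1..p}. ?cw s t h i))"
    by (rule sum.swap)
  also have "\<dots> = (\<Sum>h\<in>states (set hs). grid (map x' [1..<Suc p]) (map y [1..<Suc (Suc k)]) (?T (Suc k)) (?T p) (map (?b h) [1..<Suc p]) (?F (Suc k)))"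
    by (intro sum.cong refl sum_states_last_col) (simp add: p_def Suc)
  also have "\<dots> = (\<Sum>h\<in>states (set hs). (\<lambda>es. grid (?xs @ rev ?xs) ?ys (?T m) (?T p) (es @ rev (map Not es)) (?F m)) (map h hs))"
    unfolding xs bs Suc[symmetric] ..
  also have "\<dots> = (\<Sum>es\<in>bools (length hs). grid (?xs @ rev ?xs) ?ys (?T m) (?T p) (es @ rev (map Not es)) (?F m))"
    by (rule sum_states_list) (auto simp: hs_def distinct_map inj_on_def simp del: upt_Suc)
  also have "\<dots> = (\<Sum>es\<in>bools m. \<Sum>ds\<in>bools m. block ?xs ?ys es ds * block (map inverse ?xs) (map inverse ?ys) (map Not es) (map Not ds))"
  proof (intro sum.cong)
    show "bools (length hs) = bools m" by (simp add: hs_def del: upt_Suc)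
    fix es assume "es \<in> bools m"
    then have es: "length es = m" by simp
    have Tp: "?T p = ?T m @ ?T m" by (simp add: p_def mult_2 replicate_add)
    have "grid (?xs @ rev ?xs) ?ys (?T m) (?T p) (es @ rev (map Not es)) (?F m) =
        (\<Sum>ds\<in>bools (length ?ys). grid ?xs ?ys (?T m) (?T m) es ds * grid (rev ?xs) ?ys ds (?T m) (rev (map Not es)) (?F m))"
      unfolding Tp using es by (intro grid_append_row) (simp_all del: upt_Suc)
    also have "\<dots> = (\<Sum>ds\<in>bools m. block ?xs ?ys es ds * block (map inverse ?xs) (map inverse ?ys) (map Not es) (map Not ds))"
    proof (intro sum.cong)
      show "bools (length ?ys) = bools m" by (simp del: upt_Suc)
      fix ds assume ds: "ds \<in> bools m"
      \<comment> \<open>The reflection is applied to inverted parameters, so that it returns the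
        original ones.\<close>
      have "grid (rev ?xs) ?ys ds (?T m) (rev (map Not es)) (?F m) = block (map inverse ?xs) (map inverse ?ys) (map Not es) (map Not ds)"
        using grid_reflect[of "?T m" "map inverse ?ys" "map Not ds" "?T m" "map inverse ?xs" "map Not es"] ds es
        unfolding map_inverse_inverse map_Not_map_Not by (simp add: block_def del: upt_Suc)
      then show "grid ?xs ?ys (?T m) (?T m) es ds * grid (rev ?xs) ?ys ds (?T m) (rev (map Not es)) (?F m) =
         block ?xs ?ys es ds * block (map inverse ?xs) (map inverse ?ys) (map Not es) (map Not ds)"
        by (simp add: block_def del: upt_Suc)
    qed
    finally show "grid (?xs @ rev ?xs) ?ys (?T m) (?T p) (es @ rev (map Not es)) (?F m) =
      (\<Sum>ds\<in>bools m. block ?xs ?ys es ds * block (map inverse ?xs) (map inverse ?ys) (map Not es) (map Not ds))" .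
  qed
  finally show ?thesis by (simp add: Z_even_alt del: upt_Suc)
qed

text \<open>Columns 1 to \<open>m\<close> form a rectangle, and the half column \<open>m + 1\<close>
  is attached on its right. After a cut below the middle row the half column becomes the last column
  of the lower half.\<close>

lemma Z_HT_odd_eq_Z_odd:
  "Z_HT_odd a m x y = (\<Sum>s\<in>UNIV. Z_odd s (map x [1..<Suc m]) (x (Suc m)) (map y [1..<Suc m]) (y (Suc m)))"
proof (cases m)
  case 0
  have "hto_edges 0 = {}" "hto_vertices 0 = {}" by (auto simp: hto_edges_def hto_vertices_def)
  then show ?thesis using 0 by (simp add: Z_HT_odd_def pf_def Z_odd_alt block_def UNIV_bool)
next
  case (Suc k)
  define p where "p = 2 * m + 1"
  define x' where "x' r = x (min r (2 * m + 2 - r))" for r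
  let ?X = "x (Suc m)" and ?Y = "y (Suc m)"
  let ?E = "grid_edges p 1 m" and ?C = "{Ver i (m + 1) | i. m + 2 \<le> i \<and> i < p}"
  have E: "hto_edges m = ?E \<union> ?C"
  proof (rule Set.set_eqI)
    fix e show "e \<in> hto_edges m \<longleftrightarrow> e \<in> ?E \<union> ?C"
      by (cases e) (auto simp: hto_edges_def grid_edges_def p_def)
  qed
  have disj: "?E \<inter> ?C = {}" by (auto simp: grid_edges_def)
  have "?C \<subseteq> (\<lambda>i. Ver i (m + 1)) ` {..p}" by auto
  then have "finite ?C" by (rule finite_subset) auto
  then have fin: "finite (hto_edges m)" unfolding E using finite_grid_edges by blast
  let ?W = "\<lambda>s v. case hto_slots m s v of (L, R, U, D) \<Rightarrow> vweight a ((\<lambda>(r, j). x (min r (2 * m + 2 - r)) * inverse (y j)) v) L R U D"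
  let ?cw = "\<lambda>s t i. vweight a (x' i * inverse ?Y) (s (Hor i m)) (\<not> s (Hor (2 * m + 2 - i) m))
         (if i = m + 2 then \<not> s (Hor (m + 1) m) else t (Ver (i - 1) (m + 1))) (if i = p then False else t (Ver i (m + 1)))"
  have w1: "?W (merge ?E s t) (i, j) = grid_weight p x' y 1 (\<lambda>_. True) s i j" if "i \<in> {1..p}" "j \<in> {1..m}" for s t i j
  proof -
    have "j \<noteq> m + 1" using that by auto
    then show ?thesis
      by (simp only: hto_slots_def prod.case grid_weight_def merge_grid[OF that] if_False x'_def p_def[symmetric])
  qed
  have w2: "?W (merge ?E s t) (i, m + 1) = ?cw s t i" if "i \<in> {m + 2..p}" for s t i
  proof -
    have "merge ?E s t (Hor r m) = s (Hor r m)" if "r \<in> {1..p}" for r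
      using that Suc by (auto simp: merge_def grid_edges_def)
    moreover have "i \<in> {1..p}" "2 * m + 2 - i \<in> {1..p}" "m + 1 \<in> {1..p}"
      using that by (auto simp: p_def)
    moreover have "merge ?E s t (Ver r (m + 1)) = t (Ver r (m + 1))" for r
      by (auto simp: merge_def grid_edges_def)
    ultimately show ?thesis
      by (simp only: hto_slots_def prod.case if_True simp_thms x'_def p_def[symmetric] Suc_eq_plus1)
  qed
  let ?xs = "map x [1..<Suc m]" and ?ys = "map y [1..<Suc m]"
  let ?T = "\<lambda>n. replicate n True" and ?F = "\<lambda>n. replicate n False"
  have up: "[1..<Suc p] = [1..<m + 1] @ [m + 1] @ [m + 2..<Suc p]"
  proof -
    have "Suc p = (m + 1) + Suc m" by (simp add: p_def)
    then have "[1..<Suc p] = [1..<(m + 1) + Suc m]" by (simp only:)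
    also have "\<dots> = [1..<m + 1] @ [m + 1..<(m + 1) + Suc m]" by (rule upt_add_eq_append) simp
    also have "[m + 1..<(m + 1) + Suc m] = (m + 1) # [m + 2..<Suc p]"
      by (simp add: upt_conv_Cons p_def mult_2 del: upt_Suc)
    finally show ?thesis by simp
  qed
  have rev_upt: "map (\<lambda>i. f (2 * m + 2 - i)) [m + 2..<Suc p] = rev (map f [1..<m + 1])" for f :: "nat \<Rightarrow> 'z"
    using map_reverse_upt[of f "m + 1" m] by (simp add: p_def mult_2 del: upt_Suc)
  have low: "map x' [m + 2..<Suc p] = rev ?xs"
  proof -
    have "map x' [m + 2..<Suc p] = map (\<lambda>i. x (2 * m + 2 - i)) [m + 2..<Suc p]"
      by (auto simp: x'_def intro!: arg_cong[where f = x] simp del: upt_Suc)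
    then show ?thesis unfolding rev_upt by simp
  qed
  have xs: "map x' [1..<Suc p] = (?xs @ [?X]) @ rev ?xs"
  proof -
    have "map x' [1..<m + 1] = ?xs" by (auto simp: x'_def intro!: nth_equalityI arg_cong[where f = x] simp del: upt_Suc)
    then show ?thesis unfolding up map_append low by (simp add: x'_def)
  qed
  \<comment> \<open>\<open>ks\<close> lists the right edges of the rectangle from the top, counted
    from 0. Entry \<open>m\<close> is the middle row, which turns down into the half column and is
    negated because True means up there; the first \<open>m\<close> entries come back through the
    U-turns, reversed and negated.\<close>
  define g where "g ks = col (map (\<lambda>x. x * inverse ?Y) (rev ?xs)) (\<not> ks ! m) (drop (m + 1) ks) (map Not (rev (take m ks))) False" for ks
  have colsum: "(\<Sum>t\<in>states ?C. \<Prod>i\<in>{m + 2..p}. ?cw s t i) = g (map (\<lambda>i. s (Hor i m)) [1..<Suc p])" for s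
  proof -
    have "(\<Sum>t\<in>states ?C. \<Prod>i\<in>{m + 2..p}. ?cw s t i) = col (map (\<lambda>i. x' i * inverse ?Y) [m + 2..<Suc p]) (\<not> s (Hor (m + 1) m))
       (map (\<lambda>i. s (Hor i m)) [m + 2..<Suc p]) (map (\<lambda>i. \<not> s (Hor (2 * m + 2 - i) m)) [m + 2..<Suc p]) False"
      by (rule sum_states_col) (simp add: p_def Suc)
    moreover have "map (\<lambda>i. x' i * inverse ?Y) [m + 2..<Suc p] = map (\<lambda>x. x * inverse ?Y) (rev ?xs)"
      unfolding low[symmetric] by simp
    moreover have "map (\<lambda>i. \<not> s (Hor (2 * m + 2 - i) m)) [m + 2..<Suc p] = map Not (rev (map (\<lambda>i. s (Hor i m)) [1..<m + 1]))"
      unfolding rev_upt[of "\<lambda>i. \<not> s (Hor i m)"] by (simp add: rev_map comp_def)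
    ultimately show ?thesis unfolding g_def up by (simp add: nth_append del: upt_Suc)
  qed
  have "Z_HT_odd a m x y = (\<Sum>s\<in>states ?E. \<Sum>t\<in>states ?C. \<Prod>v\<in>hto_vertices m. ?W (merge ?E s t) v)"
  proof -
    have "Z_HT_odd a m x y = (\<Sum>s\<in>states (?E \<union> ?C). \<Prod>v\<in>hto_vertices m. ?W s v)"
      unfolding Z_HT_odd_def E[symmetric] by (rule pf_eq_sum_states[OF _ fin]) (simp add: hto_vertices_def)
    then show ?thesis unfolding sum_states_Un[OF disj] .
  qed
  also have "\<dots> = (\<Sum>s\<in>states ?E. \<Sum>t\<in>states ?C. (\<Prod>j\<in>{1..m}. \<Prod>i\<in>{1..p}. grid_weight p x' y 1 (\<lambda>_. True) s i j) * (\<Prod>i\<in>{m + 2..p}. ?cw s t i))"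
  proof (intro sum.cong refl)
    fix s t
    have "(\<Prod>v\<in>hto_vertices m. ?W (merge ?E s t) v) =
        (\<Prod>v\<in>{1..p} \<times> {1..m}. ?W (merge ?E s t) v) * (\<Prod>v\<in>{m + 2..p} \<times> {m + 1}. ?W (merge ?E s t) v)"
      unfolding hto_vertices_def p_def by (rule prod.union_disjoint) auto
    also have "(\<Prod>v\<in>{1..p} \<times> {1..m}. ?W (merge ?E s t) v) = (\<Prod>i\<in>{1..p}. \<Prod>j\<in>{1..m}. ?W (merge ?E s t) (i, j))"
      unfolding prod.cartesian_product by (rule prod.cong) auto
    also have "\<dots> = (\<Prod>j\<in>{1..m}. \<Prod>i\<in>{1..p}. ?W (merge ?E s t) (i, j))" by (rule prod.swap)
    also have "\<dots> = (\<Prod>j\<in>{1..m}. \<Prod>i\<in>{1..p}. grid_weight p x' y 1 (\<lambda>_. True) s i j)"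
      by (intro prod.cong refl w1)
    also have "(\<Prod>v\<in>{m + 2..p} \<times> {m + 1}. ?W (merge ?E s t) v) = (\<Prod>i\<in>{m + 2..p}. \<Prod>j\<in>{m + 1}. ?W (merge ?E s t) (i, j))"
      unfolding prod.cartesian_product by (rule prod.cong) auto
    also have "\<dots> = (\<Prod>i\<in>{m + 2..p}. ?W (merge ?E s t) (i, m + 1))" by (rule prod.cong) simp_all
    also have "\<dots> = (\<Prod>i\<in>{m + 2..p}. ?cw s t i)" by (intro prod.cong refl w2)
    finally show "(\<Prod>v\<in>hto_vertices m. ?W (merge ?E s t) v) =
      (\<Prod>j\<in>{1..m}. \<Prod>i\<in>{1..p}. grid_weight p x' y 1 (\<lambda>_. True) s i j) * (\<Prod>i\<in>{m + 2..p}. ?cw s t i)" .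
  qed
  also have "\<dots> = (\<Sum>s\<in>states ?E. (\<Prod>j\<in>{1..m}. \<Prod>i\<in>{1..p}. grid_weight p x' y 1 (\<lambda>_. True) s i j) * g (map (\<lambda>i. s (Hor i m)) [1..<Suc p]))"
    unfolding sum_distrib_left[symmetric] colsum ..
  also have "\<dots> = (\<Sum>ks\<in>bools p. grid (map x' [1..<Suc p]) ?ys (?T m) (?T p) ks (?F m) * g ks)"
  proof -
    have "map (\<lambda>_. True) [1..<Suc p] = ?T p" by (simp add: map_replicate_const del: upt_Suc)
    moreover have "1 \<le> m" "1 \<le> Suc m" "1 \<le> p" by (simp_all add: Suc p_def)
    ultimately show ?thesis
      using sum_states_grid[of 1 m p x' y "\<lambda>_. True" g] by (simp only: if_True diff_Suc_1)
  qed
  also have "\<dots> = (\<Sum>es\<in>bools m. \<Sum>s\<in>UNIV. \<Sum>ks\<in>bools m. grid ((?xs @ [?X]) @ rev ?xs) ?ys (?T m) (?T (Suc m) @ ?T m) ((es @ [s]) @ ks) (?F m) *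
      g ((es @ [s]) @ ks))"
  proof -
    have "p = Suc m + m" by (simp add: p_def)
    then show ?thesis unfolding xs by (simp only: sum_bools_append sum_bools_snoc replicate_add)
  qed
  also have "\<dots> = (\<Sum>es\<in>bools m. \<Sum>s\<in>UNIV. \<Sum>ds\<in>bools m. block (?xs @ [?X]) ?ys (es @ [s]) ds *
     block (map inverse ?xs) (map inverse (?ys @ [?Y])) (map Not es) (map Not ds @ [s]))"
  proof (rule sum.cong[OF refl], rule sum.cong[OF refl])
    fix es s assume "es \<in> bools m"
    then have es: "length es = m" by simp
    let ?c = "\<lambda>ks. col (map (\<lambda>x. x * inverse ?Y) (rev ?xs)) (\<not> s) ks (rev (map Not es)) False"
    let ?A = "\<lambda>ds. block (?xs @ [?X]) ?ys (es @ [s]) ds"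
    let ?G = "\<lambda>ds ks. grid (rev ?xs) ?ys ds (?T m) ks (?F m)"
    have gk: "g ((es @ [s]) @ ks) = ?c ks" for ks
      using es by (simp add: g_def nth_append rev_map del: upt_Suc)
    have "(\<Sum>ks\<in>bools m. grid ((?xs @ [?X]) @ rev ?xs) ?ys (?T m) (?T (Suc m) @ ?T m) ((es @ [s]) @ ks) (?F m) * g ((es @ [s]) @ ks)) =
      (\<Sum>ks\<in>bools m. (\<Sum>ds\<in>bools m. ?A ds * ?G ds ks) * ?c ks)"
    proof (intro sum.cong refl arg_cong2[where f = "(*)"] gk)
      fix ks assume "ks \<in> bools m"
      then show "grid ((?xs @ [?X]) @ rev ?xs) ?ys (?T m) (?T (Suc m) @ ?T m) ((es @ [s]) @ ks) (?F m) = (\<Sum>ds\<in>bools m. ?A ds * ?G ds ks)"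
        using es grid_append_row[of "?T m" ?ys "?F m" "?T (Suc m)" "?xs @ [?X]" "es @ [s]" "?T m" "rev ?xs" ks]
        by (simp add: block_def del: upt_Suc replicate.simps append_assoc)
    qed
    also have "\<dots> = (\<Sum>ds\<in>bools m. ?A ds * (\<Sum>ks\<in>bools m. ?G ds ks * ?c ks))"
      unfolding sum_distrib_left sum_distrib_right mult.assoc by (rule sum.swap)
    also have "\<dots> = (\<Sum>ds\<in>bools m. ?A ds * block (map inverse ?xs) (map inverse (?ys @ [?Y])) (map Not es) (map Not ds @ [s]))"
    proof (intro sum.cong refl arg_cong2[where f = "(*)"])
      fix ds assume "ds \<in> bools m"
      then have ds: "length ds = m" by simp
      \<comment> \<open>The half column joins the lower half with top edge \<open>\<not> s\<close>;
        reflection turns this into the lower edge \<open>s\<close>.\<close>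
      have "(\<Sum>ks\<in>bools m. ?G ds ks * ?c ks) = (\<Sum>ks\<in>bools (length (rev ?xs)). ?G ds ks * grid (rev ?xs) [?Y] [\<not> s] ks (rev (map Not es)) [False])"
        using es by (simp only: length_rev length_map length_upt diff_Suc_1)
          (intro sum.cong refl, subst grid_single_col, simp_all del: upt_Suc)
      also have "\<dots> = grid (rev ?xs) (?ys @ [?Y]) (ds @ [\<not> s]) (?T m) (rev (map Not es)) (?F m @ [False])"
        using ds es by (intro grid_append_col[symmetric]) (simp_all del: upt_Suc)
      also have "\<dots> = block (map inverse ?xs) (map inverse (?ys @ [?Y])) (map Not es) (map Not ds @ [s])"
        using grid_reflect[of "?T (Suc m)" "map inverse (?ys @ [?Y])" "map Not ds @ [s]" "?T m" "map inverse ?xs" "map Not es"] ds es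
        unfolding map_inverse_inverse map_append map_Not_map_Not
        by (simp add: block_def replicate_append_same del: upt_Suc)
      finally show "(\<Sum>ks\<in>bools m. ?G ds ks * ?c ks) = block (map inverse ?xs) (map inverse (?ys @ [?Y])) (map Not es) (map Not ds @ [s])" .
    qed
    finally show "(\<Sum>ks\<in>bools m. grid ((?xs @ [?X]) @ rev ?xs) ?ys (?T m) (?T (Suc m) @ ?T m) ((es @ [s]) @ ks) (?F m) * g ((es @ [s]) @ ks)) =
       (\<Sum>ds\<in>bools m. ?A ds * block (map inverse ?xs) (map inverse (?ys @ [?Y])) (map Not es) (map Not ds @ [s]))" .
  qed
  also have "\<dots> = (\<Sum>s\<in>UNIV. Z_odd s ?xs ?X ?ys ?Y)"
    unfolding Z_odd_alt length_map length_upt diff_Suc_1 by (rule sum.swap)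
  finally show ?thesis .
qed

end

section \<open>Excluded values of \<open>a\<close> and the sum of the two identities\<close>

text \<open>The first row begins pointing right and ends pointing left below upward edges, so the
  only way to change direction is a vertex of type 1, of weight 0. Thus a nonzero
  \<open>Z_dw\<close> supplies the locale assumption on \<open>a\<close>.\<close>

lemma Z_dw_degenerate:
  assumes "sigma (a\<^sup>2) = 0" "1 \<le> n"
  shows "Z_dw a n x y = 0"
  unfolding Z_dw_def pf_def
proof (rule sum.neutral, rule ballI)
  fix s
  let ?w = "\<lambda>v. case dw_slots n s v of (L, R, U, D) \<Rightarrow> vweight a ((\<lambda>(i, j). x i * inverse (y j)) v) L R U D"
  have flip: "vweight a z True False U D = 0" for z U D
    using assms(1) by (simp add: vweight_def)
  show "(\<Prod>v\<in>{1..n} \<times> {1..n}. ?w v) = 0"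
  proof (rule ccontr)
    assume "(\<Prod>v\<in>{1..n} \<times> {1..n}. ?w v) \<noteq> 0"
    then have nz: "?w (1, j) \<noteq> 0" if "j \<in> {1..n}" for j
      using that assms(2) by (auto simp: prod_zero_iff simp del: One_nat_def)
    have right: "s (Hor 1 j)" if "1 \<le> j" "j < n" for j
      using that
    proof (induction j rule: nat_induct_at_least)
      case base
      then show ?case using nz[of 1] by (cases "s (Hor 1 1)") (auto simp: dw_slots_def flip)
    next
      case (Suc j)
      then show ?case using nz[of "Suc j"] by (cases "s (Hor 1 (Suc j))") (auto simp: dw_slots_def flip)
    qed
    show False
    proof (cases "n = 1")
      case True
      then show False using nz[of 1] by (simp add: dw_slots_def flip)
    next
      case False
      then show False using nz[of n] right[of "n - 1"] assms(2) by (auto simp: dw_slots_def flip)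
    qed
  qed
qed

theorem theorem1:
  fixes a :: complex and x y :: "nat \<Rightarrow> complex" and m :: nat
  assumes "a \<noteq> 0" and "sigma a \<noteq> 0"
    and "\<forall>i\<in>{1..m+1}. x i \<noteq> 0" and "\<forall>j\<in>{1..m+1}. y j \<noteq> 0"
    and "a * x (m+1) + y (m+1) \<noteq> 0" and "a * y (m+1) + x (m+1) \<noteq> 0"
    and "Z_dw a m x y \<noteq> 0" and "Z_dw a (m+1) x y \<noteq> 0"
  shows "Z_HT_odd a m x y =
    a * x (m+1) * y (m+1) / (sigma a * (a * x (m+1) + y (m+1)) * (a * y (m+1) + x (m+1)))
    * (Z_dw a (m+1) x y * Z_HT2 a m x y + Z_dw a m x y * Z_HT2 a (m+1) x y)"
proof -
  have "sigma (a\<^sup>2) \<noteq> 0"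
    using Z_dw_degenerate[of a "m + 1" x y] assms(8) by auto
  then interpret six_vertex a by unfold_locales (use assms(1) in auto)
  let ?xs = "map x [1..<Suc m]" and ?ys = "map y [1..<Suc m]"
  define X where "X = x (m + 1)"
  define Y where "Y = y (m + 1)"
  define O1 where "O1 = Z_odd True ?xs X ?ys Y"
  define O0 where "O0 = Z_odd False ?xs X ?ys Y"
  define Z where "Z = Z_dw a m x y"
  define Z' where "Z' = Z_dw a (m + 1) x y"
  define H where "H = Z_HT_even a m x y"
  define H' where "H' = Z_HT_even a (m + 1) x y"
  have nz: "X \<noteq> 0" "Y \<noteq> 0" "nonzero ?xs" "nonzero ?ys" "Z \<noteq> 0" "Z' \<noteq> 0"
    using assms by (auto simp: X_def Y_def Z_def Z'_def simp del: upt_Suc)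
  have snoc: "map z [1..<Suc (m + 1)] = map z [1..<Suc m] @ [z (m + 1)]" for z :: "nat \<Rightarrow> complex"
    by simp
  have eqs: "Z = Z_dom ?xs ?ys" "Z' = Z_dom (?xs @ [X]) (?ys @ [Y])" "H = Z_even ?xs ?ys" "H' = Z_even (?xs @ [X]) (?ys @ [Y])"
    unfolding Z_def Z'_def H_def H'_def X_def Y_def Z_dw_eq_Z_dom Z_HT_even_eq_Z_even snoc by (rule refl)+
  let ?t = "X * inverse Y + Y * inverse X" and ?s = "a + inverse a"
  have "Z * (sigma a * (?t * O0 + ?s * O1)) = Z' * H"
    using defect_zero[of ?xs m ?ys X Y False] nz
    by (simp add: defect_def odd_comb_def eqs O0_def O1_def del: upt_Suc)
  then have 1: "Z' * (H / Z) = sigma a * (?t * O0 + ?s * O1)"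
    using nz by (simp add: field_simps)
  have "Z' * (sigma a * (?t * O1 + ?s * O0)) = Z * H'"
    using defect_zero[of ?xs m ?ys X Y True] nz
    by (simp add: defect_def odd_comb_def eqs O0_def O1_def del: upt_Suc)
  then have 2: "Z * (H' / Z') = sigma a * (?t * O1 + ?s * O0)"
    using nz by (simp add: field_simps)
  \<comment> \<open>In the sum of the identities \<open>O0\<close> and \<open>O1\<close> have the
    same coefficient, so only their total remains.\<close>
  have "Z' * (H / Z) + Z * (H' / Z') = sigma a * (?t + ?s) * (O0 + O1)"
    unfolding 1 2 by (simp add: algebra_simps)
  \<comment> \<open>Up to a monomial, the denominator in the theorem is this common
    coefficient.\<close>
  moreover have "(a * X + Y) * (a * Y + X) = a * X * Y * (?t + ?s)"
    using nz assms(1) by (simp add: field_simps)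
  moreover have "?t + ?s \<noteq> 0"
    using assms(5,6) calculation(2) by (auto simp: X_def Y_def)
  ultimately have "a * X * Y / (sigma a * ((a * X + Y) * (a * Y + X))) * (Z' * (H / Z) + Z * (H' / Z')) = O0 + O1"
    using nz assms(1,2) by simp
  moreover have "Z_HT_odd a m x y = O0 + O1"
    unfolding Z_HT_odd_eq_Z_odd O0_def O1_def X_def Y_def by (simp add: UNIV_bool del: upt_Suc)
  ultimately show ?thesis
    by (simp add: Z_HT2_def X_def Y_def Z_def Z'_def H_def H'_def mult.assoc)
qed

end
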